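(* Let $G$ be the wiring diagram of an expression $s_{i_1}\cdots s_{i_m}$ in the generators of $\mathfrak S_n$ and let $\lambda\vdash n$. Then $$\epsilon_q^\lambda\big((1+T_{s_{i_1}})\cdots(1+T_{s_{i_m}})\big)=\sum_W q^{\mathrm{incross}(W)+\mathrm{cross}(W)/2},$$ where the sum is over all column-strict $G$-tableaux $W$ of type $e$ and shape $\lambda^{\top}$ (the conjugate partition of $\lambda$).
   Context: The Hecke algebra $H_n(q)$ is the unital algebra over $\mathbb Z[q^{1/2},q^{-1/2}]$ generated by $T_{s_1},\dots,T_{s_{n-1}}$ with $T_{s_i}^2=(q-1)T_{s_i}+qT_e$, $T_{s_i}T_{s_j}T_{s_i}=T_{s_j}T_{s_i}T_{s_j}$ for $|i-j|=1$, $T_{s_i}T_{s_j}=T_{s_j}T_{s_i}$ for $|i-j|\ge2$; $1=T_e$. For $\lambda=(\lambda_1,\dots,\lambda_r)\vdash n$, $\epsilon_q^\lambda$ is the induced sign character of $H_n(q)$: the character induced from the one-dimensional representation of the parabolic subalgebra generated by the $T_{s_i}$ with $i\notin\{\lambda_1,\lambda_1+\lambda_2,\dots,\lambda_1+\dots+\lambda_{r-1}\}$ in which each such $T_{s_i}$ acts by $-1$ (the $q$-analogue of the induced sign character $\epsilon^\lambda$ of $\mathfrak S_n$). Wiring diagram $G$ of $s_{i_1}\cdots s_{i_m}$ (not necessarily reduced): left-to-right concatenation of elementary diagrams $G_1..G_m$, each with $n$ levels numbered $1..n$ bottom to top, where in $G_j$ each level $h\notin\{i_j,i_j+1\}$ is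 a horizontal edge and levels $i_j,i_j+1$ meet at a central vertex $c_j$ (two edges in from the left ends of these levels, two edges out to their right ends); edges oriented left to right, sources $1..n$ at the left, sinks $1..n$ at the right. A path family covering $G$ is $\pi=(\pi_1,\dots,\pi_n)$ with $\pi_i$ a path from source $i$ to some sink $v_i$, using each edge of $G$ exactly once; its type is $v=v_1\cdots v_n$ ($e$ = identity). At $c_j$ two paths meet; $j$ is a crossing if the path entering from level $i_j$ leaves on level $i_j+1$ (and vice versa), otherwise a noncrossing; $\mathrm{cross}(\pi)$ is the number of crossings. A $G$-tableau of shape $\mu$ is a filling of the Young diagram of $\mu$ (French convention) with the $n$ paths of some covering path family $\pi$, each used once; its type is the type of $\pi$, and $\mathrm{cross}(W)=\mathrm{cross}(\pi)$. A $G$-tableau of type $e$ is column-strict if in each column the source indices of the paths strictly increase from bottom to top. $\mathrm{incross}(W)$ is the number of noncrossings $j$ of $\pi$ such that the path entering $c_j$ from level $i_j+1$ lies in a column of $W$ strictly to the left of the column containing the path entering $c_j$ from level $i_j$.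
   Formalization: Column-strict is taken to require also that paths in the same column share no vertex (each lies entirely below those above it); with increasing source indices alone the identity fails, e.g. n=2, expression s_1, λ=(2), where the character is 0 but the sum is 1. *)

theory Defs
  imports
    "Graph_Theory.Vertex_Walk"
    "HOL-Algebra.QuotRing"
    "HOL-Algebra.Generated_Rings"
    "HOL-Algebra.Free_Abelian_Groups"
    "HOL-Algebra.Module"
begin

section \<open>The ground ring\<close>

text \<open>Laurent polynomials over the integers in the indeterminate \<open>q^(1/2)\<close>:
  the key \<open>k\<close> is the exponent of \<open>q^(1/2)\<close>, and multiplication is convolution.\<close>

type_synonym laurent = "int \<Rightarrow>\<^sub>0 int"

definition q_half :: laurent where
  "q_half = Poly_Mapping.single 1 1"

definition q :: laurent where
  "q = q_half ^ 2"

definition laurent_ring :: "laurent ring" where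
  "laurent_ring = \<lparr>carrier = UNIV, mult = (*), one = 1, ring.zero = 0, add = (+)\<rparr>"


section \<open>The Hecke algebra by generators and relations\<close>

text \<open>The free monoid is written additively, so that finitely supported functions on it,
  with the convolution product, form the free associative algebra.\<close>

datatype word = Word (letters: "nat list")

instantiation word :: monoid_add
begin

definition zero_word :: word where
  "0 = Word []"

definition plus_word :: "word \<Rightarrow> word \<Rightarrow> word" where
  "u + v = Word (letters u @ letters v)"

instance
  by standard (simp_all add: zero_word_def plus_word_def)

end

type_synonym free_alg = "word \<Rightarrow>\<^sub>0 laurent"

definition gen :: "nat \<Rightarrow> free_alg" where
  "gen i = Poly_Mapping.single (Word [i]) 1"

definition scal :: "laurent \<Rightarrow> free_alg" where
  "scal c = Poly_Mapping.single 0 c"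

definition free_algebra :: "nat \<Rightarrow> free_alg ring" where
  "free_algebra n =
    \<lparr>carrier = {p. \<forall>w \<in> Poly_Mapping.keys p. set (letters w) \<subseteq> {1..<n}},
     mult = (*), one = 1, ring.zero = 0, add = (+)\<rparr>"

definition hecke_relations :: "nat \<Rightarrow> free_alg set" where
  "hecke_relations n =
    {gen i * gen i - (scal (q - 1) * gen i + scal q) | i. i \<in> {1..<n}} \<union>
    {gen i * gen j * gen i - gen j * gen i * gen j | i j.
       i \<in> {1..<n} \<and> j \<in> {1..<n} \<and> \<bar>int i - int j\<bar> = 1} \<union>
    {gen i * gen j - gen j * gen i | i j.
       i \<in> {1..<n} \<and> j \<in> {1..<n} \<and> \<bar>int i - int j\<bar> \<ge> 2}"

definition hecke_ideal :: "nat \<Rightarrow> free_alg set" where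
  "hecke_ideal n = genideal (free_algebra n) (hecke_relations n)"

definition hecke :: "nat \<Rightarrow> free_alg set ring" where
  "hecke n = free_algebra n Quot hecke_ideal n"

definition T :: "nat \<Rightarrow> nat \<Rightarrow> free_alg set" where
  "T n i = hecke_ideal n +>\<^bsub>free_algebra n\<^esub> gen i"

definition hecke_scalar :: "nat \<Rightarrow> laurent \<Rightarrow> free_alg set" where
  "hecke_scalar n c = hecke_ideal n +>\<^bsub>free_algebra n\<^esub> scal c"

definition one_plus_T_product :: "nat \<Rightarrow> nat list \<Rightarrow> free_alg set" where
  "one_plus_T_product n is =
    foldr (\<lambda>i x. (\<one>\<^bsub>hecke n\<^esub> \<oplus>\<^bsub>hecke n\<^esub> T n i) \<otimes>\<^bsub>hecke n\<^esub> x) is \<one>\<^bsub>hecke n\<^esub>"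


section \<open>Characters of free modules of finite rank\<close>

definition module_basis :: "('r::comm_ring_1, 'm) module \<Rightarrow> nat \<Rightarrow> (nat \<Rightarrow> 'm) \<Rightarrow> bool" where
  "module_basis M k b \<longleftrightarrow>
    b \<in> {..<k} \<rightarrow> carrier M \<and>
    (\<forall>x \<in> carrier M. \<exists>!c. c \<in> {..<k} \<rightarrow>\<^sub>E UNIV \<and>
       x = (\<Oplus>\<^bsub>M\<^esub>i\<in>{..<k}. c i \<odot>\<^bsub>M\<^esub> b i))"

text \<open>The trace of the matrix of \<open>f\<close> with respect to any basis; meaningful only if \<open>M\<close> is free
  of finite rank.\<close>

definition module_trace :: "('r::comm_ring_1, 'm) module \<Rightarrow> ('m \<Rightarrow> 'm) \<Rightarrow> 'r" where
  "module_trace M f = (THE t. \<exists>k b C. module_basis M k b \<and>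
    (\<forall>j<k. f (b j) = (\<Oplus>\<^bsub>M\<^esub>i\<in>{..<k}. C i j \<odot>\<^bsub>M\<^esub> b i)) \<and>
    t = (\<Sum>i<k. C i i))"


section \<open>Induction of a one-dimensional representation\<close>

text \<open>\<open>P\<close> is a subring of \<open>H\<close> that acts on the ground ring through \<open>\<phi>\<close>. The tensor product over
  \<open>P\<close> of \<open>H\<close> with this module is the free abelian group on pairs modulo biadditivity
  and \<open>(h p) \<otimes> r = h \<otimes> (\<phi> p r)\<close>; \<open>H\<close> acts on it by multiplication on the left factor.\<close>

definition tensor_group ::
  "'h ring \<Rightarrow> (('h \<times> 'r::comm_ring_1) \<Rightarrow>\<^sub>0 int) monoid" where
  "tensor_group H = free_Abelian_group (carrier H \<times> (UNIV :: 'r set))"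

definition tensor_relations ::
  "'h ring \<Rightarrow> 'h set \<Rightarrow> ('h \<Rightarrow> 'r::comm_ring_1) \<Rightarrow> (('h \<times> 'r) \<Rightarrow>\<^sub>0 int) set" where
  "tensor_relations H P \<phi> =
    {frag_of (h \<oplus>\<^bsub>H\<^esub> h', r) - frag_of (h, r) - frag_of (h', r) | h h' r.
       h \<in> carrier H \<and> h' \<in> carrier H} \<union>
    {frag_of (h, r + r') - frag_of (h, r) - frag_of (h, r') | h r r'. h \<in> carrier H} \<union>
    {frag_of (h \<otimes>\<^bsub>H\<^esub> p, r) - frag_of (h, \<phi> p * r) | h p r. h \<in> carrier H \<and> p \<in> P}"

definition tensor_null ::
  "'h ring \<Rightarrow> 'h set \<Rightarrow> ('h \<Rightarrow> 'r::comm_ring_1) \<Rightarrow> (('h \<times> 'r) \<Rightarrow>\<^sub>0 int) set" where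
  "tensor_null H P \<phi> = generate (tensor_group H) (tensor_relations H P \<phi>)"

definition tensor_act ::
  "'h ring \<Rightarrow> 'h set \<Rightarrow> ('h \<Rightarrow> 'r::comm_ring_1) \<Rightarrow> 'h \<Rightarrow>
   (('h \<times> 'r) \<Rightarrow>\<^sub>0 int) set \<Rightarrow> (('h \<times> 'r) \<Rightarrow>\<^sub>0 int) set" where
  "tensor_act H P \<phi> g X =
    (\<Union>x\<in>X. tensor_null H P \<phi> #>\<^bsub>tensor_group H\<^esub>
       frag_extend (\<lambda>(h, r). frag_of (g \<otimes>\<^bsub>H\<^esub> h, r)) x)"

text \<open>The scalars act through the structure map \<open>\<iota>\<close> of the algebra \<open>H\<close>. The ring multiplication
  fields of a module record play no role.\<close>

definition induced_module ::
  "'h ring \<Rightarrow> ('r \<Rightarrow> 'h) \<Rightarrow> 'h set \<Rightarrow> ('h \<Rightarrow> 'r::comm_ring_1) \<Rightarrow>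
   ('r, (('h \<times> 'r) \<Rightarrow>\<^sub>0 int) set) module" where
  "induced_module H \<iota> P \<phi> =
    \<lparr>carrier = carrier (tensor_group H Mod tensor_null H P \<phi>),
     mult = undefined, one = undefined,
     ring.zero = \<one>\<^bsub>tensor_group H Mod tensor_null H P \<phi>\<^esub>,
     add = mult (tensor_group H Mod tensor_null H P \<phi>),
     smult = (\<lambda>c. tensor_act H P \<phi> (\<iota> c))\<rparr>"

definition induced_character ::
  "'h ring \<Rightarrow> ('r \<Rightarrow> 'h) \<Rightarrow> 'h set \<Rightarrow> ('h \<Rightarrow> 'r::comm_ring_1) \<Rightarrow> 'h \<Rightarrow> 'r" where
  "induced_character H \<iota> P \<phi> g =
    module_trace (induced_module H \<iota> P \<phi>) (tensor_act H P \<phi> g)"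


section \<open>Partitions and induced sign characters\<close>

definition is_partition :: "nat \<Rightarrow> nat list \<Rightarrow> bool" where
  "is_partition n \<mu> \<longleftrightarrow> sorted_wrt (\<ge>) \<mu> \<and> 0 \<notin> set \<mu> \<and> sum_list \<mu> = n"

definition conjugate :: "nat list \<Rightarrow> nat list" where
  "conjugate \<mu> = map (\<lambda>c. length (filter (\<lambda>p. c < p) \<mu>)) [0..<foldr max \<mu> 0]"

text \<open>Cells are (row, column), both counted from \<open>0\<close>; in the French convention row \<open>0\<close> is at the
  bottom.\<close>

definition young_diagram :: "nat list \<Rightarrow> (nat \<times> nat) set" where
  "young_diagram \<mu> = {(r, c). r < length \<mu> \<and> c < \<mu> ! r}"

definition parabolic_indices :: "nat \<Rightarrow> nat list \<Rightarrow> nat set" where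
  "parabolic_indices n \<mu> = {1..<n} - {sum_list (take k \<mu>) | k. 1 \<le> k \<and> k < length \<mu>}"

definition parabolic :: "nat \<Rightarrow> nat set \<Rightarrow> free_alg set set" where
  "parabolic n J = generate_ring (hecke n) (range (hecke_scalar n) \<union> T n ` J)"

definition sign_rep :: "nat \<Rightarrow> nat set \<Rightarrow> free_alg set \<Rightarrow> laurent" where
  "sign_rep n J = (THE \<phi>. \<phi> \<in> ring_hom (hecke n\<lparr>carrier := parabolic n J\<rparr>) laurent_ring \<and>
    \<phi> \<in> extensional (parabolic n J) \<and>
    (\<forall>c. \<phi> (hecke_scalar n c) = c) \<and> (\<forall>i\<in>J. \<phi> (T n i) = - 1))"

definition induced_sign_character :: "nat \<Rightarrow> nat list \<Rightarrow> free_alg set \<Rightarrow> laurent" where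
  "induced_sign_character n \<mu> =
    induced_character (hecke n) (hecke_scalar n)
      (parabolic n (parabolic_indices n \<mu>)) (sign_rep n (parabolic_indices n \<mu>))"


section \<open>Wiring diagrams and path families\<close>

text \<open>The \<open>j\<close>-th elementary diagram (counted from \<open>0\<close>) lies between the endpoints \<open>Pt j h\<close> and
  \<open>Pt (j + 1) h\<close>, where \<open>h\<close> is the level.\<close>

datatype vertex = Pt nat (level: nat) | Centre nat

definition elementary_arcs :: "nat \<Rightarrow> nat \<Rightarrow> nat \<Rightarrow> (vertex \<times> vertex) set" where
  "elementary_arcs n j i =
    {(Pt j h, Pt (Suc j) h) | h. h \<in> {1..n} - {i, i + 1}} \<union>
    {(Pt j i, Centre j), (Pt j (i + 1), Centre j),
     (Centre j, Pt (Suc j) i), (Centre j, Pt (Suc j) (i + 1))}"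

definition wiring_diagram :: "nat \<Rightarrow> nat list \<Rightarrow> (vertex, vertex \<times> vertex) pre_digraph" where
  "wiring_diagram n is =
    \<lparr>verts = {Pt j h | j h. j \<le> length is \<and> h \<in> {1..n}} \<union> {Centre j | j. j < length is},
     arcs = (\<Union>j<length is. elementary_arcs n j (is ! j)),
     tail = fst, head = snd\<rparr>"

definition covering_family :: "nat \<Rightarrow> nat list \<Rightarrow> (nat \<Rightarrow> vertex list) \<Rightarrow> bool" where
  "covering_family n is \<pi> \<longleftrightarrow>
    \<pi> \<in> extensional {1..n} \<and>
    (\<forall>i\<in>{1..n}. vpath (\<pi> i) (wiring_diagram n is) \<and> hd (\<pi> i) = Pt 0 i \<and>
       last (\<pi> i) \<in> Pt (length is) ` {1..n}) \<and>
    (\<forall>e\<in>arcs (wiring_diagram n is). (\<Sum>i=1..n. count_list (vwalk_arcs (\<pi> i)) e) = 1)"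

definition family_type :: "nat \<Rightarrow> (nat \<Rightarrow> vertex list) \<Rightarrow> nat \<Rightarrow> nat" where
  "family_type n \<pi> = (\<lambda>i\<in>{1..n}. level (last (\<pi> i)))"

definition has_type_id :: "nat \<Rightarrow> (nat \<Rightarrow> vertex list) \<Rightarrow> bool" where
  "has_type_id n \<pi> \<longleftrightarrow> family_type n \<pi> = (\<lambda>i\<in>{1..n}. i)"

definition enters :: "vertex list \<Rightarrow> nat \<Rightarrow> nat \<Rightarrow> bool" where
  "enters p j h \<longleftrightarrow> (Pt j h, Centre j) \<in> set (vwalk_arcs p)"

definition leaves :: "vertex list \<Rightarrow> nat \<Rightarrow> nat \<Rightarrow> bool" where
  "leaves p j h \<longleftrightarrow> (Centre j, Pt (Suc j) h) \<in> set (vwalk_arcs p)"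

definition crossing :: "nat \<Rightarrow> nat list \<Rightarrow> (nat \<Rightarrow> vertex list) \<Rightarrow> nat \<Rightarrow> bool" where
  "crossing n is \<pi> j \<longleftrightarrow>
    (\<exists>k\<in>{1..n}. enters (\<pi> k) j (is ! j) \<and> leaves (\<pi> k) j (is ! j + 1)) \<and>
    (\<exists>k\<in>{1..n}. enters (\<pi> k) j (is ! j + 1) \<and> leaves (\<pi> k) j (is ! j))"

definition cross :: "nat \<Rightarrow> nat list \<Rightarrow> (nat \<Rightarrow> vertex list) \<Rightarrow> nat" where
  "cross n is \<pi> = card {j. j < length is \<and> crossing n is \<pi> j}"


section \<open>Tableaux\<close>

text \<open>A tableau is a filling \<open>W\<close> of the cells together with the path family \<open>\<pi>\<close> it uses. The
  family is determined by the filling.\<close>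

definition G_tableau ::
  "nat \<Rightarrow> nat list \<Rightarrow> nat list \<Rightarrow> (nat \<Rightarrow> vertex list) \<Rightarrow> (nat \<times> nat \<Rightarrow> vertex list) \<Rightarrow> bool" where
  "G_tableau n is \<mu> \<pi> W \<longleftrightarrow>
    covering_family n is \<pi> \<and> W \<in> extensional (young_diagram \<mu>) \<and>
    bij_betw W (young_diagram \<mu>) (\<pi> ` {1..n})"

definition source_index :: "vertex list \<Rightarrow> nat" where
  "source_index p = level (hd p)"

text \<open>Each path lies entirely below the paths above it in its column: its source index is smaller
  and it meets none of them. The index condition alone would be too weak: for \<open>n = 2\<close>, one factor
  \<open>1 + T\<^sub>1\<close> and the partition \<open>(2)\<close>, the character value is \<open>0\<close>, but the two noncrossing paths
  through the single central vertex can be put into one column with increasing source indices.\<close>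

definition column_strict :: "nat list \<Rightarrow> (nat \<times> nat \<Rightarrow> vertex list) \<Rightarrow> bool" where
  "column_strict \<mu> W \<longleftrightarrow>
    (\<forall>r r' c. (r, c) \<in> young_diagram \<mu> \<and> (r', c) \<in> young_diagram \<mu> \<and> r < r' \<longrightarrow>
       source_index (W (r, c)) < source_index (W (r', c)) \<and>
       set (W (r, c)) \<inter> set (W (r', c)) = {})"

definition incross ::
  "nat \<Rightarrow> nat list \<Rightarrow> nat list \<Rightarrow> (nat \<Rightarrow> vertex list) \<Rightarrow> (nat \<times> nat \<Rightarrow> vertex list) \<Rightarrow> nat" where
  "incross n is \<mu> \<pi> W = card {j. j < length is \<and> \<not> crossing n is \<pi> j \<and>
    (\<exists>r c r' c'. (r, c) \<in> young_diagram \<mu> \<and> (r', c') \<in> young_diagram \<mu> \<and>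
       enters (W (r, c)) j (is ! j + 1) \<and> enters (W (r', c')) j (is ! j) \<and> c < c')}"

definition column_strict_tableaux ::
  "nat \<Rightarrow> nat list \<Rightarrow> nat list \<Rightarrow> ((nat \<Rightarrow> vertex list) \<times> (nat \<times> nat \<Rightarrow> vertex list)) set" where
  "column_strict_tableaux n is \<mu> =
    {(\<pi>, W). G_tableau n is \<mu> \<pi> W \<and> has_type_id n \<pi> \<and> column_strict \<mu> W}"

end

theory Submission
  imports Defs "HOL-Combinatorics.Transposition" "HOL-Library.Multiset"
begin

text \<open>The induced module has a basis indexed by the colourings \<open>f\<close> of the levels \<open>1, \<dots>, n\<close> in which
  colour \<open>c\<close> occurs \<open>\<mu> ! c\<close> times, that is, by the cosets of the parabolic subgroup. After scaling the
  element \<open>T\<^sub>w \<otimes> 1\<close> by \<open>q^(-l(w)/2)\<close>, the factor \<open>1 + T\<^sub>i\<close> sends \<open>f\<close> to \<open>0\<close> if \<open>f i = f (i + 1)\<close>, and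
  otherwise to \<open>q^(1/2) f \<circ> s\<^sub>i\<close> plus \<open>f\<close> (if \<open>f i < f (i + 1)\<close>) or \<open>q f\<close> (if \<open>f i > f (i + 1)\<close>).
  Hence the trace of the product is a sum over closed walks of colourings, where each step either swaps
  two different adjacent colours with weight \<open>q^(1/2)\<close> (a crossing) or leaves them (a noncrossing). Such a
  walk is a covering path family whose paths are coloured by the columns of a tableau and in which paths
  of equal colour never meet; those keep their order, so the type of a closed walk is the identity.

  Independence of the chosen reduced words shows that the basis elements span. They are linearly
  independent because the same matrices satisfy the Hecke relations, so that the algebra acts on functions
  of colourings and coordinates become functionals on the tensor product.\<close>

section \<open>The free algebra and its action on functions of colourings\<close>

text \<open>The trace in the definition of the character is a definite description over all bases,
  so its value is available only once one basis with linear coordinate functionals is known and the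
  choice of basis is shown not to matter. Computation stays with representatives in the free
  algebra: spanning is a congruence modulo a left ideal of it, and coordinates come from an action
  that kills the relations.

  The zero entry of 1 + T_i at equal colours is 1 + (-1), the sign representation showing through;
  this is what forbids paths of one column to meet. At different colours the diagonal entry of T_i
  is 0 or q - 1, which gives 1 or q, and the latter marks an inverted noncrossing. The normalisation
  makes a swap cost q^(1/2) in both directions, whence the exponent cross/2. Colour \<open>c\<close>
  is used \<open>\<mu> ! c\<close> times because this is the length of column \<open>c\<close> in
  the conjugate shape.

  The operators are defined on functions of all maps from levels to colours, with no bound on levels
  or multiplicities, so the Hecke relations hold for them without range conditions; actual
  colourings enter only with the basis.\<close>

definition linear_extension :: "(word \<Rightarrow> laurent) \<Rightarrow> free_alg \<Rightarrow> laurent" where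
  "linear_extension F p = (\<Sum>w\<in>Poly_Mapping.keys p. Poly_Mapping.lookup p w * F w)"

lemma linear_extension_superset:
  assumes "finite A" "Poly_Mapping.keys p \<subseteq> A"
  shows "linear_extension F p = (\<Sum>w\<in>A. Poly_Mapping.lookup p w * F w)"
  unfolding linear_extension_def
  by (rule sum.mono_neutral_left) (use assms in \<open>auto simp: in_keys_iff\<close>)

lemma linear_extension_add:
  "linear_extension F (p + p') = linear_extension F p + linear_extension F p'"
proof -
  let ?A = "Poly_Mapping.keys p \<union> Poly_Mapping.keys p'"
  have "linear_extension F (p + p') = (\<Sum>w\<in>?A. Poly_Mapping.lookup (p + p') w * F w)"
    by (rule linear_extension_superset) (auto simp: keys_add)
  moreover have "linear_extension F p = (\<Sum>w\<in>?A. Poly_Mapping.lookup p w * F w)"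
    "linear_extension F p' = (\<Sum>w\<in>?A. Poly_Mapping.lookup p' w * F w)"
    by (rule linear_extension_superset; auto)+
  ultimately show ?thesis
    by (simp add: lookup_add algebra_simps sum.distrib)
qed

lemma linear_extension_single [simp]: "linear_extension F (Poly_Mapping.single w c) = c * F w"
  using linear_extension_superset[of "{w}" "Poly_Mapping.single w c" F] by simp

lemma linear_extension_zero [simp]: "linear_extension F 0 = 0"
  by (simp add: linear_extension_def)

lemma free_alg_sum_monomials:
  "p = (\<Sum>w\<in>Poly_Mapping.keys p. Poly_Mapping.single w (Poly_Mapping.lookup p w))"
    for p :: free_alg
  by (rule poly_mapping_eqI) (auto simp: lookup_sum lookup_single when_def in_keys_iff)

definition free_carrier :: "nat \<Rightarrow> free_alg set" where
  "free_carrier n = carrier (free_algebra n)"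

lemma free_carrier_iff:
  "p \<in> free_carrier n \<longleftrightarrow> (\<forall>w \<in> Poly_Mapping.keys p. set (letters w) \<subseteq> {1..<n})"
  by (simp add: free_carrier_def free_algebra_def)

lemma free_carrier_zero: "0 \<in> free_carrier n"
  and free_carrier_one: "1 \<in> free_carrier n"
  and free_carrier_gen: "i \<in> {1..<n} \<Longrightarrow> gen i \<in> free_carrier n"
  and free_carrier_scal: "scal c \<in> free_carrier n"
  by (auto simp: free_carrier_iff gen_def scal_def zero_word_def single_one[symmetric]
      simp del: single_one split: if_splits)

lemma free_carrier_add: "p \<in> free_carrier n \<Longrightarrow> p' \<in> free_carrier n \<Longrightarrow> p + p' \<in> free_carrier n"
  unfolding free_carrier_iff using keys_add[of p p'] by blast

lemma free_carrier_mult: "p \<in> free_carrier n \<Longrightarrow> p' \<in> free_carrier n \<Longrightarrow> p * p' \<in> free_carrier n"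
  unfolding free_carrier_iff using keys_mult[of p p'] by (fastforce simp: plus_word_def)

lemma free_carrier_uminus: "p \<in> free_carrier n \<Longrightarrow> - p \<in> free_carrier n"
  unfolding free_carrier_iff by simp

lemma free_carrier_diff: "p \<in> free_carrier n \<Longrightarrow> p' \<in> free_carrier n \<Longrightarrow> p - p' \<in> free_carrier n"
  using free_carrier_add[of p n "- p'"] free_carrier_uminus[of p' n] by simp

lemma free_carrier_sum: "(\<And>x. x \<in> X \<Longrightarrow> f x \<in> free_carrier n) \<Longrightarrow> sum f X \<in> free_carrier n"
  by (induction X rule: infinite_finite_induct)
    (auto intro: free_carrier_zero free_carrier_add)

lemmas free_carrier_closed = free_carrier_zero free_carrier_one free_carrier_gen free_carrier_scal
  free_carrier_add free_carrier_mult free_carrier_uminus free_carrier_diff free_carrier_sum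

text \<open>Induction over the support. The inner statement carries \<open>free_carrier\<close>
  membership along, since the \<open>add\<close> case may assume it for both summands.\<close>

lemma free_alg_induct [consumes 1, case_names monomial add]:
  assumes "p \<in> free_carrier n"
    and monomial: "\<And>w c. set (letters w) \<subseteq> {1..<n} \<Longrightarrow> P (Poly_Mapping.single w c)"
    and add: "\<And>p p'. p \<in> free_carrier n \<Longrightarrow> p' \<in> free_carrier n \<Longrightarrow> P p \<Longrightarrow> P p' \<Longrightarrow> P (p + p')"
  shows "P p"
proof -
  have "P (\<Sum>w\<in>A. Poly_Mapping.single w (f w)) \<and>
      (\<Sum>w\<in>A. Poly_Mapping.single w (f w)) \<in> free_carrier n"
    if "finite A" "\<forall>w\<in>A. set (letters w) \<subseteq> {1..<n}" for A and f :: "word \<Rightarrow> laurent"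
    using that
  proof (induction A rule: finite_induct)
    case empty
    then show ?case using monomial[of 0 0] by (simp add: zero_word_def free_carrier_zero)
  next
    case (insert w A)
    then have "Poly_Mapping.single w (f w) \<in> free_carrier n"
      by (auto simp: free_carrier_iff split: if_splits)
    with insert show ?case using monomial add free_carrier_add by simp
  qed
  from this[of "Poly_Mapping.keys p" "Poly_Mapping.lookup p"] assms(1)
  show ?thesis by (simp add: free_alg_sum_monomials[symmetric] free_carrier_iff)
qed

lemma free_alg_monomial_add_induct [case_names monomial add]:
  fixes p :: free_alg
  assumes monomial: "\<And>w c. P (Poly_Mapping.single w c)"
    and add: "\<And>p p'. P p \<Longrightarrow> P p' \<Longrightarrow> P (p + p')"
  shows "P p"
proof -
  have "P (\<Sum>w\<in>A. Poly_Mapping.single w (f w))"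
    if "finite A" for A and f :: "word \<Rightarrow> laurent"
    using that
  proof (induction A rule: finite_induct)
    case empty
    then show ?case using monomial[of 0 0] by simp
  next
    case (insert w A)
    then show ?case using monomial add by simp
  qed
  from this[of "Poly_Mapping.keys p" "Poly_Mapping.lookup p"]
  show ?thesis by (simp add: free_alg_sum_monomials[symmetric])
qed

lemma scal_commutes: "scal c * p = p * scal c"
  by (induction p rule: free_alg_monomial_add_induct)
    (simp_all add: scal_def mult_single mult.commute distrib_left distrib_right)

lemma scal_add: "scal (a + b) = scal a + scal b"
  and scal_mult: "scal (a * b) = scal a * scal b"
  and scal_one: "scal 1 = 1"
  and scal_zero: "scal 0 = 0"
  and scal_uminus: "scal (- a) = - scal a"
  and scal_diff: "scal (a - b) = scal a - scal b"
  by (simp_all add: scal_def single_add mult_single single_uminus single_diff)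

lemma monomial_Cons:
  "Poly_Mapping.single (Word (i # w)) c = gen i * Poly_Mapping.single (Word w) c"
  by (simp add: gen_def mult_single plus_word_def)

lemma monomial_Nil: "Poly_Mapping.single (Word []) c = scal c"
  by (simp add: scal_def zero_word_def)

text \<open>Colourings of the levels assign to each level the column of the path that sits there.\<close>

definition swap_levels :: "nat \<Rightarrow> (nat \<Rightarrow> nat) \<Rightarrow> nat \<Rightarrow> nat" where
  "swap_levels i g = g \<circ> transpose i (Suc i)"

lemma swap_levels_apply:
  "swap_levels i g k = (if k = i then g (Suc i) else if k = Suc i then g i else g k)"
  by (simp add: swap_levels_def transpose_def)

lemma swap_levels_involutive [simp]: "swap_levels i (swap_levels i g) = g"
  by (auto simp: swap_levels_apply)

lemma swap_levels_eq [simp]: "g i = g (Suc i) \<Longrightarrow> swap_levels i g = g"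
  by (auto simp: swap_levels_apply)

lemma swap_levels_eq_iff: "swap_levels i g = f \<longleftrightarrow> g = swap_levels i f"
  by (metis swap_levels_involutive)

lemma swap_levels_braid:
  "swap_levels (Suc i) (swap_levels i (swap_levels (Suc i) g)) =
   swap_levels i (swap_levels (Suc i) (swap_levels i g))"
  by (auto simp: swap_levels_apply)

lemma swap_levels_commute:
  "Suc i < j \<or> Suc j < i \<Longrightarrow> swap_levels i (swap_levels j g) = swap_levels j (swap_levels i g)"
  by (auto simp: swap_levels_apply)

text \<open>The matrix of the generator in the basis \<open>q^(-l(w)/2) T\<^sub>w \<otimes> 1\<close> of the induced module, in which
  it is symmetric.\<close>

definition T_act :: "nat \<Rightarrow> ((nat \<Rightarrow> nat) \<Rightarrow> laurent) \<Rightarrow> (nat \<Rightarrow> nat) \<Rightarrow> laurent" where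
  "T_act i \<psi> g =
    (if g i = g (Suc i) then - \<psi> g
     else if g i < g (Suc i) then q_half * \<psi> (swap_levels i g)
     else q_half * \<psi> (swap_levels i g) + (q - 1) * \<psi> g)"


lemma T_act_eq: "g i = g (Suc i) \<Longrightarrow> T_act i \<psi> g = - \<psi> g"
  and T_act_less: "g i < g (Suc i) \<Longrightarrow> T_act i \<psi> g = q_half * \<psi> (swap_levels i g)"
  and T_act_greater:
    "g (Suc i) < g i \<Longrightarrow> T_act i \<psi> g = q_half * \<psi> (swap_levels i g) + (q - 1) * \<psi> g"
  by (simp_all add: T_act_def)

lemmas T_act_cases = T_act_eq T_act_less T_act_greater

text \<open>At equal colours -1 is a root of x^2 = (q - 1) x + q. At different colours
  \<open>T_act i\<close> acts on the pair \<open>g\<close>, \<open>swap_levels i g\<close> by a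
  symmetric 2x2 matrix with diagonal 0, q - 1 and off-diagonal entries q^(1/2). Its trace is q - 1
  and its determinant is -q, so this is Cayley-Hamilton.\<close>

lemma T_act_quadratic: "T_act i (T_act i \<psi>) g = (q - 1) * T_act i \<psi> g + q * \<psi> g"
  by (cases "g i" "g (Suc i)" rule: linorder_cases)
    (simp_all add: T_act_cases swap_levels_apply q_def power2_eq_square algebra_simps)

text \<open>Only the relative order of the three colours at \<open>i\<close>, \<open>Suc i\<close>,
  \<open>Suc (Suc i)\<close> matters, and each order leaves a polynomial identity in
  \<open>q_half\<close>. The comparison of the outer two colours is needed because the middle
  generator may meet them side by side.\<close>

lemma T_act_braid:
  "T_act i (T_act (Suc i) (T_act i \<psi>)) g = T_act (Suc i) (T_act i (T_act (Suc i) \<psi>)) g"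
  by (cases "g i" "g (Suc i)" rule: linorder_cases;
      cases "g (Suc i)" "g (Suc (Suc i))" rule: linorder_cases;
      cases "g i" "g (Suc (Suc i))" rule: linorder_cases)
    (simp_all add: T_act_cases swap_levels_apply swap_levels_braid q_def power2_eq_square algebra_simps)

lemma T_act_commute:
  "Suc i < j \<or> Suc j < i \<Longrightarrow> T_act i (T_act j \<psi>) g = T_act j (T_act i \<psi>) g"
  by (cases "g i" "g (Suc i)" rule: linorder_cases; cases "g j" "g (Suc j)" rule: linorder_cases;
      elim disjE)
    (simp_all add: T_act_cases swap_levels_apply swap_levels_commute algebra_simps)

definition act_word :: "word \<Rightarrow> ((nat \<Rightarrow> nat) \<Rightarrow> laurent) \<Rightarrow> (nat \<Rightarrow> nat) \<Rightarrow> laurent" where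
  "act_word w = foldr T_act (letters w)"

definition act :: "free_alg \<Rightarrow> ((nat \<Rightarrow> nat) \<Rightarrow> laurent) \<Rightarrow> (nat \<Rightarrow> nat) \<Rightarrow> laurent" where
  "act p \<psi> g = linear_extension (\<lambda>w. act_word w \<psi> g) p"

lemma T_act_add: "T_act i (\<lambda>g. \<psi> g + \<psi>' g) = (\<lambda>g. T_act i \<psi> g + T_act i \<psi>' g)"
  and T_act_smult: "T_act i (\<lambda>g. c * \<psi> g) = (\<lambda>g. c * T_act i \<psi> g)"
  by (auto simp: T_act_def algebra_simps)

lemma act_word_add: "act_word w (\<lambda>g. \<psi> g + \<psi>' g) = (\<lambda>g. act_word w \<psi> g + act_word w \<psi>' g)"
proof -
  have "foldr T_act xs (\<lambda>g. \<psi> g + \<psi>' g) = (\<lambda>g. foldr T_act xs \<psi> g + foldr T_act xs \<psi>' g)" for xs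
    by (induction xs) (simp_all add: T_act_add)
  then show ?thesis by (simp add: act_word_def)
qed

lemma act_word_smult: "act_word w (\<lambda>g. c * \<psi> g) = (\<lambda>g. c * act_word w \<psi> g)"
proof -
  have "foldr T_act xs (\<lambda>g. c * \<psi> g) = (\<lambda>g. c * foldr T_act xs \<psi> g)" for xs
    by (induction xs) (simp_all add: T_act_smult)
  then show ?thesis by (simp add: act_word_def)
qed

lemma act_add: "act (p + p') \<psi> g = act p \<psi> g + act p' \<psi> g"
  by (simp add: act_def linear_extension_add)

lemma act_uminus: "act (- p) \<psi> g = - act p \<psi> g"
  using act_add[of p "- p" \<psi> g] by (simp add: eq_neg_iff_add_eq_0 add.commute act_def)

lemma act_diff: "act (p - p') \<psi> g = act p \<psi> g - act p' \<psi> g"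
  using act_add[of p "- p'"] by (simp add: act_uminus)

lemma act_zero [simp]: "act 0 \<psi> g = 0"
  by (simp add: act_def)

lemma act_gen: "act (gen i) \<psi> = T_act i \<psi>"
  by (auto simp: act_def gen_def act_word_def)

lemma act_scal: "act (scal c) \<psi> = (\<lambda>g. c * \<psi> g)"
  by (auto simp: act_def scal_def act_word_def zero_word_def)

lemma act_one [simp]: "act 1 \<psi> = \<psi>"
  using act_scal[of 1 \<psi>] by (simp add: scal_one)

text \<open>\<open>act_word\<close> folds from the right, so concatenation of words becomes
  composition of operators with the left factor outermost: functions of colourings form a left
  module.\<close>

lemma act_mult: "act (p * p') \<psi> = act p (act p' \<psi>)"
proof -
  have *: "act (Poly_Mapping.single w c * p') \<psi> g = act (Poly_Mapping.single w c) (act p' \<psi>) g"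
    for w c g
  proof (induction p' rule: free_alg_monomial_add_induct)
    case (monomial v d)
    have eq: "act (Poly_Mapping.single v d) \<psi> = (\<lambda>g. d * act_word v \<psi> g)"
      by (auto simp: act_def)
    show ?case
      unfolding eq
      by (simp add: act_def mult_single act_word_smult) (simp add: act_word_def plus_word_def algebra_simps)
  next
    case (add p p')
    have eq: "act (p + p') \<psi> = (\<lambda>g. act p \<psi> g + act p' \<psi> g)"
      by (auto simp: act_add)
    show ?case
      using add unfolding eq
      by (simp add: distrib_left act_add) (simp add: act_def act_word_add algebra_simps)
  qed
  have "act (p * p') \<psi> g = act p (act p' \<psi>) g" for g
    by (induction p rule: free_alg_monomial_add_induct) (simp_all add: * distrib_right act_add)
  then show ?thesis by blast
qed

lemma act_smult: "act p (\<lambda>g. c * \<psi> g) = (\<lambda>g. c * act p \<psi> g)"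
proof -
  have "act (p * scal c) \<psi> = act (scal c * p) \<psi>"
    by (simp add: scal_commutes)
  then show ?thesis by (simp add: act_mult act_scal)
qed

section \<open>The sign homomorphism of the free algebra\<close>

definition sgn_hom :: "free_alg \<Rightarrow> laurent" where
  "sgn_hom = linear_extension (\<lambda>w. (- 1) ^ length (letters w))"

lemma sgn_hom_add: "sgn_hom (p + p') = sgn_hom p + sgn_hom p'"
  by (simp add: sgn_hom_def linear_extension_add)

lemma sgn_hom_scal: "sgn_hom (scal c) = c"
  and sgn_hom_gen: "sgn_hom (gen i) = - 1"
  and sgn_hom_zero: "sgn_hom 0 = 0"
  by (simp_all add: sgn_hom_def scal_def gen_def zero_word_def)

lemma sgn_hom_one: "sgn_hom 1 = 1"
  using sgn_hom_scal[of 1] by (simp add: scal_one)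

lemma sgn_hom_uminus: "sgn_hom (- p) = - sgn_hom p"
  using sgn_hom_add[of p "- p"] by (simp add: sgn_hom_zero eq_neg_iff_add_eq_0 add.commute)

lemma sgn_hom_diff: "sgn_hom (p - p') = sgn_hom p - sgn_hom p'"
  using sgn_hom_add[of p "- p'"] by (simp add: sgn_hom_uminus)

lemma sgn_hom_mult: "sgn_hom (p * p') = sgn_hom p * sgn_hom p'"
proof -
  have *: "sgn_hom (Poly_Mapping.single w c * p') = sgn_hom (Poly_Mapping.single w c) * sgn_hom p'"
    for w c
    by (induction p' rule: free_alg_monomial_add_induct)
      (simp_all add: mult_single sgn_hom_def power_add plus_word_def algebra_simps
        linear_extension_add)
  show ?thesis
    by (induction p rule: free_alg_monomial_add_induct) (simp_all add: * distrib_right sgn_hom_add)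
qed

section \<open>Colourings and the basis elements of the induced module\<close>

text \<open>The extensional function space fixes the values outside \<open>{1..n}\<close>, so that
  each coset is exactly one function and colourings can be compared by equality.\<close>

definition colourings :: "nat \<Rightarrow> nat list \<Rightarrow> (nat \<Rightarrow> nat) set" where
  "colourings n \<mu> = {g \<in> {1..n} \<rightarrow>\<^sub>E {..<length \<mu>}.
    \<forall>c<length \<mu>. card {k \<in> {1..n}. g k = c} = \<mu> ! c}"

text \<open>The coset of the identity: the weakly increasing colouring whose classes are consecutive
  blocks of sizes \<open>\<mu> ! 0\<close>, \<open>\<mu> ! 1\<close> and so on.\<close>

definition base_colouring :: "nat \<Rightarrow> nat list \<Rightarrow> nat \<Rightarrow> nat" where
  "base_colouring n \<mu> = (\<lambda>k\<in>{1..n}. LEAST c. k \<le> sum_list (take (Suc c) \<mu>))"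

lemma finite_colourings: "finite (colourings n \<mu>)"
  unfolding colourings_def by (rule finite_subset[of _ "{1..n} \<rightarrow>\<^sub>E {..<length \<mu>}"]) (auto intro: finite_PiE)

lemma swap_levels_colourings:
  assumes "g \<in> colourings n \<mu>" "i \<in> {1..<n}"
  shows "swap_levels i g \<in> colourings n \<mu>"
proof -
  have t: "transpose i (Suc i) k \<in> {1..n} \<longleftrightarrow> k \<in> {1..n}" for k
    using assms(2) by (auto simp: transpose_def)
  have "card {k \<in> {1..n}. swap_levels i g k = c} = card {k \<in> {1..n}. g k = c}" for c
  proof -
    have "{k \<in> {1..n}. swap_levels i g k = c} = transpose i (Suc i) ` {k \<in> {1..n}. g k = c}"
      by (rule Set.set_eqI) (simp only: in_transpose_image_iff mem_Collect_eq t swap_levels_def o_apply)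
    then show ?thesis by (simp add: card_image)
  qed
  moreover have "swap_levels i g \<in> {1..n} \<rightarrow>\<^sub>E {..<length \<mu>}"
    using assms by (auto simp: colourings_def PiE_def extensional_def swap_levels_apply Pi_def)
  ultimately show ?thesis
    using assms(1) by (simp add: colourings_def)
qed

lemma sum_list_take_mono: "a \<le> b \<Longrightarrow> sum_list (take a \<mu>) \<le> sum_list (take b \<mu>)" for \<mu> :: "nat list"
  by (metis le_add1 le_add_diff_inverse sum_list_append take_add)

lemma base_colouring_eq_iff:
  assumes "sum_list \<mu> = n" "k \<in> {1..n}"
  shows "base_colouring n \<mu> k = c \<longleftrightarrow> sum_list (take c \<mu>) < k \<and> k \<le> sum_list (take (Suc c) \<mu>)"
proof -
  let ?P = "\<lambda>c. k \<le> sum_list (take (Suc c) \<mu>)"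
  have "?P (length \<mu>)" using assms by simp
  then have L: "?P (LEAST c. ?P c)" by (rule LeastI)
  have lt: "\<not> ?P d" if "d < (LEAST c. ?P c)" for d
    using that by (rule not_less_Least)
  have b: "base_colouring n \<mu> k = (LEAST c. ?P c)" using assms by (simp add: base_colouring_def)
  show ?thesis
  proof
    assume "base_colouring n \<mu> k = c"
    with b L lt[of "c - 1"] show "sum_list (take c \<mu>) < k \<and> ?P c"
      using assms by (cases c) auto
  next
    assume a: "sum_list (take c \<mu>) < k \<and> ?P c"
    have "(LEAST c. ?P c) = c"
    proof (rule Least_equality)
      fix d assume "?P d"
      then show "c \<le> d" using a sum_list_take_mono[of "Suc d" c \<mu>] by (meson leI Suc_leI le_trans not_le)
    qed (use a in simp)
    with b show "base_colouring n \<mu> k = c" by simp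
  qed
qed

lemma base_colouring_bounds:
  assumes "sum_list \<mu> = n" "k \<in> {1..n}"
  shows "sum_list (take (base_colouring n \<mu> k) \<mu>) < k"
    "k \<le> sum_list (take (Suc (base_colouring n \<mu> k)) \<mu>)"
  using base_colouring_eq_iff[OF assms] by blast+

lemma base_colouring_mono:
  assumes "sum_list \<mu> = n" "k \<in> {1..n}" "l \<in> {1..n}" "k \<le> l"
  shows "base_colouring n \<mu> k \<le> base_colouring n \<mu> l"
  using base_colouring_bounds[OF assms(1,2)] base_colouring_bounds[OF assms(1,3)] assms(4)
    sum_list_take_mono[of "Suc (base_colouring n \<mu> l)" "base_colouring n \<mu> k" \<mu>]
  by (meson leI Suc_leI le_trans not_le)

lemma base_colouring_in_colourings:
  assumes "sum_list \<mu> = n"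
  shows "base_colouring n \<mu> \<in> colourings n \<mu>"
proof -
  have "base_colouring n \<mu> k < length \<mu>" if "k \<in> {1..n}" for k
  proof (rule ccontr)
    assume "\<not> ?thesis"
    then show False using base_colouring_bounds(1)[OF assms that] assms that by simp
  qed
  moreover have "card {k \<in> {1..n}. base_colouring n \<mu> k = c} = \<mu> ! c" if "c < length \<mu>" for c
  proof -
    have "sum_list (take (Suc c) \<mu>) \<le> n"
      using sum_list_take_mono[of "Suc c" "length \<mu>" \<mu>] that assms by simp
    then have "{k \<in> {1..n}. base_colouring n \<mu> k = c} = {sum_list (take c \<mu>)<..sum_list (take (Suc c) \<mu>)}"
    proof (intro Set.set_eqI iffI)
      fix k
      assume k: "k \<in> {sum_list (take c \<mu>)<..sum_list (take (Suc c) \<mu>)}"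
      with \<open>sum_list (take (Suc c) \<mu>) \<le> n\<close> have "k \<in> {1..n}" by auto
      with k show "k \<in> {k \<in> {1..n}. base_colouring n \<mu> k = c}"
        using base_colouring_eq_iff[OF assms, of k c] by simp
    qed (use base_colouring_bounds[OF assms] in auto)
    then show ?thesis using that by (simp add: take_Suc_conv_app_nth)
  qed
  ultimately show ?thesis
    by (auto simp: colourings_def base_colouring_def)
qed

text \<open>The multiplicities of the colours are fixed by \<open>\<mu>\<close>, and a multiset has
  only one sorted listing.\<close>

lemma colouring_without_descent:
  assumes "sum_list \<mu> = n" "g \<in> colourings n \<mu>"
    and "\<And>i. i \<in> {1..<n} \<Longrightarrow> g i \<le> g (Suc i)"
  shows "g = base_colouring n \<mu>"
proof -
  let ?f = "base_colouring n \<mu>" and ?xs = "[1..<Suc n]"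
  have f: "?f \<in> colourings n \<mu>" by (rule base_colouring_in_colourings) fact
  have cnt: "count (mset (map h ?xs)) c = card {k \<in> {1..n}. h k = c}" for h :: "nat \<Rightarrow> nat" and c
  proof -
    have "count (mset (map h ?xs)) c = length (filter (\<lambda>k. h k = c) ?xs)"
    proof -
      have "count (mset (map h ys)) c = length (filter (\<lambda>k. h k = c) ys)" for ys
        by (induction ys) auto
      then show ?thesis .
    qed
    also have "\<dots> = card (set (filter (\<lambda>k. h k = c) ?xs))"
      by (rule distinct_card[symmetric]) simp
    also have "set (filter (\<lambda>k. h k = c) ?xs) = {k \<in> {1..n}. h k = c}" by auto
    finally show ?thesis .
  qed
  have "card {k \<in> {1..n}. h k = c} = (if c < length \<mu> then \<mu> ! c else 0)"
    if "h \<in> colourings n \<mu>" for h c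
    using that by (auto simp: colourings_def PiE_def Pi_def)
  then have "mset (map g ?xs) = mset (map ?f ?xs)"
    using f assms(2) by (intro multiset_eqI) (simp only: cnt)
  moreover have "sorted (map g ?xs)"
    unfolding sorted_iff_nth_Suc using assms(3) by (auto simp del: upt_Suc)
  moreover have "sorted (map ?f ?xs)"
    unfolding sorted_iff_nth_Suc using base_colouring_mono[OF assms(1)] by (auto simp del: upt_Suc)
  ultimately have "map g ?xs = map ?f ?xs"
    by (metis properties_for_sort)
  then have "g k = ?f k" if "k \<in> {1..n}" for k
    using that by (simp del: upt_Suc)
  moreover have "g k = ?f k" if "k \<notin> {1..n}" for k
    using that assms(2) f by (simp add: colourings_def PiE_def extensional_def)
  ultimately show ?thesis by blast
qed

text \<open>The removed partial sums are the last levels of the blocks, where the base colouring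
  steps up. So the parabolic generators are those that meet equal colours in the base colouring,
  which is where \<open>T_act\<close> is -1.\<close>

lemma parabolic_indices_iff:
  assumes "sum_list \<mu> = n" "i \<in> {1..<n}"
  shows "i \<in> parabolic_indices n \<mu> \<longleftrightarrow> base_colouring n \<mu> i = base_colouring n \<mu> (Suc i)"
proof -
  let ?c = "base_colouring n \<mu> i"
  have i: "i \<in> {1..n}" "Suc i \<in> {1..n}" using assms by auto
  note bi = base_colouring_bounds[OF assms(1) i(1)]
  have eq: "?c = base_colouring n \<mu> (Suc i) \<longleftrightarrow> i \<noteq> sum_list (take (Suc ?c) \<mu>)"
    using base_colouring_eq_iff[OF assms(1) i(2), of ?c] bi by (auto simp: eq_commute)
  show ?thesis
  proof
    assume J: "i \<in> parabolic_indices n \<mu>"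
    show "?c = base_colouring n \<mu> (Suc i)"
    proof (cases "Suc ?c < length \<mu>")
      case True
      then show ?thesis using J unfolding eq parabolic_indices_def by fastforce
    next
      case False
      then show ?thesis unfolding eq using assms by auto
    qed
  next
    assume "?c = base_colouring n \<mu> (Suc i)"
    then have ne: "i \<noteq> sum_list (take (Suc ?c) \<mu>)" by (simp add: eq)
    have "i \<noteq> sum_list (take k \<mu>)" for k
    proof
      assume ik: "i = sum_list (take k \<mu>)"
      show False
        using bi sum_list_take_mono[of k ?c \<mu>] sum_list_take_mono[of "Suc ?c" k \<mu>] ne ik
        by (cases "k \<le> ?c") auto
    qed
    then show "i \<in> parabolic_indices n \<mu>" using assms(2) by (auto simp: parabolic_indices_def)
  qed
qed

section \<open>Normalised coset representatives\<close>

definition q_half_inv :: laurent where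
  "q_half_inv = Poly_Mapping.single (- 1) 1"

lemma q_half_inv: "q_half_inv * q_half = 1" "q_half * q_half_inv = 1"
  by (simp_all add: q_half_inv_def q_half_def mult_single)

text \<open>A potential in place of the inversion number: swapping a descent at \<open>i\<close>
  lowers it by \<open>f i - f (Suc i)\<close>, so termination and induction need no count of
  inversions.\<close>

definition disorder :: "nat \<Rightarrow> (nat \<Rightarrow> nat) \<Rightarrow> nat" where
  "disorder n f = (\<Sum>k=1..n. (n - k) * f k)"

lemma disorder_swap_levels:
  assumes "i \<in> {1..<n}" "f (Suc i) < f i"
  shows "disorder n (swap_levels i f) < disorder n f"
proof -
  let ?R = "{1..n} - {i, Suc i}"
  have s: "(\<Sum>k=1..n. u k) = u i + (u (Suc i) + sum u ?R)" for u :: "nat \<Rightarrow> nat"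
  proof -
    have "{1..n} = insert i (insert (Suc i) ?R)" using assms(1) by auto
    then have "(\<Sum>k=1..n. u k) = sum u (insert i (insert (Suc i) ?R))" by simp
    also have "\<dots> = u i + (u (Suc i) + sum u ?R)" by (subst sum.insert; simp)+
    finally show ?thesis .
  qed
  have R: "(\<Sum>k\<in>?R. (n - k) * swap_levels i f k) = (\<Sum>k\<in>?R. (n - k) * f k)"
    by (rule sum.cong) (auto simp: swap_levels_apply)
  obtain d where d: "n - i = Suc d" "n - Suc i = d"
    using assms(1) by (metis Suc_diff_Suc atLeastLessThan_iff)
  show ?thesis
    unfolding disorder_def s R using assms(2) by (simp add: swap_levels_apply d)
qed

definition descents :: "nat \<Rightarrow> (nat \<Rightarrow> nat) \<Rightarrow> nat set" where
  "descents n f = {i \<in> {1..<n}. f (Suc i) < f i}"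

text \<open>The normalised basis element \<open>q^(-l(w)/2) T\<^sub>w\<close> of the coset of \<open>f\<close>, along one chosen reduced
  word.\<close>

function coset_elt :: "nat \<Rightarrow> (nat \<Rightarrow> nat) \<Rightarrow> free_alg" where
  "coset_elt n f = (if descents n f = {} then 1
    else scal q_half_inv *
      (gen (LEAST i. i \<in> descents n f) * coset_elt n (swap_levels (LEAST i. i \<in> descents n f) f)))"
  by auto
termination
proof (relation "measure (\<lambda>(n, f). disorder n f)")
  fix n and f :: "nat \<Rightarrow> nat"
  assume "descents n f \<noteq> {}"
  then have "(LEAST i. i \<in> descents n f) \<in> descents n f" by (meson LeastI ex_in_conv)
  then show "((n, swap_levels (LEAST i. i \<in> descents n f) f), n, f) \<in> measure (\<lambda>(n, f). disorder n f)"
    using disorder_swap_levels by (simp add: descents_def)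
qed simp

declare coset_elt.simps [simp del]

lemma coset_elt_no_descent: "descents n f = {} \<Longrightarrow> coset_elt n f = 1"
  by (subst coset_elt.simps) simp

lemma coset_elt_descent:
  assumes "descents n f \<noteq> {}"
  obtains i where "i \<in> descents n f"
    "coset_elt n f = scal q_half_inv * (gen i * coset_elt n (swap_levels i f))"
proof
  show "(LEAST i. i \<in> descents n f) \<in> descents n f" using assms by (meson LeastI ex_in_conv)
  show "coset_elt n f = scal q_half_inv * (gen (LEAST i. i \<in> descents n f) *
      coset_elt n (swap_levels (LEAST i. i \<in> descents n f) f))"
    using assms by (subst coset_elt.simps) simp
qed

lemma disorder_induct [case_names step]:
  assumes "\<And>f. (\<And>g. disorder n g < disorder n f \<Longrightarrow> P g) \<Longrightarrow> P f"
  shows "P f"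
  by (rule measure_induct_rule[of "disorder n"]) (rule assms)

lemma coset_elt_carrier: "coset_elt n f \<in> free_carrier n"
proof (induction f rule: disorder_induct[of n])
  case (step f)
  show ?case
  proof (cases "descents n f = {}")
    case True
    then show ?thesis by (simp add: coset_elt_no_descent free_carrier_one)
  next
    case False
    then obtain i where i: "i \<in> descents n f"
      "coset_elt n f = scal q_half_inv * (gen i * coset_elt n (swap_levels i f))"
      by (rule coset_elt_descent)
    have "disorder n (swap_levels i f) < disorder n f"
      using i(1) disorder_swap_levels by (simp add: descents_def)
    with i step show ?thesis by (auto simp: descents_def intro!: free_carrier_closed)
  qed
qed

definition delta :: "(nat \<Rightarrow> nat) \<Rightarrow> (nat \<Rightarrow> nat) \<Rightarrow> laurent" where
  "delta f g = (if g = f then 1 else 0)"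

text \<open>\<open>T_act\<close> is written by rows; this is a column. At \<open>g = f\<close> the
  row has no diagonal term because \<open>f\<close> ascends, and at
  \<open>g = swap_levels i f\<close> the diagonal term multiplies
  \<open>delta f g = 0\<close>.\<close>

lemma T_act_delta_ascent:
  assumes "f i < f (Suc i)"
  shows "T_act i (delta f) = (\<lambda>g. q_half * delta (swap_levels i f) g)"
proof
  fix g
  show "T_act i (delta f) g = q_half * delta (swap_levels i f) g"
    using assms by (auto simp: T_act_def delta_def swap_levels_eq_iff) (auto simp: swap_levels_apply)
qed

lemma T_act_delta_level:
  assumes "f i = f (Suc i)"
  shows "T_act i (delta f) = (\<lambda>g. - delta f g)"
proof
  fix g
  show "T_act i (delta f) g = - delta f g"
    using assms by (auto simp: T_act_def delta_def swap_levels_eq_iff)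
qed

text \<open>Each step of the recursion climbs from \<open>swap_levels i f\<close> to
  \<open>f\<close> along an ascent, whose factor \<open>q_half\<close> cancels against
  \<open>q_half_inv\<close>. Hence the coordinates of \<open>coset_elt n f\<close> can be read off
  from its action on the base vector, which gives linear independence.\<close>

lemma act_coset_elt:
  assumes "sum_list \<mu> = n" "f \<in> colourings n \<mu>"
  shows "act (coset_elt n f) (delta (base_colouring n \<mu>)) = delta f"
  using assms(2)
proof (induction f rule: disorder_induct[of n])
  case (step f)
  show ?case
  proof (cases "descents n f = {}")
    case True
    then have "f = base_colouring n \<mu>"
      using step.prems by (intro colouring_without_descent[OF assms(1)]) (auto simp: descents_def not_less)
    with True show ?thesis by (simp add: coset_elt_no_descent)
  next
    case False
    then obtain i where i: "i \<in> descents n f"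
      "coset_elt n f = scal q_half_inv * (gen i * coset_elt n (swap_levels i f))"
      by (rule coset_elt_descent)
    have "disorder n (swap_levels i f) < disorder n f"
      using i(1) disorder_swap_levels by (simp add: descents_def)
    moreover have "swap_levels i f \<in> colourings n \<mu>"
      using i(1) step.prems swap_levels_colourings by (simp add: descents_def)
    ultimately have "act (coset_elt n (swap_levels i f)) (delta (base_colouring n \<mu>)) = delta (swap_levels i f)"
      using step.IH by blast
    moreover have "T_act i (delta (swap_levels i f)) = (\<lambda>g. q_half * delta f g)"
      using T_act_delta_ascent[of "swap_levels i f" i] i(1) by (simp add: swap_levels_apply descents_def)
    ultimately show ?thesis
      by (simp add: i(2) act_mult act_scal act_gen mult.assoc[symmetric] q_half_inv)
  qed
qed

section \<open>Spanning\<close>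

text \<open>The closure properties of the kernel of the map from the free algebra to the induced
  module that sends x to the tensor of x and 1. This kernel is only a left ideal: the relations are
  therefore assumed with an arbitrary right factor, whereas the sign condition
  \<open>gen j + 1\<close> is imposed at the generating vector alone.\<close>

locale hecke_left_ideal =
  fixes n :: nat and \<mu> :: "nat list" and Z :: "free_alg set"
  assumes sum_mu: "sum_list \<mu> = n"
    and Z_add: "x \<in> Z \<Longrightarrow> y \<in> Z \<Longrightarrow> x + y \<in> Z"
    and Z_mult: "a \<in> free_carrier n \<Longrightarrow> x \<in> Z \<Longrightarrow> a * x \<in> Z"
    and Z_relation: "r \<in> hecke_relations n \<Longrightarrow> a \<in> free_carrier n \<Longrightarrow> r * a \<in> Z"
    and Z_sign: "j \<in> parabolic_indices n \<mu> \<Longrightarrow> gen j + 1 \<in> Z"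
    and Z_zero: "0 \<in> Z"
begin

definition cong :: "free_alg \<Rightarrow> free_alg \<Rightarrow> bool" (infix "\<approx>\<^sub>Z" 50) where
  "x \<approx>\<^sub>Z y \<longleftrightarrow> x - y \<in> Z"

lemma cong_refl [simp]: "x \<approx>\<^sub>Z x"
  by (simp add: cong_def Z_zero)

lemma cong_sym: "x \<approx>\<^sub>Z y \<Longrightarrow> y \<approx>\<^sub>Z x"
  using Z_mult[OF free_carrier_scal[of "- 1"], of "x - y"]
  by (simp add: cong_def scal_uminus scal_one)

lemma cong_trans [trans]: "x \<approx>\<^sub>Z y \<Longrightarrow> y \<approx>\<^sub>Z z \<Longrightarrow> x \<approx>\<^sub>Z z"
  using Z_add[of "x - y" "y - z"] by (simp add: cong_def)

lemma cong_add: "x \<approx>\<^sub>Z y \<Longrightarrow> x' \<approx>\<^sub>Z y' \<Longrightarrow> x + x' \<approx>\<^sub>Z y + y'"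
  using Z_add[of "x - y" "x' - y'"] by (simp add: cong_def algebra_simps)

lemma cong_mult: "a \<in> free_carrier n \<Longrightarrow> x \<approx>\<^sub>Z y \<Longrightarrow> a * x \<approx>\<^sub>Z a * y"
  using Z_mult[of a "x - y"] by (simp add: cong_def algebra_simps)

lemma cong_quadratic:
  assumes "i \<in> {1..<n}" "a \<in> free_carrier n"
  shows "gen i * (gen i * a) \<approx>\<^sub>Z scal (q - 1) * (gen i * a) + scal q * a"
proof -
  have "gen i * gen i - (scal (q - 1) * gen i + scal q) \<in> hecke_relations n"
    using assms(1) by (auto simp: hecke_relations_def)
  from Z_relation[OF this assms(2)] show ?thesis
    by (simp add: cong_def algebra_simps)
qed

lemma cong_braid:
  assumes "i \<in> {1..<n}" "Suc i \<in> {1..<n}" "a \<in> free_carrier n"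
  shows "gen i * (gen (Suc i) * (gen i * a)) \<approx>\<^sub>Z gen (Suc i) * (gen i * (gen (Suc i) * a))"
proof -
  have "gen i * gen (Suc i) * gen i - gen (Suc i) * gen i * gen (Suc i) \<in> hecke_relations n"
    unfolding hecke_relations_def using assms(1,2)
    by (intro UnI1 UnI2 CollectI exI[of _ i] exI[of _ "Suc i"]) simp
  from Z_relation[OF this assms(3)] show ?thesis
    by (simp add: cong_def algebra_simps)
qed

lemma cong_commute:
  assumes "i \<in> {1..<n}" "j \<in> {1..<n}" "Suc i < j \<or> Suc j < i" "a \<in> free_carrier n"
  shows "gen i * (gen j * a) \<approx>\<^sub>Z gen j * (gen i * a)"
proof -
  have "gen i * gen j - gen j * gen i \<in> hecke_relations n"
    unfolding hecke_relations_def using assms(1-3)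
    by (intro UnI2 CollectI exI[of _ i] exI[of _ j]) auto
  from Z_relation[OF this assms(4)] show ?thesis
    by (simp add: cong_def algebra_simps)
qed

text \<open>The generator divided by q^(1/2). Braid and commutation relations are homogeneous and
  survive this scaling, and each \<open>coset_elt\<close> is a pure product of such factors.\<close>

definition tau :: "nat \<Rightarrow> free_alg \<Rightarrow> free_alg" where
  "tau i x = scal q_half_inv * (gen i * x)"

lemma gen_scal: "gen i * (scal c * x) = scal c * (gen i * x)"
  by (metis mult.assoc scal_commutes)

lemma gen_tau: "gen i * x = scal q_half * tau i x"
  by (simp add: tau_def mult.assoc[symmetric] scal_mult[symmetric] q_half_inv scal_one)

lemma tau_cong: "i \<in> {1..<n} \<Longrightarrow> x \<approx>\<^sub>Z y \<Longrightarrow> tau i x \<approx>\<^sub>Z tau i y"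
  unfolding tau_def by (intro cong_mult free_carrier_closed)

lemma tau_braid:
  assumes "i \<in> {1..<n}" "Suc i \<in> {1..<n}" "a \<in> free_carrier n"
  shows "tau i (tau (Suc i) (tau i a)) \<approx>\<^sub>Z tau (Suc i) (tau i (tau (Suc i) a))"
  unfolding tau_def gen_scal
  by (intro cong_mult free_carrier_scal cong_braid assms)

lemma tau_commute:
  assumes "i \<in> {1..<n}" "j \<in> {1..<n}" "Suc i < j \<or> Suc j < i" "a \<in> free_carrier n"
  shows "tau i (tau j a) \<approx>\<^sub>Z tau j (tau i a)"
  unfolding tau_def gen_scal
  by (intro cong_mult free_carrier_scal cong_commute assms)

abbreviation e :: "(nat \<Rightarrow> nat) \<Rightarrow> free_alg" where
  "e \<equiv> coset_elt n"

text \<open>Two descents of \<open>f\<close> lead down to a common colouring by the two sides of a commutation or braid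
  relation, so the choice of reduced word does not matter.\<close>

lemma e_descent: "i \<in> descents n f \<Longrightarrow> e f \<approx>\<^sub>Z tau i (e (swap_levels i f))"
proof (induction f arbitrary: i rule: disorder_induct[of n])
  case (step f)
  have less: "disorder n (swap_levels i g) < disorder n g" if "i \<in> descents n g" for i g
    using that disorder_swap_levels by (simp add: descents_def)
  have any_two: "tau i (e (swap_levels i f)) \<approx>\<^sub>Z tau j (e (swap_levels j f))"
    if ij: "i \<in> descents n f" "j \<in> descents n f" "i < j" for i j
  proof (cases "j = Suc i")
    case False
    let ?fi = "swap_levels i f" and ?fj = "swap_levels j f"
    let ?g = "swap_levels j ?fi"
    have far: "Suc i < j \<or> Suc j < i" using False ij(3) by simp
    have n: "i \<in> {1..<n}" "j \<in> {1..<n}" using ij by (simp_all add: descents_def)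
    have g: "?g = swap_levels i ?fj" by (rule swap_levels_commute) (use far in auto)
    have "j \<in> descents n ?fi" "i \<in> descents n ?fj"
      using ij far by (auto simp: descents_def swap_levels_apply)
    then have 1: "e ?fi \<approx>\<^sub>Z tau j (e ?g)" "e ?fj \<approx>\<^sub>Z tau i (e ?g)"
      using step.IH less ij unfolding g by (metis g)+
    have "tau i (e ?fi) \<approx>\<^sub>Z tau i (tau j (e ?g))" by (intro tau_cong 1 n)
    also have "\<dots> \<approx>\<^sub>Z tau j (tau i (e ?g))" by (intro tau_commute far n coset_elt_carrier)
    also have "\<dots> \<approx>\<^sub>Z tau j (e ?fj)" by (intro tau_cong cong_sym[OF 1(2)] n)
    finally show ?thesis .
  next
    case True
    let ?f1 = "swap_levels i f" let ?f2 = "swap_levels j ?f1" let ?f3 = "swap_levels i ?f2"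
    let ?g1 = "swap_levels j f" let ?g2 = "swap_levels i ?g1" let ?g3 = "swap_levels j ?g2"
    have n: "i \<in> {1..<n}" "j \<in> {1..<n}" using ij by (simp_all add: descents_def)
    \<comment> \<open>Descents at \<open>i\<close> and \<open>Suc i\<close> mean three strictly
      decreasing colours. Sorting them along either side of the hexagon ends at the same colouring,
      and every step on both sides is a descent.\<close>
    have f3: "?g3 = ?f3" using swap_levels_braid[of i f] True by simp
    have d: "j \<in> descents n ?f1" "i \<in> descents n ?f2" "i \<in> descents n ?g1" "j \<in> descents n ?g2"
      using ij True by (auto simp: descents_def swap_levels_apply)
    have l: "disorder n ?f1 < disorder n f" "disorder n ?g1 < disorder n f"
      "disorder n ?f2 < disorder n f" "disorder n ?g2 < disorder n f"
      using less[OF ij(1)] less[OF ij(2)] less[OF d(1)] less[OF d(3)] by simp_all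
    have "tau i (e ?f1) \<approx>\<^sub>Z tau i (tau j (e ?f2))" by (intro tau_cong n step.IH l d)
    also have "\<dots> \<approx>\<^sub>Z tau i (tau j (tau i (e ?f3)))" by (intro tau_cong n step.IH l d)
    also have "\<dots> \<approx>\<^sub>Z tau j (tau i (tau j (e ?f3)))"
      unfolding True by (rule tau_braid) (use n True coset_elt_carrier in auto)
    also have "\<dots> \<approx>\<^sub>Z tau j (tau i (e ?g2))"
      by (intro tau_cong n cong_sym[OF step.IH[OF l(4) d(4), unfolded f3]])
    also have "\<dots> \<approx>\<^sub>Z tau j (e ?g1)"
      by (intro tau_cong n cong_sym[OF step.IH[OF l(2) d(3)]])
    finally show ?thesis .
  qed
  have "descents n f \<noteq> {}" using step.prems by blast
  then obtain j where j: "j \<in> descents n f" "e f = tau j (e (swap_levels j f))"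
    unfolding tau_def by (rule coset_elt_descent)
  show ?case
    \<comment> \<open>\<open>coset_elt\<close> recurses along one descent \<open>j\<close>; the
      given descent \<open>i\<close> is compared with it. \<open>any_two\<close> expects the smaller
      index first, so it is used once as it stands and once reversed.\<close>
    using any_two[OF j(1) step.prems] cong_sym[OF any_two[OF step.prems j(1)]] j(2)
    by (cases i j rule: linorder_cases) auto
qed

lemma gen_e_ascent:
  assumes "i \<in> {1..<n}" "f i < f (Suc i)"
  shows "gen i * e f \<approx>\<^sub>Z scal q_half * e (swap_levels i f)"
proof -
  have "i \<in> descents n (swap_levels i f)" using assms by (simp add: descents_def swap_levels_apply)
  from e_descent[OF this] have "e (swap_levels i f) \<approx>\<^sub>Z tau i (e f)" by simp
  then show ?thesis
    unfolding gen_tau by (rule cong_mult[OF free_carrier_scal cong_sym])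
qed

text \<open>Replacing \<open>e f\<close> by \<open>tau i (e (swap_levels i f))\<close> puts two
  factors \<open>gen i\<close> side by side, and the quadratic relation applies.\<close>

lemma gen_e_descent:
  assumes "i \<in> {1..<n}" "f (Suc i) < f i"
  shows "gen i * e f \<approx>\<^sub>Z scal (q - 1) * e f + scal q_half * e (swap_levels i f)"
proof -
  let ?g = "swap_levels i f"
  have d: "e f \<approx>\<^sub>Z tau i (e ?g)" using assms by (intro e_descent) (simp add: descents_def)
  have "gen i * e f \<approx>\<^sub>Z gen i * tau i (e ?g)" by (intro cong_mult free_carrier_closed assms d)
  also have "\<dots> = scal q_half_inv * (gen i * (gen i * e ?g))" by (simp add: tau_def gen_scal)
  also have "\<dots> \<approx>\<^sub>Z scal q_half_inv * (scal (q - 1) * (gen i * e ?g) + scal q * e ?g)"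
    by (intro cong_mult free_carrier_scal cong_quadratic assms coset_elt_carrier)
  also have "\<dots> = scal (q - 1) * tau i (e ?g) + scal (q_half_inv * q) * e ?g"
    by (simp add: tau_def distrib_left mult.assoc[symmetric] scal_mult[symmetric] mult.commute)
  also have "q_half_inv * q = q_half"
    by (simp add: q_def power2_eq_square mult.assoc[symmetric] q_half_inv)
  also have "scal (q - 1) * tau i (e ?g) + scal q_half * e ?g \<approx>\<^sub>Z
      scal (q - 1) * e f + scal q_half * e ?g"
    by (intro cong_add cong_mult free_carrier_scal cong_sym[OF d] cong_refl)
  finally show ?thesis .
qed

text \<open>This reflects a fact about a minimal coset representative w: if s_i fixes the coset of
  w, then s_i w = w s_j for some s_j in the parabolic subgroup. The induction lowers
  \<open>f\<close> along descents while following the pair of equal neighbours; at the bottom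
  \<open>f\<close> is the base colouring, and the sign condition applies.\<close>

lemma gen_e_level:
  assumes "i \<in> {1..<n}" "f i = f (Suc i)" "f \<in> colourings n \<mu>"
  shows "gen i * e f \<approx>\<^sub>Z - e f"
proof -
  \<comment> \<open>For the normalised generator the eigenvalue -1 becomes -q^(-1/2).\<close>
  have "tau i (e f) \<approx>\<^sub>Z scal (- q_half_inv) * e f"
    using assms
  proof (induction f arbitrary: i rule: disorder_induct[of n])
    case (step f)
    show ?case
    proof (cases "descents n f = {}")
      case True
      then have f: "f = base_colouring n \<mu>"
        using step.prems by (intro colouring_without_descent[OF sum_mu]) (auto simp: descents_def not_less)
      then have "gen i + 1 \<in> Z" using step.prems by (intro Z_sign) (simp add: parabolic_indices_iff[OF sum_mu])
      then have "gen i \<approx>\<^sub>Z - 1" by (simp add: cong_def)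
      then have "scal q_half_inv * gen i \<approx>\<^sub>Z scal q_half_inv * (- 1)"
        by (intro cong_mult free_carrier_scal)
      then show ?thesis using True by (simp add: coset_elt_no_descent tau_def scal_uminus)
    next
      case False
      then obtain j where j: "j \<in> descents n f" by blast
      let ?g = "swap_levels j f"
      have jn: "j \<in> {1..<n}" using j by (simp add: descents_def)
      have ij: "i \<noteq> j" using j step.prems by (auto simp: descents_def)
      have ef: "e f \<approx>\<^sub>Z tau j (e ?g)" by (rule e_descent[OF j])
      have less: "disorder n ?g < disorder n f"
        using j disorder_swap_levels by (simp add: descents_def)
      have gc: "?g \<in> colourings n \<mu>" by (intro swap_levels_colourings step.prems jn)
      have tau_sc: "tau k (scal c * x) = scal c * tau k x" for k c x
        by (simp add: tau_def gen_scal) (metis mult.assoc scal_commutes)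
      show ?thesis
      proof (cases "Suc i < j \<or> Suc j < i")
        case True
        have "?g i = ?g (Suc i)" using step.prems True by (auto simp: swap_levels_apply)
        with step gc less have IH: "tau i (e ?g) \<approx>\<^sub>Z scal (- q_half_inv) * e ?g" by blast
        have "tau i (e f) \<approx>\<^sub>Z tau i (tau j (e ?g))" by (intro tau_cong ef step.prems)
        also have "\<dots> \<approx>\<^sub>Z tau j (tau i (e ?g))"
          by (intro tau_commute step.prems jn True coset_elt_carrier)
        also have "\<dots> \<approx>\<^sub>Z tau j (scal (- q_half_inv) * e ?g)" by (intro tau_cong jn IH)
        also have "\<dots> = scal (- q_half_inv) * tau j (e ?g)" by (rule tau_sc)
        also have "\<dots> \<approx>\<^sub>Z scal (- q_half_inv) * e f" by (intro cong_mult free_carrier_scal cong_sym[OF ef])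
        finally show ?thesis .
      next
        case False
        then have adj: "j = Suc i \<or> i = Suc j" using ij by auto
        \<comment> \<open>Of the three colours involved two are equal. Both swaps move the third one
          past the equal pair, so the pair travels from \<open>i\<close> to \<open>j\<close>; the
          braid relation transports the eigenvalue back.\<close>
        let ?h = "swap_levels i ?g"
        have di: "i \<in> descents n ?g"
          using adj j step.prems by (auto simp: descents_def swap_levels_apply)
        have eg: "e ?g \<approx>\<^sub>Z tau i (e ?h)" by (rule e_descent[OF di])
        have less': "disorder n ?h < disorder n f"
          using di less disorder_swap_levels[of i n ?g] by (simp add: descents_def)
        have "?h j = ?h (Suc j)" using adj j step.prems by (auto simp: swap_levels_apply)
        moreover have "?h \<in> colourings n \<mu>" by (intro swap_levels_colourings step.prems gc)
        ultimately have IH: "tau j (e ?h) \<approx>\<^sub>Z scal (- q_half_inv) * e ?h"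
          using step.IH[OF less' jn] by blast
        have efh: "e f \<approx>\<^sub>Z tau j (tau i (e ?h))"
          using ef tau_cong[OF jn eg] by (rule cong_trans)
        have "tau i (e f) \<approx>\<^sub>Z tau i (tau j (tau i (e ?h)))" by (intro tau_cong efh step.prems)
        also have "\<dots> \<approx>\<^sub>Z tau j (tau i (tau j (e ?h)))"
          using adj
        proof
          assume "j = Suc i"
          then show ?thesis using tau_braid[of i "e ?h"] step.prems jn coset_elt_carrier by simp
        next
          assume "i = Suc j"
          then show ?thesis using cong_sym[OF tau_braid[of j "e ?h"]] step.prems jn coset_elt_carrier
            by simp
        qed
        also have "\<dots> \<approx>\<^sub>Z tau j (tau i (scal (- q_half_inv) * e ?h))"
          by (intro tau_cong jn step.prems IH)
        also have "\<dots> = scal (- q_half_inv) * tau j (tau i (e ?h))" by (simp add: tau_sc)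
        also have "\<dots> \<approx>\<^sub>Z scal (- q_half_inv) * e f"
          by (intro cong_mult free_carrier_scal cong_sym[OF efh])
        finally show ?thesis .
      qed
    qed
  qed
  then have "scal q_half * tau i (e f) \<approx>\<^sub>Z scal q_half * (scal (- q_half_inv) * e f)"
    by (intro cong_mult free_carrier_scal)
  also have "scal q_half * (scal (- q_half_inv) * e f) = - e f"
    by (simp add: mult.assoc[symmetric] scal_mult[symmetric] q_half_inv scal_uminus scal_one)
  finally show ?thesis unfolding gen_tau .
qed

definition spanned :: "free_alg \<Rightarrow> bool" where
  "spanned x \<longleftrightarrow> (\<exists>c. x \<approx>\<^sub>Z (\<Sum>f\<in>colourings n \<mu>. scal (c f) * e f))"

lemma spanned_cong: "x \<approx>\<^sub>Z y \<Longrightarrow> spanned y \<Longrightarrow> spanned x"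
  unfolding spanned_def by (blast intro: cong_trans)

lemma spanned_add:
  assumes "spanned x" "spanned y"
  shows "spanned (x + y)"
proof -
  obtain c d where "x \<approx>\<^sub>Z (\<Sum>f\<in>colourings n \<mu>. scal (c f) * e f)"
    "y \<approx>\<^sub>Z (\<Sum>f\<in>colourings n \<mu>. scal (d f) * e f)"
    using assms by (auto simp: spanned_def)
  from cong_add[OF this] have "x + y \<approx>\<^sub>Z (\<Sum>f\<in>colourings n \<mu>. scal (c f + d f) * e f)"
    by (simp add: sum.distrib[symmetric] distrib_right scal_add)
  then show ?thesis by (auto simp: spanned_def)
qed

lemma spanned_scal:
  assumes "spanned x"
  shows "spanned (scal a * x)"
proof -
  obtain c where "x \<approx>\<^sub>Z (\<Sum>f\<in>colourings n \<mu>. scal (c f) * e f)"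
    using assms by (auto simp: spanned_def)
  from cong_mult[OF free_carrier_scal[of a] this]
  have "scal a * x \<approx>\<^sub>Z (\<Sum>f\<in>colourings n \<mu>. scal (a * c f) * e f)"
    by (simp add: sum_distrib_left mult.assoc[symmetric] scal_mult)
  then show ?thesis by (auto simp: spanned_def)
qed

lemma spanned_e:
  assumes "f \<in> colourings n \<mu>"
  shows "spanned (e f)"
proof -
  have "(\<Sum>g\<in>colourings n \<mu>. scal (delta f g) * e g) = (\<Sum>g\<in>colourings n \<mu>. if g = f then e g else 0)"
    by (rule sum.cong) (auto simp: delta_def scal_one scal_zero)
  also have "\<dots> = e f" using assms finite_colourings by simp
  finally show ?thesis unfolding spanned_def by (metis cong_refl)
qed

lemma spanned_sum: "(\<And>i. i \<in> I \<Longrightarrow> spanned (x i)) \<Longrightarrow> spanned (sum x I)"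
proof (induction I rule: infinite_finite_induct)
  case (insert i I)
  then show ?case by (simp add: spanned_add)
next
  case empty
  show ?case unfolding spanned_def by (rule exI[of _ "\<lambda>_. 0"]) (simp add: scal_zero)
next
  case (infinite I)
  then show ?case unfolding spanned_def by (intro exI[of _ "\<lambda>_. 0"]) (simp add: scal_zero)
qed

lemma spanned_gen_e:
  assumes "i \<in> {1..<n}" "f \<in> colourings n \<mu>"
  shows "spanned (gen i * e f)"
proof (cases "f i" "f (Suc i)" rule: linorder_cases)
  case less
  then show ?thesis
    using gen_e_ascent assms by (blast intro: spanned_cong spanned_scal spanned_e swap_levels_colourings)
next
  case equal
  have "- e f = scal (- 1) * e f" by (simp add: scal_uminus scal_one)
  then have "gen i * e f \<approx>\<^sub>Z scal (- 1) * e f" using gen_e_level[OF assms(1) equal assms(2)] by simp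
  then show ?thesis using assms by (blast intro: spanned_cong spanned_scal spanned_e)
next
  case greater
  then show ?thesis
    using gen_e_descent assms
    by (blast intro: spanned_cong spanned_add spanned_scal spanned_e swap_levels_colourings)
qed

lemma spanned_gen:
  assumes "i \<in> {1..<n}" "spanned x"
  shows "spanned (gen i * x)"
proof -
  obtain c where "x \<approx>\<^sub>Z (\<Sum>f\<in>colourings n \<mu>. scal (c f) * e f)"
    using assms by (auto simp: spanned_def)
  from cong_mult[OF free_carrier_gen[OF assms(1)] this]
  have "gen i * x \<approx>\<^sub>Z (\<Sum>f\<in>colourings n \<mu>. scal (c f) * (gen i * e f))"
    by (simp add: sum_distrib_left gen_scal)
  moreover have "spanned (\<Sum>f\<in>colourings n \<mu>. scal (c f) * (gen i * e f))"
    using assms(1) by (intro spanned_sum spanned_scal spanned_gen_e)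
  ultimately show ?thesis by (rule spanned_cong)
qed

lemma e_base: "e (base_colouring n \<mu>) = 1"
proof (rule coset_elt_no_descent)
  have "base_colouring n \<mu> i \<le> base_colouring n \<mu> (Suc i)" if "i \<in> {1..<n}" for i
    using that by (intro base_colouring_mono[OF sum_mu]) auto
  then show "descents n (base_colouring n \<mu>) = {}" by (fastforce simp: descents_def)
qed

text \<open>The span contains 1, which is the representative of the base colouring, and is stable
  under left multiplication by generators and scalars; hence it contains every word.\<close>

theorem all_spanned: "p \<in> free_carrier n \<Longrightarrow> spanned p"
proof (induction p rule: free_alg_induct)
  case (monomial w c)
  obtain xs where w: "w = Word xs" by (cases w)
  have "spanned (Poly_Mapping.single (Word xs) c)" if "set xs \<subseteq> {1..<n}" for xs
    using that
  proof (induction xs)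
    case Nil
    have "spanned 1"
      using spanned_e[OF base_colouring_in_colourings[OF sum_mu]] by (simp add: e_base)
    from spanned_scal[OF this] show ?case by (simp add: monomial_Nil)
  next
    case (Cons i xs)
    then show ?case by (simp add: monomial_Cons spanned_gen)
  qed
  then show ?case using monomial w by simp
next
  case (add p p')
  then show ?case by (simp add: spanned_add)
qed

end

section \<open>Traces and dual bases\<close>

no_notation vwalk_join (infixr "\<oplus>" 65)

text \<open>Module axioms stated for \<open>smult\<close> alone: the scalars are a type rather than
  a carrier set, and \<open>induced_module\<close> leaves \<open>mult\<close> and \<open>one\<close>
  of its record \<open>undefined\<close>.\<close>

locale scalar_module = abelian_group M for M :: "('r::comm_ring_1, 'm) module" (structure) +
  assumes scalar_closed: "x \<in> carrier M \<Longrightarrow> c \<odot> x \<in> carrier M"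
    and scalar_add_left: "x \<in> carrier M \<Longrightarrow> (c + d) \<odot> x = c \<odot> x \<oplus> d \<odot> x"
    and scalar_add_right: "x \<in> carrier M \<Longrightarrow> y \<in> carrier M \<Longrightarrow> c \<odot> (x \<oplus> y) = c \<odot> x \<oplus> c \<odot> y"
    and scalar_mult: "x \<in> carrier M \<Longrightarrow> (c * d) \<odot> x = c \<odot> (d \<odot> x)"
    and scalar_one: "x \<in> carrier M \<Longrightarrow> 1 \<odot> x = x"
begin

definition linear_functional :: "('m \<Rightarrow> 'r) \<Rightarrow> bool" where
  "linear_functional \<Phi> \<longleftrightarrow>
    (\<forall>x\<in>carrier M. \<forall>y\<in>carrier M. \<Phi> (x \<oplus> y) = \<Phi> x + \<Phi> y) \<and>
    (\<forall>c. \<forall>x\<in>carrier M. \<Phi> (c \<odot> x) = c * \<Phi> x)"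

definition linear_endo :: "('m \<Rightarrow> 'm) \<Rightarrow> bool" where
  "linear_endo u \<longleftrightarrow> u \<in> carrier M \<rightarrow> carrier M \<and>
    (\<forall>x\<in>carrier M. \<forall>y\<in>carrier M. u (x \<oplus> y) = u x \<oplus> u y) \<and>
    (\<forall>c. \<forall>x\<in>carrier M. u (c \<odot> x) = c \<odot> u x)"

lemma linear_functional_zero: "linear_functional \<Phi> \<Longrightarrow> \<Phi> \<zero> = 0"
  unfolding linear_functional_def by (metis add_cancel_left_left l_zero zero_closed)

lemma linear_endo_zero:
  assumes "linear_endo u" shows "u \<zero> = \<zero>"
proof -
  have "u \<zero> \<in> carrier M" using assms by (auto simp: linear_endo_def)
  moreover have "u \<zero> \<oplus> u \<zero> = u \<zero>" using assms unfolding linear_endo_def by (metis l_zero zero_closed)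
  ultimately show ?thesis by (metis add.r_cancel_one')
qed

lemma linear_functional_finsum:
  assumes "linear_functional \<Phi>" "finite I" "\<And>i. i \<in> I \<Longrightarrow> b i \<in> carrier M"
  shows "\<Phi> (\<Oplus>i\<in>I. c i \<odot> b i) = (\<Sum>i\<in>I. c i * \<Phi> (b i))"
  using assms(2,3)
proof (induction I rule: finite_induct)
  case empty
  then show ?case by (simp add: linear_functional_zero[OF assms(1)])
next
  case (insert i I)
  then have "(\<Oplus>i\<in>insert i I. c i \<odot> b i) = c i \<odot> b i \<oplus> (\<Oplus>i\<in>I. c i \<odot> b i)"
    by (intro finsum_insert) (auto intro: scalar_closed)
  moreover have "(\<Oplus>i\<in>I. c i \<odot> b i) \<in> carrier M"
    using insert by (intro finsum_closed) (auto intro: scalar_closed)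
  ultimately show ?case
    using insert assms(1) by (simp add: linear_functional_def scalar_closed)
qed

lemma linear_endo_finsum:
  assumes "linear_endo u" "finite I" "\<And>i. i \<in> I \<Longrightarrow> b i \<in> carrier M"
  shows "u (\<Oplus>i\<in>I. c i \<odot> b i) = (\<Oplus>i\<in>I. c i \<odot> u (b i))"
  using assms(2,3)
proof (induction I rule: finite_induct)
  case empty
  then show ?case by (simp add: linear_endo_zero[OF assms(1)])
next
  case (insert i I)
  have ub: "u x \<in> carrier M" if "x \<in> carrier M" for x
    using that assms(1) by (auto simp: linear_endo_def)
  have "(\<Oplus>i\<in>insert i I. c i \<odot> b i) = c i \<odot> b i \<oplus> (\<Oplus>i\<in>I. c i \<odot> b i)"
    using insert by (intro finsum_insert) (auto intro: scalar_closed)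
  moreover have "(\<Oplus>i\<in>insert i I. c i \<odot> u (b i)) = c i \<odot> u (b i) \<oplus> (\<Oplus>i\<in>I. c i \<odot> u (b i))"
    using insert by (intro finsum_insert) (auto intro: scalar_closed ub)
  moreover have "(\<Oplus>i\<in>I. c i \<odot> b i) \<in> carrier M"
    using insert by (intro finsum_closed) (auto intro: scalar_closed)
  ultimately show ?case
    using insert assms(1) by (simp add: linear_endo_def scalar_closed)
qed

text \<open>A basis with its coordinates given as linear functionals, which turns matrix entries
  into values \<open>\<Phi> i (u (b j))\<close>.\<close>

definition dual_basis :: "nat \<Rightarrow> (nat \<Rightarrow> 'm) \<Rightarrow> (nat \<Rightarrow> 'm \<Rightarrow> 'r) \<Rightarrow> bool" where
  "dual_basis k b \<Phi> \<longleftrightarrow> b \<in> {..<k} \<rightarrow> carrier M \<and> (\<forall>i<k. linear_functional (\<Phi> i)) \<and>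
    (\<forall>i<k. \<forall>j<k. \<Phi> i (b j) = (if i = j then 1 else 0)) \<and>
    (\<forall>x\<in>carrier M. x = (\<Oplus>i\<in>{..<k}. \<Phi> i x \<odot> b i))"

lemma dual_basis_coefficient:
  assumes "dual_basis k b \<Phi>" "j < k"
  shows "\<Phi> j (\<Oplus>i\<in>{..<k}. c i \<odot> b i) = c j"
proof -
  have "\<Phi> j (\<Oplus>i\<in>{..<k}. c i \<odot> b i) = (\<Sum>i<k. c i * \<Phi> j (b i))"
    using assms by (intro linear_functional_finsum) (auto simp: dual_basis_def)
  also have "\<dots> = (\<Sum>i<k. if i = j then c j else 0)"
    using assms by (intro sum.cong) (auto simp: dual_basis_def)
  finally show ?thesis using assms by simp
qed

lemma dual_basis_imp_module_basis:
  assumes "dual_basis k b \<Phi>"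
  shows "module_basis M k b"
  unfolding module_basis_def
proof (intro conjI ballI)
  show "b \<in> {..<k} \<rightarrow> carrier M" using assms by (simp add: dual_basis_def)
  fix x assume x: "x \<in> carrier M"
  let ?c = "\<lambda>i\<in>{..<k}. \<Phi> i x"
  show "\<exists>!c. c \<in> {..<k} \<rightarrow>\<^sub>E UNIV \<and> x = (\<Oplus>i\<in>{..<k}. c i \<odot> b i)"
  proof (rule ex1I[of _ ?c])
    have "(\<Oplus>i\<in>{..<k}. ?c i \<odot> b i) = (\<Oplus>i\<in>{..<k}. \<Phi> i x \<odot> b i)"
      using assms by (intro finsum_cong') (auto simp: dual_basis_def intro!: scalar_closed)
    then show "?c \<in> {..<k} \<rightarrow>\<^sub>E UNIV \<and> x = (\<Oplus>i\<in>{..<k}. ?c i \<odot> b i)"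
      using assms x by (simp add: dual_basis_def)
  next
    fix c assume c: "c \<in> {..<k} \<rightarrow>\<^sub>E UNIV \<and> x = (\<Oplus>i\<in>{..<k}. c i \<odot> b i)"
    then have "\<Phi> j x = c j" if "j < k" for j
      using dual_basis_coefficient[OF assms that] by simp
    with c show "c = ?c" by (auto simp: PiE_def extensional_def)
  qed
qed

text \<open>The coordinates are picked by a definite description; their uniqueness is what makes
  them additive and homogeneous.\<close>

lemma module_basis_imp_dual_basis:
  assumes "module_basis M k b"
  obtains \<Phi> where "dual_basis k b \<Phi>"
proof -
  have b: "b i \<in> carrier M" if "i < k" for i
    using assms that by (auto simp: module_basis_def)
  let ?P = "\<lambda>x c. c \<in> {..<k} \<rightarrow>\<^sub>E UNIV \<and> x = (\<Oplus>i\<in>{..<k}. c i \<odot> b i)"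
  define \<Phi> where "\<Phi> i x = (THE c. ?P x c) i" for i x
  have ex1: "\<exists>!c. ?P x c" if "x \<in> carrier M" for x
    using assms that unfolding module_basis_def by (elim conjE bspec)
  have P: "?P x (THE c. ?P x c)" if "x \<in> carrier M" for x
    using ex1[OF that] by (rule theI')
  have expand: "x = (\<Oplus>i\<in>{..<k}. \<Phi> i x \<odot> b i)" if "x \<in> carrier M" for x
    using P[OF that] by (simp add: \<Phi>_def)
  have unique: "\<Phi> i x = c i" if "x \<in> carrier M" "x = (\<Oplus>i\<in>{..<k}. c i \<odot> b i)" "i < k" for x c i
  proof -
    \<comment> \<open>Uniqueness in \<open>module_basis\<close> concerns extensional coefficient
      functions, so an arbitrary \<open>c\<close> has to be restricted first.\<close>
    have "(\<Oplus>i\<in>{..<k}. restrict c {..<k} i \<odot> b i) = (\<Oplus>i\<in>{..<k}. c i \<odot> b i)"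
      by (intro finsum_cong') (auto intro!: scalar_closed b)
    then have "?P x (restrict c {..<k})" using that by simp
    with ex1[OF that(1)] have "(THE c. ?P x c) = restrict c {..<k}" by (rule the1_equality[where P = "?P x"])
    then show ?thesis using that by (simp add: \<Phi>_def)
  qed
  have zero_scalar: "0 \<odot> x = \<zero>" if "x \<in> carrier M" for x
  proof -
    have "0 \<odot> x \<oplus> 0 \<odot> x = 0 \<odot> x" using scalar_add_left[OF that, of 0 0] by simp
    then show ?thesis using scalar_closed[OF that] by (metis add.r_cancel_one')
  qed
  have "linear_functional (\<Phi> i)" if "i < k" for i
    unfolding linear_functional_def
  proof (intro conjI allI ballI)
    fix x y assume xy: "x \<in> carrier M" "y \<in> carrier M"
    have "x \<oplus> y = (\<Oplus>i\<in>{..<k}. \<Phi> i x \<odot> b i) \<oplus> (\<Oplus>i\<in>{..<k}. \<Phi> i y \<odot> b i)"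
      using expand xy by metis
    also have "\<dots> = (\<Oplus>i\<in>{..<k}. \<Phi> i x \<odot> b i \<oplus> \<Phi> i y \<odot> b i)"
      by (intro finsum_addf[symmetric]) (auto intro!: scalar_closed b)
    also have "\<dots> = (\<Oplus>i\<in>{..<k}. (\<Phi> i x + \<Phi> i y) \<odot> b i)"
      by (intro finsum_cong') (auto simp: scalar_add_left b intro!: scalar_closed)
    finally have "x \<oplus> y = (\<Oplus>i\<in>{..<k}. (\<Phi> i x + \<Phi> i y) \<odot> b i)" .
    from unique[OF a_closed[OF xy] this that] show "\<Phi> i (x \<oplus> y) = \<Phi> i x + \<Phi> i y" .
  next
    fix c x assume x: "x \<in> carrier M"
    have fc: "finsum M f I \<in> carrier M" if "\<And>i. i \<in> I \<Longrightarrow> f i \<in> carrier M" for f and I :: "nat set"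
      using that by (intro finsum_closed) auto
    have dist: "c \<odot> (\<Oplus>i\<in>I. d i \<odot> b i) = (\<Oplus>i\<in>I. (c * d i) \<odot> b i)"
      if "finite I" "I \<subseteq> {..<k}" for I d
      using that
    proof (induction I rule: finite_induct)
      case empty
      have "c \<odot> \<zero> \<oplus> c \<odot> \<zero> = c \<odot> \<zero>" using scalar_add_right[of \<zero> \<zero> c] by simp
      then have "c \<odot> \<zero> = \<zero>" using scalar_closed[of \<zero> c] by (metis add.r_cancel_one' zero_closed)
      then show ?case by simp
    next
      case (insert i I)
      have sub: "\<And>i. i \<in> I \<Longrightarrow> b i \<in> carrier M" "b i \<in> carrier M" using insert b by auto
      have "(\<Oplus>i\<in>insert i I. d i \<odot> b i) = d i \<odot> b i \<oplus> (\<Oplus>i\<in>I. d i \<odot> b i)"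
        using insert sub by (intro finsum_insert) (auto intro!: scalar_closed)
      moreover have "(\<Oplus>i\<in>insert i I. (c * d i) \<odot> b i) = (c * d i) \<odot> b i \<oplus> (\<Oplus>i\<in>I. (c * d i) \<odot> b i)"
        using insert sub by (intro finsum_insert) (auto intro!: scalar_closed)
      moreover have "(\<Oplus>i\<in>I. d i \<odot> b i) \<in> carrier M" using sub by (intro fc) (auto intro!: scalar_closed)
      ultimately show ?case
        using insert sub by (simp add: scalar_add_right scalar_mult scalar_closed)
    qed
    have "c \<odot> x = c \<odot> (\<Oplus>i\<in>{..<k}. \<Phi> i x \<odot> b i)" using expand[OF x] by simp
    also have "\<dots> = (\<Oplus>i\<in>{..<k}. (c * \<Phi> i x) \<odot> b i)" by (intro dist) auto
    finally show "\<Phi> i (c \<odot> x) = c * \<Phi> i x"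
      using x that by (intro unique scalar_closed)
  qed
  moreover have "\<Phi> i (b j) = (if i = j then 1 else 0)" if "i < k" "j < k" for i j
  proof -
    have "(\<Oplus>l\<in>{..<k}. (if l = j then 1 else 0) \<odot> b l) = (\<Oplus>l\<in>{..<k}. if j = l then b l else \<zero>)"
      by (intro finsum_cong') (auto simp: scalar_one zero_scalar b)
    also have "\<dots> = b j"
      using that b by (intro add.finprod_singleton) auto
    finally have "b j = (\<Oplus>l\<in>{..<k}. (if l = j then 1 else 0) \<odot> b l)" by simp
    from unique[OF b[OF that(2)] this that(1)] show ?thesis .
  qed
  ultimately have "dual_basis k b \<Phi>"
    unfolding dual_basis_def using b expand by blast
  then show thesis by (rule that)
qed

text \<open>Expanding each basis in the other turns both traces into the double sum of
  \<open>\<Phi>' j (b i) * \<Phi> i (u (b' j))\<close>. No transition matrix is inverted, and the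
  two bases may have different lengths.\<close>

lemma dual_basis_trace_eq:
  assumes "dual_basis k b \<Phi>" "dual_basis k' b' \<Phi>'" "linear_endo u"
  shows "(\<Sum>i<k. \<Phi> i (u (b i))) = (\<Sum>j<k'. \<Phi>' j (u (b' j)))"
proof -
  have b: "b i \<in> carrier M" "linear_functional (\<Phi> i)" if "i < k" for i
    using assms(1) that by (auto simp: dual_basis_def)
  have b': "b' i \<in> carrier M" "linear_functional (\<Phi>' i)" if "i < k'" for i
    using assms(2) that by (auto simp: dual_basis_def)
  have u: "u x \<in> carrier M" if "x \<in> carrier M" for x
    using assms(3) that by (auto simp: linear_endo_def)
  have 1: "\<Phi> i (u (b i)) = (\<Sum>j<k'. \<Phi>' j (b i) * \<Phi> i (u (b' j)))" if "i < k" for i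
  proof -
    have "u (b i) = u (\<Oplus>j\<in>{..<k'}. \<Phi>' j (b i) \<odot> b' j)"
      using assms(2) b(1)[OF that] by (simp add: dual_basis_def)
    also have "\<dots> = (\<Oplus>j\<in>{..<k'}. \<Phi>' j (b i) \<odot> u (b' j))"
      by (intro linear_endo_finsum assms b') auto
    also have "\<Phi> i \<dots> = (\<Sum>j<k'. \<Phi>' j (b i) * \<Phi> i (u (b' j)))"
      by (intro linear_functional_finsum b that u b') auto
    finally show ?thesis .
  qed
  have 2: "\<Phi>' j (u (b' j)) = (\<Sum>i<k. \<Phi> i (u (b' j)) * \<Phi>' j (b i))" if "j < k'" for j
  proof -
    have "u (b' j) = (\<Oplus>i\<in>{..<k}. \<Phi> i (u (b' j)) \<odot> b i)"
      using assms(1) u[OF b'(1)[OF that]] by (simp add: dual_basis_def)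
    then have "\<Phi>' j (u (b' j)) = \<Phi>' j (\<Oplus>i\<in>{..<k}. \<Phi> i (u (b' j)) \<odot> b i)" by simp
    also have "\<dots> = (\<Sum>i<k. \<Phi> i (u (b' j)) * \<Phi>' j (b i))"
      by (intro linear_functional_finsum b that b') auto
    finally show ?thesis .
  qed
  have "(\<Sum>i<k. \<Phi> i (u (b i))) = (\<Sum>i<k. \<Sum>j<k'. \<Phi>' j (b i) * \<Phi> i (u (b' j)))"
    by (intro sum.cong) (simp_all add: 1)
  also have "\<dots> = (\<Sum>j<k'. \<Sum>i<k. \<Phi> i (u (b' j)) * \<Phi>' j (b i))"
    by (subst sum.swap) (simp add: mult.commute)
  also have "\<dots> = (\<Sum>j<k'. \<Phi>' j (u (b' j)))"
    by (intro sum.cong) (simp_all add: 2)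
  finally show ?thesis .
qed

lemma module_trace_dual_basis:
  assumes "dual_basis k b \<Phi>" "linear_endo u"
  shows "module_trace M u = (\<Sum>i<k. \<Phi> i (u (b i)))"
  unfolding module_trace_def
proof (rule the_equality)
  have "u (b j) \<in> carrier M" if "j < k" for j
    using assms that by (auto simp: dual_basis_def linear_endo_def)
  then have "\<forall>j<k. u (b j) = (\<Oplus>i\<in>{..<k}. \<Phi> i (u (b j)) \<odot> b i)"
    using assms(1) by (simp add: dual_basis_def)
  then show "\<exists>k' b' C. module_basis M k' b' \<and>
      (\<forall>j<k'. u (b' j) = (\<Oplus>i\<in>{..<k'}. C i j \<odot> b' i)) \<and> (\<Sum>i<k. \<Phi> i (u (b i))) = (\<Sum>i<k'. C i i)"
    using dual_basis_imp_module_basis[OF assms(1)]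
    by (intro exI[of _ k] exI[of _ b] exI[of _ "\<lambda>i j. \<Phi> i (u (b j))"]) simp
next
  fix t
  assume "\<exists>k' b' C. module_basis M k' b' \<and>
      (\<forall>j<k'. u (b' j) = (\<Oplus>i\<in>{..<k'}. C i j \<odot> b' i)) \<and> t = (\<Sum>i<k'. C i i)"
  then obtain k' b' C where *: "module_basis M k' b'"
    "\<forall>j<k'. u (b' j) = (\<Oplus>i\<in>{..<k'}. C i j \<odot> b' i)" "t = (\<Sum>i<k'. C i i)"
    by blast
  obtain \<Phi>' where d: "dual_basis k' b' \<Phi>'" by (rule module_basis_imp_dual_basis[OF *(1)])
  have "\<Phi>' j (u (b' j)) = C j j" if "j < k'" for j
    using *(2) that dual_basis_coefficient[OF d that, of "\<lambda>i. C i j"] by simp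
  then have "t = (\<Sum>j<k'. \<Phi>' j (u (b' j)))" by (simp add: *(3))
  also have "\<dots> = (\<Sum>i<k. \<Phi> i (u (b i)))" using dual_basis_trace_eq[OF assms(1) d assms(2)] by simp
  finally show "t = (\<Sum>i<k. \<Phi> i (u (b i)))" .
qed

end

section \<open>Modules induced from a character\<close>

locale induced_from_character = ring H for H :: "'h ring" (structure) +
  fixes P :: "'h set" and \<phi> :: "'h \<Rightarrow> laurent" and \<iota> :: "laurent \<Rightarrow> 'h"
  assumes P_sub: "P \<subseteq> carrier H"
    and scalar_in_P: "\<iota> c \<in> P"
    and character_scalar: "\<phi> (\<iota> c) = c"
    and scalar_add: "\<iota> (c + d) = \<iota> c \<oplus> \<iota> d"
    and scalar_mult: "\<iota> (c * d) = \<iota> c \<otimes> \<iota> d"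
    and scalar_one: "\<iota> 1 = \<one>"
    and scalar_central: "h \<in> carrier H \<Longrightarrow> \<iota> c \<otimes> h = h \<otimes> \<iota> c"
begin

abbreviation G :: "(('h \<times> laurent) \<Rightarrow>\<^sub>0 int) monoid" where
  "G \<equiv> tensor_group H"

abbreviation N :: "(('h \<times> laurent) \<Rightarrow>\<^sub>0 int) set" where
  "N \<equiv> tensor_null H P \<phi>"

abbreviation M :: "(laurent, (('h \<times> laurent) \<Rightarrow>\<^sub>0 int) set) module" where
  "M \<equiv> induced_module H \<iota> P \<phi>"

lemma scalar_carrier: "\<iota> c \<in> carrier H"
  using P_sub scalar_in_P by blast

lemma carrier_G: "x \<in> carrier G \<longleftrightarrow> Poly_Mapping.keys x \<subseteq> carrier H \<times> UNIV"
  by (simp add: tensor_group_def)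

lemma mult_G: "x \<otimes>\<^bsub>G\<^esub> y = x + y"
  and one_G: "\<one>\<^bsub>G\<^esub> = 0"
  by (simp_all add: tensor_group_def)

lemma inv_G: "x \<in> carrier G \<Longrightarrow> inv\<^bsub>G\<^esub> x = - x"
  by (simp add: tensor_group_def)

lemma comm_group_G: "comm_group G"
  by (simp add: tensor_group_def abelian_free_Abelian_group)

lemma group_G: "group G"
  using comm_group_G by (rule comm_group.axioms)

lemma frag_of_G: "h \<in> carrier H \<Longrightarrow> frag_of (h, r) \<in> carrier G"
  by (simp add: carrier_G)

lemma diff_G: "x \<in> carrier G \<Longrightarrow> y \<in> carrier G \<Longrightarrow> x - y \<in> carrier G"
  unfolding carrier_G using keys_diff[of x y] by blast

lemma add_G: "x \<in> carrier G \<Longrightarrow> y \<in> carrier G \<Longrightarrow> x + y \<in> carrier G"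
  unfolding carrier_G using keys_add[of x y] by blast

lemma tensor_relations_G: "tensor_relations H P \<phi> \<subseteq> carrier G"
  unfolding tensor_relations_def using P_sub
  by (auto intro!: diff_G frag_of_G)

lemma tensor_relations_cases [consumes 1, case_names left right balanced]:
  assumes "x \<in> tensor_relations H P \<phi>"
  obtains h h' r where "h \<in> carrier H" "h' \<in> carrier H"
      "x = frag_of (h \<oplus> h', r) - frag_of (h, r) - frag_of (h', r)"
  | h r r' where "h \<in> carrier H" "x = frag_of (h, r + r') - frag_of (h, r) - frag_of (h, r')"
  | h p r where "h \<in> carrier H" "p \<in> P" "x = frag_of (h \<otimes> p, r) - frag_of (h, \<phi> p * r)"
proof -
  from assms show thesis
    unfolding tensor_relations_def
  proof (elim UnE CollectE exE conjE)
  qed (rule that(1), assumption, assumption, assumption, rule that(2), assumption, assumption,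
      rule that(3), assumption, assumption, assumption)
qed

lemma tensor_relations_left: "h \<in> carrier H \<Longrightarrow> h' \<in> carrier H \<Longrightarrow>
    frag_of (h \<oplus> h', r) - frag_of (h, r) - frag_of (h', r) \<in> tensor_relations H P \<phi>"
  and tensor_relations_right: "h \<in> carrier H \<Longrightarrow>
    frag_of (h, r + r') - frag_of (h, r) - frag_of (h, r') \<in> tensor_relations H P \<phi>"
  and tensor_relations_balanced: "h \<in> carrier H \<Longrightarrow> p \<in> P \<Longrightarrow>
    frag_of (h \<otimes> p, r) - frag_of (h, \<phi> p * r) \<in> tensor_relations H P \<phi>"
  unfolding tensor_relations_def by blast+

lemma subgroup_N: "subgroup N G"
  unfolding tensor_null_def using tensor_relations_G
  by (rule group.generate_is_subgroup[OF group_G])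

lemma normal_N: "N \<lhd> G"
  using comm_group_G subgroup_N by (rule comm_group.subgroup_imp_normal)

lemma N_G: "x \<in> N \<Longrightarrow> x \<in> carrier G"
  using subgroup_N by (rule subgroup.mem_carrier)

lemma N_zero: "0 \<in> N"
  using subgroup.one_closed[OF subgroup_N] by (simp add: one_G)

lemma N_add: "x \<in> N \<Longrightarrow> y \<in> N \<Longrightarrow> x + y \<in> N"
  using subgroup.m_closed[OF subgroup_N] by (simp add: mult_G)

lemma N_uminus: "x \<in> N \<Longrightarrow> - x \<in> N"
  using subgroup.m_inv_closed[OF subgroup_N] by (simp add: inv_G N_G)

lemma N_diff: "x \<in> N \<Longrightarrow> y \<in> N \<Longrightarrow> x - y \<in> N"
  using N_add[of x "- y"] N_uminus by simp

lemma N_relation: "x \<in> tensor_relations H P \<phi> \<Longrightarrow> x \<in> N"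
  unfolding tensor_null_def by (rule generate.incl)

text \<open>A subgroup is closed under differences, so one \<open>diff\<close> case covers the
  neutral element, inverses and products of the generated subgroup.\<close>

lemma N_induct [consumes 1, case_names relation diff]:
  assumes "x \<in> N"
    and relation: "\<And>x. x \<in> tensor_relations H P \<phi> \<Longrightarrow> Q x"
    and diff: "\<And>x y. x \<in> N \<Longrightarrow> y \<in> N \<Longrightarrow> Q x \<Longrightarrow> Q y \<Longrightarrow> Q (x - y)"
  shows "Q x"
proof -
  \<comment> \<open>A relation that always exists; its difference with itself yields
    \<open>Q 0\<close>.\<close>
  have r0: "frag_of (\<zero> \<oplus> \<zero>, 0) - frag_of (\<zero>, 0) - frag_of (\<zero>, 0) \<in> tensor_relations H P \<phi>"
    unfolding tensor_relations_def by blast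
  have Q0: "Q 0" using diff[OF N_relation[OF r0] N_relation[OF r0] relation[OF r0] relation[OF r0]] by simp
  have Qm: "Q (- x)" if "x \<in> N" "Q x" for x using diff[OF N_zero that(1) Q0 that(2)] by simp
  from assms(1) have "x \<in> N \<and> Q x" unfolding tensor_null_def
  proof (induction rule: generate.induct)
    case one
    then show ?case using Q0 N_zero by (simp add: one_G tensor_null_def)
  next
    case (incl h)
    then show ?case using relation by (auto intro: generate.incl)
  next
    case (inv h)
    then have "inv\<^bsub>G\<^esub> h = - h" using tensor_relations_G inv_G by blast
    then show ?case using inv Qm[of h] N_uminus[of h] N_relation[of h] relation[of h]
      by (simp add: tensor_null_def)
  next
    case (eng h1 h2)
    then have "h1 \<in> N" "- h2 \<in> N" "Q h1" "Q (- h2)" using N_uminus Qm by (auto simp: tensor_null_def)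
    from diff[OF this] eng show ?case using N_add[of h1 h2] by (simp add: mult_G tensor_null_def)
  qed
  then show ?thesis by simp
qed

definition cls :: "(('h \<times> laurent) \<Rightarrow>\<^sub>0 int) \<Rightarrow> (('h \<times> laurent) \<Rightarrow>\<^sub>0 int) set" where
  "cls x = N #>\<^bsub>G\<^esub> x"

lemma mem_cls: "y \<in> cls x \<longleftrightarrow> y - x \<in> N"
proof -
  have "y \<in> cls x \<longleftrightarrow> (\<exists>z\<in>N. y = z + x)" by (auto simp: cls_def r_coset_def mult_G)
  also have "\<dots> \<longleftrightarrow> y - x \<in> N" by (metis add_diff_cancel diff_add_cancel)
  finally show ?thesis .
qed

lemma cls_eq_iff: "cls x = cls y \<longleftrightarrow> x - y \<in> N"
proof
  assume "cls x = cls y"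
  then show "x - y \<in> N" using mem_cls[of x x] mem_cls[of x y] N_zero by simp
next
  assume xy: "x - y \<in> N"
  have "z - x \<in> N \<longleftrightarrow> z - y \<in> N" for z
    using N_add[of "z - x" "x - y"] N_diff[of "z - y" "x - y"] xy by auto
  then show "cls x = cls y" by (auto simp: mem_cls)
qed

lemma carrier_M: "carrier M = cls ` carrier G"
  by (auto simp: induced_module_def FactGroup_def RCOSETS_def cls_def)

lemma zero_M: "\<zero>\<^bsub>M\<^esub> = cls 0"
proof -
  have "cls 0 = N" by (auto simp: mem_cls)
  then show ?thesis by (simp add: induced_module_def FactGroup_def)
qed

lemma cls_add: "x \<in> carrier G \<Longrightarrow> y \<in> carrier G \<Longrightarrow> cls x \<oplus>\<^bsub>M\<^esub> cls y = cls (x + y)"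
  using normal.rcos_sum[OF normal_N, of x y]
  by (simp add: induced_module_def FactGroup_def cls_def mult_G)

lemma abelian_group_M: "abelian_group M"
proof (rule abelian_groupI)
  show "\<zero>\<^bsub>M\<^esub> \<in> carrier M" by (simp add: zero_M carrier_M) (simp add: carrier_G)
  fix X Y Z
  assume "X \<in> carrier M"
  then obtain x where x: "X = cls x" "x \<in> carrier G" by (auto simp: carrier_M)
  have "0 \<in> carrier G" "- x \<in> carrier G" using x by (simp_all add: carrier_G)
  then show "\<zero>\<^bsub>M\<^esub> \<oplus>\<^bsub>M\<^esub> X = X" "\<exists>Y\<in>carrier M. Y \<oplus>\<^bsub>M\<^esub> X = \<zero>\<^bsub>M\<^esub>"
    using x by (auto simp: zero_M carrier_M cls_add intro!: bexI[of _ "- x"])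
  assume "Y \<in> carrier M"
  then obtain y where y: "Y = cls y" "y \<in> carrier G" by (auto simp: carrier_M)
  show "X \<oplus>\<^bsub>M\<^esub> Y \<in> carrier M" "X \<oplus>\<^bsub>M\<^esub> Y = Y \<oplus>\<^bsub>M\<^esub> X"
    using x y by (auto simp: cls_add carrier_M add_G add.commute)
  assume "Z \<in> carrier M"
  then obtain z where z: "Z = cls z" "z \<in> carrier G" by (auto simp: carrier_M)
  show "X \<oplus>\<^bsub>M\<^esub> Y \<oplus>\<^bsub>M\<^esub> Z = X \<oplus>\<^bsub>M\<^esub> (Y \<oplus>\<^bsub>M\<^esub> Z)"
    using x y z by (simp add: cls_add add_G add.assoc)
qed

section \<open>The left action on the tensor product\<close>

definition translate :: "'h \<Rightarrow> (('h \<times> laurent) \<Rightarrow>\<^sub>0 int) \<Rightarrow> ('h \<times> laurent) \<Rightarrow>\<^sub>0 int" where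
  "translate g = frag_extend (\<lambda>(h, r). frag_of (g \<otimes> h, r))"

lemma translate_N:
  assumes "g \<in> carrier H" "x \<in> N"
  shows "translate g x \<in> N"
  using assms(2)
proof (induction x rule: N_induct)
  case (relation x)
  then have "translate g x \<in> tensor_relations H P \<phi>"
  proof (cases rule: tensor_relations_cases)
    case (left h h' r)
    then have "translate g x = frag_of (g \<otimes> h \<oplus> g \<otimes> h', r) - frag_of (g \<otimes> h, r) - frag_of (g \<otimes> h', r)"
      using assms(1) by (simp add: translate_def frag_extend_diff r_distr)
    then show ?thesis using left assms(1) by (simp add: tensor_relations_left)
  next
    case (right h r r')
    then have "translate g x = frag_of (g \<otimes> h, r + r') - frag_of (g \<otimes> h, r) - frag_of (g \<otimes> h, r')"
      by (simp add: translate_def frag_extend_diff)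
    then show ?thesis using right assms(1) by (simp add: tensor_relations_right)
  next
    case (balanced h p r)
    then have "p \<in> carrier H" using P_sub by blast
    then have "translate g x = frag_of (g \<otimes> h \<otimes> p, r) - frag_of (g \<otimes> h, \<phi> p * r)"
      using balanced assms(1) by (simp add: translate_def frag_extend_diff m_assoc)
    then show ?thesis using balanced assms(1) by (simp add: tensor_relations_balanced)
  qed
  then show ?case by (rule N_relation)
next
  case (diff x y)
  then show ?case unfolding translate_def by (simp add: frag_extend_diff N_diff)
qed

text \<open>\<open>tensor_act\<close> is a union over all representatives of a class. Translation
  preserves \<open>N\<close>, so the cosets in this union coincide.\<close>

lemma tensor_act_cls:
  assumes "g \<in> carrier H"
  shows "tensor_act H P \<phi> g (cls x) = cls (translate g x)"
proof -
  have "cls (translate g y) = cls (translate g x)" if "y \<in> cls x" for y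
    using that translate_N[OF assms, of "y - x"]
    by (simp add: cls_eq_iff mem_cls translate_def frag_extend_diff)
  moreover have "x \<in> cls x" by (simp add: mem_cls N_zero)
  ultimately show ?thesis
    unfolding tensor_act_def cls_def[symmetric] translate_def[symmetric] by blast
qed

definition tensor_one :: "'h \<Rightarrow> (('h \<times> laurent) \<Rightarrow>\<^sub>0 int) set" where
  "tensor_one h = cls (frag_of (h, 1))"

lemma tensor_one_carrier: "h \<in> carrier H \<Longrightarrow> tensor_one h \<in> carrier M"
  by (simp add: tensor_one_def carrier_M frag_of_G)

lemma tensor_one_add:
  assumes "h \<in> carrier H" "h' \<in> carrier H"
  shows "tensor_one (h \<oplus> h') = tensor_one h \<oplus>\<^bsub>M\<^esub> tensor_one h'"
proof -
  have "frag_of (h \<oplus> h', 1) - frag_of (h, 1) - frag_of (h', 1) \<in> N"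
    using assms by (intro N_relation tensor_relations_left)
  then have "cls (frag_of (h \<oplus> h', 1)) = cls (frag_of (h, 1) + frag_of (h', 1))"
    by (simp add: cls_eq_iff algebra_simps)
  then show ?thesis using assms by (simp add: tensor_one_def cls_add frag_of_G)
qed

lemma tensor_act_tensor_one:
  "g \<in> carrier H \<Longrightarrow> tensor_act H P \<phi> g (tensor_one h) = tensor_one (g \<otimes> h)"
  by (simp add: tensor_one_def tensor_act_cls translate_def)

lemma smult_tensor_one: "c \<odot>\<^bsub>M\<^esub> tensor_one h = tensor_one (\<iota> c \<otimes> h)"
  by (simp add: induced_module_def tensor_act_tensor_one scalar_carrier)

text \<open>Balancing with the parabolic element \<open>\<iota> r\<close>, on which the character
  takes the value \<open>r\<close>, moves the right factor to the left, where it is central. So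
  tensors with right factor 1 suffice.\<close>

lemma cls_pure:
  assumes "h \<in> carrier H"
  shows "cls (frag_of (h, r)) = tensor_one (\<iota> r \<otimes> h)"
proof -
  have "frag_of (h \<otimes> \<iota> r, 1) - frag_of (h, \<phi> (\<iota> r) * 1) \<in> N"
    using assms scalar_in_P by (intro N_relation tensor_relations_balanced)
  then have "cls (frag_of (h \<otimes> \<iota> r, 1)) = cls (frag_of (h, r))"
    by (simp add: cls_eq_iff character_scalar)
  then show ?thesis using assms by (simp add: tensor_one_def scalar_central)
qed

lemma tensor_one_balanced:
  assumes "h \<in> carrier H" "p \<in> P"
  shows "tensor_one (h \<otimes> p) = tensor_one (\<iota> (\<phi> p) \<otimes> h)"
proof -
  have "frag_of (h \<otimes> p, 1) - frag_of (h, \<phi> p * 1) \<in> N"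
    using assms by (intro N_relation tensor_relations_balanced)
  then have "cls (frag_of (h \<otimes> p, 1)) = cls (frag_of (h, \<phi> p))"
    by (simp add: cls_eq_iff)
  then show ?thesis using assms by (simp add: tensor_one_def[of "h \<otimes> p"] cls_pure)
qed

lemma tensor_one_zero: "tensor_one \<zero> = \<zero>\<^bsub>M\<^esub>"
proof -
  interpret M: abelian_group M by (rule abelian_group_M)
  have "tensor_one \<zero> \<oplus>\<^bsub>M\<^esub> tensor_one \<zero> = tensor_one \<zero>"
    using tensor_one_add[of \<zero> \<zero>] by simp
  then show ?thesis using tensor_one_carrier[OF zero_closed] by (metis M.add.r_cancel_one')
qed

lemma carrier_M_tensor_one: "carrier M = tensor_one ` carrier H"
proof -
  have "\<exists>h\<in>carrier H. cls x = tensor_one h" if "Poly_Mapping.keys x \<subseteq> carrier H \<times> UNIV" for x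
    using that
  proof (induction x rule: frag_induction)
    case zero
    then show ?case using tensor_one_zero zero_M by auto
  next
    case (diff x y)
    then obtain h h' where h: "h \<in> carrier H" "cls x = tensor_one h" "h' \<in> carrier H" "cls y = tensor_one h'"
      by blast
    have "x - frag_of (h, 1) \<in> N" "y - frag_of (h', 1) \<in> N"
      using h by (simp_all add: tensor_one_def cls_eq_iff)
    then have "(x - frag_of (h, 1)) - (y - frag_of (h', 1)) \<in> N" by (rule N_diff)
    \<comment> \<open>Additivity in the left factor, applied to \<open>h \<ominus> h'\<close> and
      \<open>h'\<close>, turns the difference of two tensors into a single one.\<close>
    moreover have "frag_of (h \<ominus> h' \<oplus> h', 1) - frag_of (h \<ominus> h', 1) - frag_of (h', 1) \<in> N"
      using h by (intro N_relation tensor_relations_left minus_closed)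
    then have "frag_of (h, 1) - frag_of (h \<ominus> h', 1) - frag_of (h', 1) \<in> N"
      using h by (simp add: minus_eq a_assoc l_neg)
    ultimately have "((x - frag_of (h, 1)) - (y - frag_of (h', 1))) +
        (frag_of (h, 1) - frag_of (h \<ominus> h', 1) - frag_of (h', 1)) \<in> N"
      by (rule N_add)
    then have "cls (x - y) = tensor_one (h \<ominus> h')"
      by (simp add: tensor_one_def cls_eq_iff algebra_simps)
    then show ?case using h by blast
  next
    case (one a)
    then obtain h r where "a = (h, r)" "h \<in> carrier H" by auto
    then show ?case using cls_pure[of h r] scalar_carrier by blast
  qed
  then have "carrier M \<subseteq> tensor_one ` carrier H" unfolding carrier_M by (auto simp: carrier_G image_iff)
  then show ?thesis using tensor_one_carrier by blast
qed

lemma scalar_module_M: "scalar_module M"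
proof (intro scalar_module.intro scalar_module_axioms.intro abelian_group_M)
  fix x y c d
  assume "x \<in> carrier M"
  then obtain h where h: "x = tensor_one h" "h \<in> carrier H" by (auto simp: carrier_M_tensor_one)
  note [simp] = scalar_carrier
  show "c \<odot>\<^bsub>M\<^esub> x \<in> carrier M" using h by (simp add: smult_tensor_one tensor_one_carrier)
  show "(c + d) \<odot>\<^bsub>M\<^esub> x = c \<odot>\<^bsub>M\<^esub> x \<oplus>\<^bsub>M\<^esub> d \<odot>\<^bsub>M\<^esub> x"
    using h by (simp add: smult_tensor_one scalar_add l_distr tensor_one_add)
  show "(c * d) \<odot>\<^bsub>M\<^esub> x = c \<odot>\<^bsub>M\<^esub> (d \<odot>\<^bsub>M\<^esub> x)"
    using h by (simp add: smult_tensor_one scalar_mult m_assoc)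
  show "1 \<odot>\<^bsub>M\<^esub> x = x" using h by (simp add: smult_tensor_one scalar_one)
  assume "y \<in> carrier M"
  then obtain h' where h': "y = tensor_one h'" "h' \<in> carrier H" by (auto simp: carrier_M_tensor_one)
  show "c \<odot>\<^bsub>M\<^esub> (x \<oplus>\<^bsub>M\<^esub> y) = c \<odot>\<^bsub>M\<^esub> x \<oplus>\<^bsub>M\<^esub> c \<odot>\<^bsub>M\<^esub> y"
    using h h' by (simp add: tensor_one_add[symmetric] smult_tensor_one r_distr)
qed

lemma linear_endo_tensor_act:
  assumes "g \<in> carrier H"
  shows "scalar_module.linear_endo M (tensor_act H P \<phi> g)"
proof -
  interpret M: scalar_module M by (rule scalar_module_M)
  have swap: "g \<otimes> (\<iota> c \<otimes> h) = \<iota> c \<otimes> (g \<otimes> h)" if "h \<in> carrier H" for c h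
    using that assms by (metis m_assoc scalar_carrier scalar_central)
  show ?thesis
    unfolding M.linear_endo_def carrier_M_tensor_one using assms scalar_carrier
    by (auto simp: tensor_act_tensor_one tensor_one_carrier tensor_one_add[symmetric] r_distr
        smult_tensor_one swap)
qed

text \<open>The universal property of the tensor product:
  \<open>(h, r) \<mapsto> r * \<beta> h\<close> extends to the free abelian group and vanishes on
  each of the three kinds of relations, hence on \<open>N\<close>.\<close>

lemma balanced_functional_descends:
  assumes add: "\<And>h h'. h \<in> carrier H \<Longrightarrow> h' \<in> carrier H \<Longrightarrow> \<beta> (h \<oplus> h') = \<beta> h + \<beta> h'"
    and scal: "\<And>c h. h \<in> carrier H \<Longrightarrow> \<beta> (\<iota> c \<otimes> h) = c * \<beta> h"
    and balanced: "\<And>h p. h \<in> carrier H \<Longrightarrow> p \<in> P \<Longrightarrow> \<beta> (h \<otimes> p) = \<phi> p * \<beta> h"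
  obtains \<Phi> where "scalar_module.linear_functional M \<Phi>"
    "\<And>h. h \<in> carrier H \<Longrightarrow> \<Phi> (tensor_one h) = \<beta> h"
proof -
  interpret M: scalar_module M by (rule scalar_module_M)
  define \<Phi>0 :: "(('h \<times> laurent) \<Rightarrow>\<^sub>0 int) \<Rightarrow> laurent" where
    "\<Phi>0 = frag_extend (\<lambda>(h, r). r * \<beta> h)"
  have null: "\<Phi>0 x = 0" if "x \<in> N" for x
    using that
  proof (induction x rule: N_induct)
    case (relation x)
    then show ?case
      by (cases rule: tensor_relations_cases)
        (simp_all add: \<Phi>0_def frag_extend_diff add balanced distrib_left distrib_right mult.assoc mult.left_commute)
  next
    case (diff x y)
    then show ?case by (simp add: \<Phi>0_def frag_extend_diff)
  qed
  define \<Phi> where "\<Phi> X = \<Phi>0 (SOME x. x \<in> X)" for X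
  have cls: "\<Phi> (cls x) = \<Phi>0 x" for x
  proof -
    have "x \<in> cls x" by (simp add: mem_cls N_zero)
    then have "(SOME y. y \<in> cls x) \<in> cls x" by (rule someI)
    then have "\<Phi>0 ((SOME y. y \<in> cls x) - x) = 0" by (simp add: mem_cls null)
    then show ?thesis by (simp add: \<Phi>_def \<Phi>0_def frag_extend_diff)
  qed
  have one: "\<Phi> (tensor_one h) = \<beta> h" for h
    by (simp add: tensor_one_def cls) (simp add: \<Phi>0_def)
  have "M.linear_functional \<Phi>"
    unfolding M.linear_functional_def carrier_M_tensor_one using scalar_carrier
    by (auto simp: tensor_one_add[symmetric] one add scal smult_tensor_one)
  then show thesis using one by (rule that)
qed

end

section \<open>The Hecke algebra and its sign representation\<close>

lemma free_algebra_simps: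
  "carrier (free_algebra n) = free_carrier n"
  "x \<otimes>\<^bsub>free_algebra n\<^esub> y = x * y"
  "x \<oplus>\<^bsub>free_algebra n\<^esub> y = x + y"
  "\<one>\<^bsub>free_algebra n\<^esub> = 1"
  "\<zero>\<^bsub>free_algebra n\<^esub> = 0"
  by (simp_all add: free_carrier_def) (simp_all add: free_algebra_def)

lemma ring_free_algebra: "ring (free_algebra n)"
proof (rule ringI)
  show "abelian_group (free_algebra n)"
    by (rule abelian_groupI)
      (auto simp: free_algebra_simps algebra_simps intro: free_carrier_closed
        intro!: bexI[of _ "- x" for x])
  show "Group.monoid (free_algebra n)"
    by (rule monoidI) (auto simp: free_algebra_simps mult.assoc intro: free_carrier_closed)
qed (simp_all add: free_algebra_simps algebra_simps)

lemma free_algebra_uminus: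
  assumes "x \<in> free_carrier n"
  shows "\<ominus>\<^bsub>free_algebra n\<^esub> x = - x"
proof -
  interpret ring "free_algebra n" by (rule ring_free_algebra)
  show ?thesis
    using assms by (intro minus_equality) (simp_all add: free_algebra_simps free_carrier_closed)
qed

lemma free_algebra_idealI:
  assumes "K \<subseteq> free_carrier n" "0 \<in> K" "\<And>x y. x \<in> K \<Longrightarrow> y \<in> K \<Longrightarrow> x - y \<in> K"
    and "\<And>a x. a \<in> free_carrier n \<Longrightarrow> x \<in> K \<Longrightarrow> a * x \<in> K \<and> x * a \<in> K"
  shows "ideal K (free_algebra n)"
proof -
  interpret ring "free_algebra n" by (rule ring_free_algebra)
  have um: "- x \<in> K" if "x \<in> K" for x using assms(2,3) that by (metis diff_0)
  have "subgroup K (add_monoid (free_algebra n))"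
  proof (rule add.subgroupI)
    fix x y assume "x \<in> K" "y \<in> K"
    then show "x \<oplus>\<^bsub>free_algebra n\<^esub> y \<in> K"
      using assms(3)[of x "- y"] um by (simp add: free_algebra_simps)
  next
    fix x assume "x \<in> K"
    then show "\<ominus>\<^bsub>free_algebra n\<^esub> x \<in> K" using um assms(1) free_algebra_uminus by auto
  qed (use assms(1,2) in \<open>auto simp: free_algebra_simps\<close>)
  then show ?thesis
    using assms(4) by (intro idealI ring_free_algebra) (auto simp: free_algebra_simps)
qed

lemma hecke_relations_carrier: "hecke_relations n \<subseteq> free_carrier n"
  unfolding hecke_relations_def by (auto intro!: free_carrier_closed)

lemma ideal_hecke_ideal: "ideal (hecke_ideal n) (free_algebra n)"
  unfolding hecke_ideal_def
  by (rule ring.genideal_ideal[OF ring_free_algebra])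
    (simp add: free_algebra_simps hecke_relations_carrier)

lemma hecke_ideal_minimal: "ideal K (free_algebra n) \<Longrightarrow> hecke_relations n \<subseteq> K \<Longrightarrow> hecke_ideal n \<subseteq> K"
  unfolding hecke_ideal_def by (rule ring.genideal_minimal[OF ring_free_algebra])

lemma hecke_relations_ideal: "hecke_relations n \<subseteq> hecke_ideal n"
  unfolding hecke_ideal_def
  by (rule ring.genideal_self[OF ring_free_algebra])
    (simp add: free_algebra_simps hecke_relations_carrier)

lemma hecke_ideal_mult_right:
  "x \<in> hecke_ideal n \<Longrightarrow> a \<in> free_carrier n \<Longrightarrow> x * a \<in> hecke_ideal n"
  using ideal.I_r_closed[OF ideal_hecke_ideal, of x n a] by (simp add: free_algebra_simps)

lemma ring_hecke: "ring (hecke n)"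
  unfolding hecke_def by (rule ideal.quotient_is_ring[OF ideal_hecke_ideal])

definition rep :: "nat \<Rightarrow> free_alg \<Rightarrow> free_alg set" where
  "rep n p = hecke_ideal n +>\<^bsub>free_algebra n\<^esub> p"

lemma rep_hom: "rep n \<in> ring_hom (free_algebra n) (hecke n)"
  unfolding hecke_def rep_def[abs_def] by (rule ideal.rcos_ring_hom[OF ideal_hecke_ideal])

lemma rep_add: "x \<in> free_carrier n \<Longrightarrow> y \<in> free_carrier n \<Longrightarrow> rep n (x + y) = rep n x \<oplus>\<^bsub>hecke n\<^esub> rep n y"
  using ring_hom_add[OF rep_hom, of x n y] by (simp add: free_algebra_simps)

lemma rep_mult: "x \<in> free_carrier n \<Longrightarrow> y \<in> free_carrier n \<Longrightarrow> rep n (x * y) = rep n x \<otimes>\<^bsub>hecke n\<^esub> rep n y"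
  using ring_hom_mult[OF rep_hom, of x n y] by (simp add: free_algebra_simps)

lemma rep_one: "rep n 1 = \<one>\<^bsub>hecke n\<^esub>"
  using ring_hom_one[OF rep_hom, of n] by (simp add: free_algebra_simps)

lemma rep_carrier: "x \<in> free_carrier n \<Longrightarrow> rep n x \<in> carrier (hecke n)"
  using ring_hom_closed[OF rep_hom, of x n] by (simp add: free_algebra_simps)

lemma carrier_hecke: "carrier (hecke n) = rep n ` free_carrier n"
  by (auto simp: hecke_def FactRing_def A_RCOSETS_def' rep_def free_algebra_simps)

lemma rep_zero_iff:
  assumes "x \<in> free_carrier n"
  shows "rep n x = \<zero>\<^bsub>hecke n\<^esub> \<longleftrightarrow> x \<in> hecke_ideal n"
proof -
  interpret ideal "hecke_ideal n" "free_algebra n" by (rule ideal_hecke_ideal)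
  have "\<zero>\<^bsub>hecke n\<^esub> = hecke_ideal n" by (simp add: hecke_def FactRing_def)
  then show ?thesis
    unfolding rep_def using assms a_rcos_const a_rcos_self[of x] by (auto simp: free_algebra_simps)
qed

lemma rep_zero: "rep n 0 = \<zero>\<^bsub>hecke n\<^esub>"
  using rep_zero_iff[of 0 n] ideal.Icarr additive_subgroup.zero_closed[OF ideal.axioms(1)[OF ideal_hecke_ideal[of n]]]
  by (simp add: free_carrier_closed free_algebra_simps)

lemma rep_uminus:
  assumes "x \<in> free_carrier n"
  shows "rep n (- x) = \<ominus>\<^bsub>hecke n\<^esub> rep n x"
proof -
  interpret ring "hecke n" by (rule ring_hecke)
  show ?thesis
    using assms rep_add[of "- x" n x]
    by (intro minus_equality[symmetric]) (simp_all add: rep_carrier free_carrier_closed rep_zero)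
qed

lemma rep_eq_iff:
  assumes "x \<in> free_carrier n" "y \<in> free_carrier n"
  shows "rep n x = rep n y \<longleftrightarrow> x - y \<in> hecke_ideal n"
proof -
  interpret ring "hecke n" by (rule ring_hecke)
  have "rep n (x - y) = rep n x \<ominus>\<^bsub>hecke n\<^esub> rep n y"
    using rep_add[of x n "- y"] assms by (simp add: free_carrier_closed rep_uminus minus_eq)
  then have "x - y \<in> hecke_ideal n \<longleftrightarrow> rep n x \<ominus>\<^bsub>hecke n\<^esub> rep n y = \<zero>\<^bsub>hecke n\<^esub>"
    using rep_zero_iff[of "x - y" n] assms by (simp add: free_carrier_closed)
  then show ?thesis using assms by (simp add: rep_carrier)
qed

lemma T_rep: "T n i = rep n (gen i)"
  and hecke_scalar_rep: "hecke_scalar n c = rep n (scal c)"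
  by (simp_all add: T_def hecke_scalar_def rep_def)

lemma abs_one_cases: "\<bar>int i - int j\<bar> = 1 \<longleftrightarrow> j = Suc i \<or> i = Suc j"
  by auto

text \<open>The elements that act as zero form a two-sided ideal, and the identities for
  \<open>T_act\<close> put the relations into it. The generated ideal is the least such
  ideal.\<close>

lemma act_hecke_ideal:
  assumes "p \<in> hecke_ideal n"
  shows "act p \<psi> g = 0"
proof -
  let ?K = "{p \<in> free_carrier n. \<forall>\<psi> g. act p \<psi> g = 0}"
  have "ideal ?K (free_algebra n)"
  proof (rule free_algebra_idealI)
    fix a x assume a: "a \<in> free_carrier n" and x: "x \<in> ?K"
    \<comment> \<open>The zero function is written as a multiple by 0 so that
      \<open>act_smult\<close> carries it through \<open>act a\<close>.\<close>
    then have "act x \<psi> = (\<lambda>g. 0 * \<psi> g)" for \<psi> by auto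
    then have "act (a * x) \<psi> g = 0" for \<psi> g unfolding act_mult by (simp only: act_smult) simp
    moreover have "act (x * a) \<psi> g = 0" for \<psi> g using x by (simp add: act_mult)
    ultimately show "a * x \<in> ?K \<and> x * a \<in> ?K" using a x by (simp add: free_carrier_closed)
  qed (auto simp: act_diff free_carrier_closed)
  moreover have "hecke_relations n \<subseteq> ?K"
  proof
    fix r assume r: "r \<in> hecke_relations n"
    have "act r \<psi> g = 0" for \<psi> g
      using r unfolding hecke_relations_def
    proof (elim UnE CollectE exE conjE)
      fix i assume "r = gen i * gen i - (scal (q - 1) * gen i + scal q)"
      then show ?thesis
        by (simp add: act_diff act_add act_mult act_gen act_scal T_act_quadratic)
    next
      fix i j assume "r = gen i * gen j * gen i - gen j * gen i * gen j" "\<bar>int i - int j\<bar> = 1"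
      then show ?thesis
        using T_act_braid[of i \<psi> g] T_act_braid[of j \<psi> g] unfolding abs_one_cases
        by (auto simp: act_diff act_mult act_gen)
    next
      fix i j assume "r = gen i * gen j - gen j * gen i" "\<bar>int i - int j\<bar> \<ge> 2"
      moreover from this have "Suc i < j \<or> Suc j < i" by linarith
      ultimately show ?thesis
        using T_act_commute[of i j \<psi> g] by (simp add: act_diff act_mult act_gen)
    qed
    then show "r \<in> ?K" using r hecke_relations_carrier by auto
  qed
  ultimately have "hecke_ideal n \<subseteq> ?K" by (rule hecke_ideal_minimal)
  then show ?thesis using assms by blast
qed

text \<open>With every generator at -1 the quadratic relation reads 1 = -(q - 1) + q, and the other
  relations compare products of equally many factors -1.\<close>

lemma sgn_hom_hecke_ideal:
  assumes "p \<in> hecke_ideal n"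
  shows "sgn_hom p = 0"
proof -
  let ?K = "{p \<in> free_carrier n. sgn_hom p = 0}"
  have "ideal ?K (free_algebra n)"
    by (rule free_algebra_idealI)
      (auto simp: sgn_hom_diff sgn_hom_mult sgn_hom_zero free_carrier_closed)
  moreover have "hecke_relations n \<subseteq> ?K"
  proof -
    have "sgn_hom r = 0" if "r \<in> hecke_relations n" for r
      using that unfolding hecke_relations_def
      by (auto simp: sgn_hom_diff sgn_hom_add sgn_hom_mult sgn_hom_gen sgn_hom_scal)
    then show ?thesis using hecke_relations_carrier by blast
  qed
  ultimately have "hecke_ideal n \<subseteq> ?K" by (rule hecke_ideal_minimal)
  then show ?thesis using assms by blast
qed

text \<open>Meaningful only if \<open>F\<close> is additive and vanishes on the ideal: the value is taken at an arbitrary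
  representative.\<close>

definition descend :: "nat \<Rightarrow> (free_alg \<Rightarrow> laurent) \<Rightarrow> free_alg set \<Rightarrow> laurent" where
  "descend n F h = F (SOME p. p \<in> free_carrier n \<and> rep n p = h)"

lemma descend_rep:
  assumes "\<And>x. x \<in> hecke_ideal n \<Longrightarrow> F x = 0" "\<And>x y. F (x - y) = F x - F y" "p \<in> free_carrier n"
  shows "descend n F (rep n p) = F p"
proof -
  let ?p = "SOME p'. p' \<in> free_carrier n \<and> rep n p' = rep n p"
  have "?p \<in> free_carrier n \<and> rep n ?p = rep n p"
    by (rule someI[of _ p]) (simp add: assms(3))
  then have "?p - p \<in> hecke_ideal n" using rep_eq_iff[of ?p n p] assms(3) by simp
  then show ?thesis using assms(1)[of "?p - p"] assms(2)[of ?p p] by (simp add: descend_def)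
qed

lemma descend_sgn_hom: "p \<in> free_carrier n \<Longrightarrow> descend n sgn_hom (rep n p) = sgn_hom p"
  by (rule descend_rep) (auto simp: sgn_hom_hecke_ideal sgn_hom_diff)

lemma parabolic_carrier:
  assumes "J \<subseteq> {1..<n}"
  shows "parabolic n J \<subseteq> carrier (hecke n)"
  unfolding parabolic_def
  by (rule ring.generate_ring_incl[OF ring_hecke])
    (use assms in \<open>auto simp: T_rep hecke_scalar_rep intro!: rep_carrier free_carrier_closed\<close>)

lemma parabolic_hom_uminus:
  assumes "\<phi> \<in> ring_hom (hecke n\<lparr>carrier := parabolic n J\<rparr>) laurent_ring" "J \<subseteq> {1..<n}"
    and "h \<in> parabolic n J"
  shows "\<phi> (\<ominus>\<^bsub>hecke n\<^esub> h) = - \<phi> h"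
proof -
  interpret ring "hecke n" by (rule ring_hecke)
  have add: "\<phi> (x \<oplus>\<^bsub>hecke n\<^esub> y) = \<phi> x + \<phi> y" if "x \<in> parabolic n J" "y \<in> parabolic n J" for x y
    using ring_hom_add[OF assms(1), of x y] that by (simp add: laurent_ring_def)
  have h: "h \<in> carrier (hecke n)" using assms parabolic_carrier by blast
  have m: "\<ominus>\<^bsub>hecke n\<^esub> h \<in> parabolic n J" using assms(3) unfolding parabolic_def by (rule generate_ring.a_inv)
  have z: "\<zero>\<^bsub>hecke n\<^esub> \<in> parabolic n J" unfolding parabolic_def by (rule zero_in_generate)
  have "\<phi> \<zero>\<^bsub>hecke n\<^esub> = 0" using add[OF z z] by simp
  then have "\<phi> (\<ominus>\<^bsub>hecke n\<^esub> h) + \<phi> h = 0" using add[OF m assms(3)] h by (simp add: l_neg)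
  then show ?thesis by (simp add: eq_neg_iff_add_eq_0)
qed

text \<open>The sign representation of a parabolic subalgebra exists because the whole algebra has one.\<close>

lemma sign_rep_eq:
  assumes "J \<subseteq> {1..<n}"
  shows "sign_rep n J = restrict (descend n sgn_hom) (parabolic n J)"
  unfolding sign_rep_def
proof (rule the_equality)
  let ?s = "restrict (descend n sgn_hom) (parabolic n J)"
  let ?R = "hecke n\<lparr>carrier := parabolic n J\<rparr>"
  have in_P: "hecke_scalar n c \<in> parabolic n J" "i \<in> J \<Longrightarrow> T n i \<in> parabolic n J" for c i
    unfolding parabolic_def by (auto intro: generate_ring.incl)
  have closed: "x \<otimes>\<^bsub>hecke n\<^esub> y \<in> parabolic n J" "x \<oplus>\<^bsub>hecke n\<^esub> y \<in> parabolic n J"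
    if "x \<in> parabolic n J" "y \<in> parabolic n J" for x y
    using that unfolding parabolic_def by (auto intro: generate_ring.eng_mult generate_ring.eng_add)
  have one: "\<one>\<^bsub>hecke n\<^esub> \<in> parabolic n J" unfolding parabolic_def by (rule generate_ring.one)
  have hom: "?s \<in> ring_hom ?R laurent_ring"
  proof (rule ring_hom_memI)
    fix x y assume "x \<in> carrier ?R" "y \<in> carrier ?R"
    then have xy: "x \<in> parabolic n J" "y \<in> parabolic n J" by simp_all
    then obtain a b where ab: "x = rep n a" "y = rep n b" "a \<in> free_carrier n" "b \<in> free_carrier n"
      using parabolic_carrier[OF assms] unfolding carrier_hecke by blast
    show "?s (x \<otimes>\<^bsub>?R\<^esub> y) = ?s x \<otimes>\<^bsub>laurent_ring\<^esub> ?s y"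
      using xy closed ab
      by (simp add: laurent_ring_def) (simp add: rep_mult[symmetric] descend_sgn_hom free_carrier_closed sgn_hom_mult)
    show "?s (x \<oplus>\<^bsub>?R\<^esub> y) = ?s x \<oplus>\<^bsub>laurent_ring\<^esub> ?s y"
      using xy closed ab
      by (simp add: laurent_ring_def) (simp add: rep_add[symmetric] descend_sgn_hom free_carrier_closed sgn_hom_add)
  next
    show "?s \<one>\<^bsub>?R\<^esub> = \<one>\<^bsub>laurent_ring\<^esub>"
      using one by (simp add: laurent_ring_def)
        (simp add: rep_one[symmetric] descend_sgn_hom free_carrier_closed sgn_hom_one)
  qed (simp add: laurent_ring_def)
  have scal: "?s (hecke_scalar n c) = c" for c
    using in_P(1)[of c] by (simp add: hecke_scalar_rep descend_sgn_hom free_carrier_closed sgn_hom_scal)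
  have T: "?s (T n i) = - 1" if "i \<in> J" for i
  proof -
    have "gen i \<in> free_carrier n" using subsetD[OF assms that] by (rule free_carrier_gen)
    then show ?thesis using in_P(2)[OF that] by (simp add: T_rep descend_sgn_hom sgn_hom_gen)
  qed
  show s: "?s \<in> ring_hom ?R laurent_ring \<and> ?s \<in> extensional (parabolic n J) \<and>
    (\<forall>c. ?s (hecke_scalar n c) = c) \<and> (\<forall>i\<in>J. ?s (T n i) = - 1)"
    using hom scal T by blast
  fix \<phi>
  assume \<phi>: "\<phi> \<in> ring_hom ?R laurent_ring \<and> \<phi> \<in> extensional (parabolic n J) \<and>
    (\<forall>c. \<phi> (hecke_scalar n c) = c) \<and> (\<forall>i\<in>J. \<phi> (T n i) = - 1)"
  then have \<phi>hom: "\<phi> \<in> ring_hom ?R laurent_ring" by blast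
  have "\<phi> h = ?s h" if "h \<in> parabolic n J" for h
  proof -
    have "h \<in> generate_ring (hecke n) (range (hecke_scalar n) \<union> T n ` J)"
      using that by (simp add: parabolic_def)
    then show ?thesis
    proof (induction rule: generate_ring.induct)
      case one
      show ?case using ring_hom_one[OF \<phi>hom] ring_hom_one[OF hom] by simp
    next
      case (incl h)
      then show ?case using \<phi> scal T by (auto simp del: restrict_apply)
    next
      case (a_inv h)
      then have "h \<in> parabolic n J" by (simp add: parabolic_def)
      then show ?case
        using a_inv.IH parabolic_hom_uminus[OF \<phi>hom assms] parabolic_hom_uminus[OF hom assms] by metis
    next
      case (eng_add h1 h2)
      then have "h1 \<in> carrier ?R" "h2 \<in> carrier ?R" by (simp_all add: parabolic_def)
      then show ?case
        using eng_add.IH ring_hom_add[OF \<phi>hom, of h1 h2] ring_hom_add[OF hom, of h1 h2] by simp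
    next
      case (eng_mult h1 h2)
      then have "h1 \<in> carrier ?R" "h2 \<in> carrier ?R" by (simp_all add: parabolic_def)
      then show ?case
        using eng_mult.IH ring_hom_mult[OF \<phi>hom, of h1 h2] ring_hom_mult[OF hom, of h1 h2] by simp
    qed
  qed
  then show "\<phi> = ?s" using \<phi> by (intro extensionalityI[of \<phi> "parabolic n J"]) auto
qed

section \<open>The induced sign character as a trace\<close>

text \<open>On the base vector the parabolic subalgebra acts through its sign character; this is the
  balancing condition that lets coordinates pass to the tensor product. The representative is built
  along the generation of \<open>h\<close>, so that the action and \<open>sgn_hom\<close> are
  computed from the same \<open>p\<close>.\<close>

lemma parabolic_act_base:
  assumes mu: "sum_list \<mu> = n" and h: "h \<in> parabolic n (parabolic_indices n \<mu>)"
  obtains p where "p \<in> free_carrier n" "h = rep n p"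
    "act p (delta (base_colouring n \<mu>)) = (\<lambda>g. sgn_hom p * delta (base_colouring n \<mu>) g)"
proof -
  let ?d = "delta (base_colouring n \<mu>)" and ?J = "parabolic_indices n \<mu>"
  let ?Q = "\<lambda>h. \<exists>p\<in>free_carrier n. h = rep n p \<and> (\<forall>g. act p ?d g = sgn_hom p * ?d g)"
  have J: "?J \<subseteq> {1..<n}" by (auto simp: parabolic_indices_def)
  have "h \<in> generate_ring (hecke n) (range (hecke_scalar n) \<union> T n ` ?J)"
    using h by (simp add: parabolic_def)
  then have "?Q h"
  proof (induction rule: generate_ring.induct)
    case one
    show ?case by (rule bexI[of _ 1]) (simp_all add: rep_one sgn_hom_one free_carrier_closed)
  next
    case (incl h)
    then show ?case
    proof (elim UnE imageE)
      fix c assume "h = hecke_scalar n c"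
      then show ?thesis
        by (intro bexI[of _ "scal c"])
          (simp_all add: hecke_scalar_rep act_scal sgn_hom_scal free_carrier_closed)
    next
      fix i assume i: "h = T n i" "i \<in> ?J"
      then have "base_colouring n \<mu> i = base_colouring n \<mu> (Suc i)"
        using parabolic_indices_iff[OF mu, of i] J by blast
      moreover have "gen i \<in> free_carrier n" using i J by (intro free_carrier_gen) blast
      ultimately show ?thesis
        using i by (intro bexI[of _ "gen i"]) (simp_all add: T_rep act_gen sgn_hom_gen T_act_delta_level)
    qed
  next
    case (a_inv h)
    then obtain p where "p \<in> free_carrier n" "h = rep n p" "\<forall>g. act p ?d g = sgn_hom p * ?d g" by blast
    then show ?case
      by (intro bexI[of _ "- p"]) (simp_all add: rep_uminus act_uminus sgn_hom_uminus free_carrier_closed)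
  next
    case (eng_add h1 h2)
    then obtain p p' where "p \<in> free_carrier n" "h1 = rep n p" "\<forall>g. act p ?d g = sgn_hom p * ?d g"
      "p' \<in> free_carrier n" "h2 = rep n p'" "\<forall>g. act p' ?d g = sgn_hom p' * ?d g" by blast
    then show ?case
      by (intro bexI[of _ "p + p'"]) (simp_all add: rep_add act_add sgn_hom_add free_carrier_closed distrib_right)
  next
    case (eng_mult h1 h2)
    then obtain p p' where p: "p \<in> free_carrier n" "h1 = rep n p" "\<forall>g. act p ?d g = sgn_hom p * ?d g"
      "p' \<in> free_carrier n" "h2 = rep n p'" "\<forall>g. act p' ?d g = sgn_hom p' * ?d g" by blast
    have "act p' ?d = (\<lambda>g. sgn_hom p' * ?d g)" using p(6) by blast
    then have "act (p * p') ?d g = sgn_hom (p * p') * ?d g" for g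
      using p(3) by (simp add: act_mult act_smult sgn_hom_mult algebra_simps)
    then show ?case
      using p by (intro bexI[of _ "p * p'"]) (simp_all add: rep_mult free_carrier_closed)
  qed
  then show thesis using that by blast
qed

lemma descend_act:
  "p \<in> free_carrier n \<Longrightarrow> descend n (\<lambda>p. act p \<psi> f) (rep n p) = act p \<psi> f"
  by (rule descend_rep) (simp_all add: act_hecke_ideal act_diff)

text \<open>The vectors obtained from \<open>coset_elt n f\<close> span by
  \<open>all_spanned\<close>, and the functionals taking the \<open>f\<close>-coordinate of the
  action on the base vector are dual to them. The diagonal matrix entries are then
  \<open>act p (delta f) f\<close>.\<close>

theorem induced_sign_character_rep:
  assumes mu: "sum_list \<mu> = n" and p: "p \<in> free_carrier n"
  shows "induced_sign_character n \<mu> (rep n p) = (\<Sum>f\<in>colourings n \<mu>. act p (delta f) f)"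
proof -
  let ?J = "parabolic_indices n \<mu>" and ?d = "delta (base_colouring n \<mu>)"
  let ?P = "parabolic n ?J" and ?\<phi> = "sign_rep n ?J"
  have J: "?J \<subseteq> {1..<n}" by (auto simp: parabolic_indices_def)
  have scalar_P: "hecke_scalar n c \<in> ?P" for c
    unfolding parabolic_def by (rule generate_ring.incl) simp
  have phi: "?\<phi> (rep n x) = sgn_hom x" if "x \<in> free_carrier n" "rep n x \<in> ?P" for x
    using that by (simp add: sign_rep_eq[OF J] descend_sgn_hom)
  interpret ind: induced_from_character "hecke n" ?P ?\<phi> "hecke_scalar n"
  proof (intro induced_from_character.intro induced_from_character_axioms.intro)
    show "ring (hecke n)" by (rule ring_hecke)
    show "?P \<subseteq> carrier (hecke n)" by (rule parabolic_carrier[OF J])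
    fix c d
    show "hecke_scalar n c \<in> ?P" by (rule scalar_P)
    show "?\<phi> (hecke_scalar n c) = c"
      using phi[of "scal c"] scalar_P[of c] by (simp add: hecke_scalar_rep free_carrier_closed sgn_hom_scal)
    show "hecke_scalar n (c + d) = hecke_scalar n c \<oplus>\<^bsub>hecke n\<^esub> hecke_scalar n d"
      by (simp add: hecke_scalar_rep scal_add rep_add free_carrier_closed)
    show "hecke_scalar n (c * d) = hecke_scalar n c \<otimes>\<^bsub>hecke n\<^esub> hecke_scalar n d"
      by (simp add: hecke_scalar_rep scal_mult rep_mult free_carrier_closed)
    show "hecke_scalar n 1 = \<one>\<^bsub>hecke n\<^esub>"
      by (simp add: hecke_scalar_rep scal_one rep_one)
    fix h assume "h \<in> carrier (hecke n)"
    then obtain x where x: "h = rep n x" "x \<in> free_carrier n" by (auto simp: carrier_hecke)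
    then show "hecke_scalar n c \<otimes>\<^bsub>hecke n\<^esub> h = h \<otimes>\<^bsub>hecke n\<^esub> hecke_scalar n c"
      by (simp add: hecke_scalar_rep rep_mult[symmetric] free_carrier_closed scal_commutes)
  qed
  interpret M: scalar_module ind.M by (rule ind.scalar_module_M)
  let ?t = "\<lambda>x. ind.tensor_one (rep n x)"
  have t_add: "?t (x + y) = ?t x \<oplus>\<^bsub>ind.M\<^esub> ?t y" if "x \<in> free_carrier n" "y \<in> free_carrier n" for x y
    using that by (simp add: rep_add ind.tensor_one_add rep_carrier)
  have t_zero: "?t 0 = \<zero>\<^bsub>ind.M\<^esub>" by (simp add: rep_zero ind.tensor_one_zero)
  have t_closed: "?t x \<in> carrier ind.M" if "x \<in> free_carrier n" for x
    using that by (simp add: ind.tensor_one_carrier rep_carrier)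
  have t_act: "tensor_act (hecke n) ?P ?\<phi> (rep n x) (?t y) = ?t (x * y)"
    if "x \<in> free_carrier n" "y \<in> free_carrier n" for x y
    using that by (simp add: ind.tensor_act_tensor_one rep_carrier rep_mult)
  have t_scal: "c \<odot>\<^bsub>ind.M\<^esub> ?t x = ?t (scal c * x)" if "x \<in> free_carrier n" for c x
    using that by (simp add: ind.smult_tensor_one hecke_scalar_rep rep_mult free_carrier_closed)
  \<comment> \<open>The kernel of \<open>?t\<close>, to which the spanning theorem is
    applied.\<close>
  let ?Z = "{x \<in> free_carrier n. ?t x = \<zero>\<^bsub>ind.M\<^esub>}"
  interpret Z: hecke_left_ideal n \<mu> ?Z
  proof
    show "sum_list \<mu> = n" by fact
    show "0 \<in> ?Z" by (simp add: t_zero free_carrier_closed)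
    fix x y assume "x \<in> ?Z" "y \<in> ?Z"
    then show "x + y \<in> ?Z" by (simp add: t_add free_carrier_closed)
  next
    fix a x assume a: "a \<in> free_carrier n" and x: "x \<in> ?Z"
    have "?t (a * x) = tensor_act (hecke n) ?P ?\<phi> (rep n a) (?t 0)"
      using a x t_act[of a x] by (simp add: t_zero)
    also have "\<dots> = \<zero>\<^bsub>ind.M\<^esub>" using t_act[OF a free_carrier_zero] by (simp add: t_zero)
    finally show "a * x \<in> ?Z" using a x by (simp add: free_carrier_closed)
  next
    fix r a assume r: "r \<in> hecke_relations n" and a: "a \<in> free_carrier n"
    then have "r * a \<in> hecke_ideal n"
      using hecke_relations_ideal by (intro hecke_ideal_mult_right) auto
    moreover have ra: "r * a \<in> free_carrier n"
      using r a hecke_relations_carrier by (intro free_carrier_mult) auto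
    ultimately have "rep n (r * a) = \<zero>\<^bsub>hecke n\<^esub>" using rep_zero_iff by blast
    then show "r * a \<in> ?Z" using ra by (simp add: ind.tensor_one_zero)
  next
    fix j assume j: "j \<in> ?J"
    then have g: "gen j \<in> free_carrier n" using J by (intro free_carrier_gen) blast
    have TP: "rep n (gen j) \<in> ?P"
      using j unfolding parabolic_def T_rep[symmetric] by (intro generate_ring.incl) simp
    \<comment> \<open>Balancing at the unit: a parabolic generator can be exchanged for its
      character value -1.\<close>
    have "?t (gen j) = ind.tensor_one (\<one>\<^bsub>hecke n\<^esub> \<otimes>\<^bsub>hecke n\<^esub> rep n (gen j))"
      using g by (simp add: rep_carrier)
    also have "\<dots> = ?t (scal (- 1))"
      using ind.tensor_one_balanced[OF ind.one_closed TP] phi[OF g TP] ind.r_one[OF ind.scalar_carrier[of "- 1"]]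
      by (simp add: sgn_hom_gen hecke_scalar_rep)
    finally have "?t (gen j + 1) = ?t (scal (- 1) + 1)"
      using g by (simp add: t_add free_carrier_closed)
    also have "\<dots> = \<zero>\<^bsub>ind.M\<^esub>" by (simp add: scal_uminus scal_one t_zero)
    finally show "gen j + 1 \<in> ?Z" using g by (simp add: free_carrier_closed)
  qed
  have t_cong: "?t x = ?t y" if "Z.cong x y" "y \<in> free_carrier n" for x y
  proof -
    have "x - y \<in> free_carrier n" "?t (x - y) = \<zero>\<^bsub>ind.M\<^esub>" using that by (simp_all add: Z.cong_def)
    then show ?thesis using t_add[of "x - y" y] that t_closed[of y] by simp
  qed
  have t_sum: "?t (\<Sum>i\<in>I. scal (c i) * y i) = (\<Oplus>\<^bsub>ind.M\<^esub>i\<in>I. c i \<odot>\<^bsub>ind.M\<^esub> ?t (y i))"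
    if "finite I" "\<And>i. y i \<in> free_carrier n" for I :: "nat set" and c y
    using that(1)
  proof (induction I rule: finite_induct)
    case empty
    then show ?case by (simp add: t_zero)
  next
    case (insert i I)
    have "(\<Oplus>\<^bsub>ind.M\<^esub>i\<in>insert i I. c i \<odot>\<^bsub>ind.M\<^esub> ?t (y i)) =
        c i \<odot>\<^bsub>ind.M\<^esub> ?t (y i) \<oplus>\<^bsub>ind.M\<^esub> (\<Oplus>\<^bsub>ind.M\<^esub>i\<in>I. c i \<odot>\<^bsub>ind.M\<^esub> ?t (y i))"
      using insert that(2) by (intro M.finsum_insert) (auto intro!: M.scalar_closed t_closed)
    then show ?case
      using insert that(2) by (simp add: t_add t_scal free_carrier_closed)
  qed
  \<comment> \<open>\<open>module_basis\<close> is indexed by an initial segment of the naturals, so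
    the colourings are enumerated.\<close>
  obtain en where en: "bij_betw en {..<card (colourings n \<mu>)} (colourings n \<mu>)"
    using ex_bij_betw_nat_finite[OF finite_colourings] unfolding atLeast0LessThan by blast
  let ?k = "card (colourings n \<mu>)"
  have en_in: "en i \<in> colourings n \<mu>" if "i < ?k" for i
    using that en by (auto simp: bij_betw_def)
  let ?b = "\<lambda>i. ?t (coset_elt n (en i))"
  \<comment> \<open>The coordinate at \<open>en i\<close>: let \<open>x\<close> act on the base
    vector and evaluate the resulting function there. This is balanced because parabolic elements
    only rescale the base vector.\<close>
  have "\<exists>\<Phi>. M.linear_functional \<Phi> \<and> (\<forall>x\<in>free_carrier n. \<Phi> (?t x) = act x ?d (en i))" for i
  proof -
    let ?\<beta> = "descend n (\<lambda>x. act x ?d (en i))"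
    obtain \<Phi> where \<Phi>: "M.linear_functional \<Phi>" "\<And>h. h \<in> carrier (hecke n) \<Longrightarrow> \<Phi> (ind.tensor_one h) = ?\<beta> h"
    proof (rule ind.balanced_functional_descends[of ?\<beta>])
      fix h h' assume "h \<in> carrier (hecke n)" "h' \<in> carrier (hecke n)"
      then obtain x x' where "h = rep n x" "h' = rep n x'" "x \<in> free_carrier n" "x' \<in> free_carrier n"
        by (auto simp: carrier_hecke)
      then show "?\<beta> (h \<oplus>\<^bsub>hecke n\<^esub> h') = ?\<beta> h + ?\<beta> h'"
        by (simp add: rep_add[symmetric] descend_act free_carrier_closed act_add)
    next
      fix c h assume "h \<in> carrier (hecke n)"
      then obtain x where "h = rep n x" "x \<in> free_carrier n" by (auto simp: carrier_hecke)
      then show "?\<beta> (hecke_scalar n c \<otimes>\<^bsub>hecke n\<^esub> h) = c * ?\<beta> h"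
        by (simp add: hecke_scalar_rep rep_mult[symmetric] descend_act free_carrier_closed act_mult act_scal)
    next
      fix h h' assume "h \<in> carrier (hecke n)" and h': "h' \<in> ?P"
      then obtain x where x: "h = rep n x" "x \<in> free_carrier n" by (auto simp: carrier_hecke)
      obtain y where y: "y \<in> free_carrier n" "h' = rep n y" "act y ?d = (\<lambda>g. sgn_hom y * ?d g)"
        by (rule parabolic_act_base[OF mu h'])
      show "?\<beta> (h \<otimes>\<^bsub>hecke n\<^esub> h') = ?\<phi> h' * ?\<beta> h"
        using x y h'
        by (simp add: rep_mult[symmetric] descend_act free_carrier_closed act_mult act_smult phi)
    qed blast
    then show ?thesis by (intro exI[of _ \<Phi>]) (simp add: rep_carrier descend_act)
  qed
  then obtain \<Phi> where \<Phi>: "\<And>i. M.linear_functional (\<Phi> i)"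
    "\<And>i x. x \<in> free_carrier n \<Longrightarrow> \<Phi> i (?t x) = act x ?d (en i)"
    by metis
  have \<Phi>_b: "\<Phi> i (?b j) = delta (en j) (en i)" if "j < ?k" for i j
    using \<Phi>(2)[OF coset_elt_carrier] act_coset_elt[OF mu en_in[OF that]] by simp
  have \<Phi>_dual: "\<Phi> i (?b j) = (if i = j then 1 else 0)" if "i < ?k" "j < ?k" for i j
    using that en \<Phi>_b[of j i] by (auto simp: delta_def bij_betw_def inj_on_def)
  have "M.dual_basis ?k ?b \<Phi>"
    unfolding M.dual_basis_def
  proof (intro conjI allI impI ballI)
    show "?b \<in> {..<?k} \<rightarrow> carrier ind.M" by (auto intro: t_closed coset_elt_carrier)
    fix X assume "X \<in> carrier ind.M"
    then obtain x where x: "X = ?t x" "x \<in> free_carrier n"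
      by (auto simp: ind.carrier_M_tensor_one carrier_hecke)
    obtain c where c: "Z.cong x (\<Sum>f\<in>colourings n \<mu>. scal (c f) * coset_elt n f)"
      using Z.all_spanned[OF x(2)] by (auto simp: Z.spanned_def)
    have "(\<Sum>f\<in>colourings n \<mu>. scal (c f) * coset_elt n f) = (\<Sum>i<?k. scal (c (en i)) * coset_elt n (en i))"
      using sum.reindex_bij_betw[OF en, of "\<lambda>f. scal (c f) * coset_elt n f"] by simp
    with c have "Z.cong x (\<Sum>i<?k. scal (c (en i)) * coset_elt n (en i))" by simp
    then have "X = ?t (\<Sum>i<?k. scal (c (en i)) * coset_elt n (en i))"
      unfolding x by (rule t_cong) (intro free_carrier_closed coset_elt_carrier)
    also have "\<dots> = (\<Oplus>\<^bsub>ind.M\<^esub>i\<in>{..<?k}. c (en i) \<odot>\<^bsub>ind.M\<^esub> ?b i)"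
      by (rule t_sum) (auto intro: coset_elt_carrier)
    finally have X: "X = (\<Oplus>\<^bsub>ind.M\<^esub>i\<in>{..<?k}. c (en i) \<odot>\<^bsub>ind.M\<^esub> ?b i)" .
    have "\<Phi> j X = c (en j)" if "j < ?k" for j
    proof -
      have "\<Phi> j X = (\<Sum>i<?k. c (en i) * \<Phi> j (?b i))"
        unfolding X by (intro M.linear_functional_finsum \<Phi> t_closed coset_elt_carrier) simp
      also have "\<dots> = (\<Sum>i<?k. if i = j then c (en j) else 0)"
        using that by (intro sum.cong) (auto simp: \<Phi>_dual)
      finally show ?thesis using that by simp
    qed
    then have "(\<Oplus>\<^bsub>ind.M\<^esub>i\<in>{..<?k}. \<Phi> i X \<odot>\<^bsub>ind.M\<^esub> ?b i) = (\<Oplus>\<^bsub>ind.M\<^esub>i\<in>{..<?k}. c (en i) \<odot>\<^bsub>ind.M\<^esub> ?b i)"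
      by (intro M.finsum_cong') (auto intro!: M.scalar_closed t_closed coset_elt_carrier)
    then show "X = (\<Oplus>\<^bsub>ind.M\<^esub>i\<in>{..<?k}. \<Phi> i X \<odot>\<^bsub>ind.M\<^esub> ?b i)" using X by simp
  qed (use \<Phi> \<Phi>_dual in auto)
  moreover have "M.linear_endo (tensor_act (hecke n) ?P ?\<phi> (rep n p))"
    by (rule ind.linear_endo_tensor_act[OF rep_carrier[OF p]])
  ultimately have "induced_sign_character n \<mu> (rep n p) =
      (\<Sum>i<?k. \<Phi> i (tensor_act (hecke n) ?P ?\<phi> (rep n p) (?b i)))"
    unfolding induced_sign_character_def induced_character_def by (rule M.module_trace_dual_basis)
  also have "\<dots> = (\<Sum>i<?k. act p (delta (en i)) (en i))"
  proof (rule sum.cong)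
    fix i assume "i \<in> {..<?k}"
    then have "act (coset_elt n (en i)) ?d = delta (en i)" using act_coset_elt[OF mu en_in] by simp
    then show "\<Phi> i (tensor_act (hecke n) ?P ?\<phi> (rep n p) (?b i)) = act p (delta (en i)) (en i)"
      using p by (simp add: t_act coset_elt_carrier \<Phi>(2) free_carrier_closed act_mult)
  qed simp
  also have "\<dots> = (\<Sum>f\<in>colourings n \<mu>. act p (delta f) f)"
    using sum.reindex_bij_betw[OF en, of "\<lambda>f. act p (delta f) f"] by simp
  finally show ?thesis .
qed

definition one_plus_T_act :: "nat \<Rightarrow> ((nat \<Rightarrow> nat) \<Rightarrow> laurent) \<Rightarrow> (nat \<Rightarrow> nat) \<Rightarrow> laurent" where
  "one_plus_T_act i \<psi> g = \<psi> g + T_act i \<psi> g"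

lemma one_plus_T_product_rep:
  assumes "set is \<subseteq> {1..<n}"
  obtains p where "p \<in> free_carrier n" "one_plus_T_product n is = rep n p"
    "act p = foldr one_plus_T_act is"
proof -
  define p where "p = foldr (\<lambda>i x. (1 + gen i) * x) is 1"
  have "p \<in> free_carrier n \<and> one_plus_T_product n is = rep n p \<and> act p = foldr one_plus_T_act is"
    using assms unfolding p_def
  proof (induction "is")
    case Nil
    then show ?case by (auto simp: one_plus_T_product_def rep_one free_carrier_closed fun_eq_iff)
  next
    case (Cons i "is")
    let ?x = "foldr (\<lambda>i x. (1 + gen i) * x) is 1"
    have i: "1 + gen i \<in> free_carrier n" "gen i \<in> free_carrier n" using Cons.prems by (auto intro!: free_carrier_closed)
    have "rep n (1 + gen i) = \<one>\<^bsub>hecke n\<^esub> \<oplus>\<^bsub>hecke n\<^esub> T n i"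
      using i(2) by (simp add: rep_add rep_one T_rep free_carrier_closed)
    moreover have "act ((1 + gen i) * ?x) = foldr one_plus_T_act (i # is)"
    proof
      fix \<psi>
      have "act ((1 + gen i) * ?x) \<psi> = one_plus_T_act i (act ?x \<psi>)"
        by (auto simp: act_mult one_plus_T_act_def act_add act_gen)
      then show "act ((1 + gen i) * ?x) \<psi> = foldr one_plus_T_act (i # is) \<psi>" using Cons by simp
    qed
    ultimately show ?case
      using Cons i by (simp add: one_plus_T_product_def rep_mult free_carrier_closed)
  qed
  then show thesis using that by blast
qed

corollary induced_sign_character_one_plus_T:
  assumes "sum_list \<mu> = n" "set is \<subseteq> {1..<n}"
  shows "induced_sign_character n \<mu> (one_plus_T_product n is) =
    (\<Sum>f\<in>colourings n \<mu>. foldr one_plus_T_act is (delta f) f)"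
proof -
  obtain p where "p \<in> free_carrier n" "one_plus_T_product n is = rep n p" "act p = foldr one_plus_T_act is"
    by (rule one_plus_T_product_rep[OF assms(2)])
  then show ?thesis using induced_sign_character_rep[OF assms(1), of p] by simp
qed

section \<open>Expansion over sets of crossings\<close>

text \<open>Covering families are encoded by their sets \<open>E\<close> of crossings; \<open>level_at s E j k\<close> is the level at
  which the path from source \<open>k\<close> reaches the \<open>j\<close>-th elementary diagram, and \<open>source_at s E j\<close> is the
  inverse permutation.\<close>

definition crossing_perm :: "(nat \<Rightarrow> nat) \<Rightarrow> nat set \<Rightarrow> nat \<Rightarrow> nat \<Rightarrow> nat" where
  "crossing_perm s E j = (if j \<in> E then transpose (s j) (Suc (s j)) else id)"

primrec level_at :: "(nat \<Rightarrow> nat) \<Rightarrow> nat set \<Rightarrow> nat \<Rightarrow> nat \<Rightarrow> nat" where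
  "level_at s E 0 k = k"
| "level_at s E (Suc j) k = crossing_perm s E j (level_at s E j k)"

primrec source_at :: "(nat \<Rightarrow> nat) \<Rightarrow> nat set \<Rightarrow> nat \<Rightarrow> nat \<Rightarrow> nat" where
  "source_at s E 0 h = h"
| "source_at s E (Suc j) h = source_at s E j (crossing_perm s E j h)"

lemma crossing_perm_involutive [simp]: "crossing_perm s E j (crossing_perm s E j h) = h"
  by (simp add: crossing_perm_def)

lemma source_at_level_at [simp]: "source_at s E j (level_at s E j k) = k"
  by (induction j) simp_all

lemma level_at_source_at [simp]: "level_at s E j (source_at s E j h) = h"
  by (induction j arbitrary: h) simp_all

lemma level_at_eq_iff: "level_at s E j k = h \<longleftrightarrow> k = source_at s E j h"
  by auto

text \<open>The position before diagram \<open>j\<close> depends only on crossings to its left; this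
  allows the choice at a new last diagram to be added without disturbing earlier weights.\<close>

lemma source_at_cong: "E \<inter> {..<j} = E' \<inter> {..<j} \<Longrightarrow> source_at s E j = source_at s E' j"
proof (induction j)
  case (Suc j)
  have "j \<in> E \<longleftrightarrow> j \<in> E'" using Suc.prems by (auto simp: set_eq_iff lessThan_Suc)
  moreover have "E \<inter> {..<j} = E' \<inter> {..<j}" using Suc.prems by (auto simp: set_eq_iff lessThan_Suc)
  ultimately show ?case using Suc.IH by (auto simp: crossing_perm_def)
qed auto

lemma level_at_in:
  assumes "\<And>i. i < j \<Longrightarrow> s i \<in> {1..<n}"
  shows "level_at s E j k \<in> {1..n} \<longleftrightarrow> k \<in> {1..n}"
  using assms
proof (induction j)
  case (Suc j)
  have "s j \<in> {1..<n}" using Suc.prems by simp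
  then have "crossing_perm s E j h \<in> {1..n} \<longleftrightarrow> h \<in> {1..n}" for h
    by (auto simp: crossing_perm_def transpose_def)
  then show ?case using Suc by simp
qed simp

lemma source_at_in:
  assumes "\<And>i. i < j \<Longrightarrow> s i \<in> {1..<n}"
  shows "source_at s E j h \<in> {1..n} \<longleftrightarrow> h \<in> {1..n}"
proof -
  have "level_at s E j (source_at s E j h) \<in> {1..n} \<longleftrightarrow> source_at s E j h \<in> {1..n}"
    by (rule level_at_in) (rule assms)
  then show ?thesis by (simp del: atLeastAtMost_iff)
qed

text \<open>The entry of 1 + T_i in the row of a colouring with colour \<open>a\<close> at level i
  and \<open>b\<close> at level i + 1; \<open>x\<close> tells whether the step swaps. The values 0
  and \<open>q\<close> arise as 1 - 1 and 1 + (q - 1).\<close>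

definition step_weight :: "nat \<Rightarrow> nat \<Rightarrow> bool \<Rightarrow> laurent" where
  "step_weight a b x = (if a = b then 0 else if x then q_half else if b < a then q else 1)"

lemma one_plus_T_act_step:
  "one_plus_T_act i \<psi> g = step_weight (g i) (g (Suc i)) False * \<psi> g +
    step_weight (g i) (g (Suc i)) True * \<psi> (swap_levels i g)"
  by (cases "g i" "g (Suc i)" rule: linorder_cases)
    (simp_all add: one_plus_T_act_def T_act_def step_weight_def algebra_simps)

definition colour_at :: "(nat \<Rightarrow> nat) \<Rightarrow> nat set \<Rightarrow> (nat \<Rightarrow> nat) \<Rightarrow> nat \<Rightarrow> nat \<Rightarrow> nat" where
  "colour_at s E g j h = g (source_at s E j h)"

definition walk_weight :: "(nat \<Rightarrow> nat) \<Rightarrow> nat set \<Rightarrow> (nat \<Rightarrow> nat) \<Rightarrow> nat \<Rightarrow> laurent" where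
  "walk_weight s E g m =
    (\<Prod>j<m. step_weight (colour_at s E g j (s j)) (colour_at s E g j (Suc (s j))) (j \<in> E))"

lemma sum_Pow_insert:
  assumes "finite A" "a \<notin> A"
  shows "(\<Sum>E\<in>Pow (insert a A). F E) = (\<Sum>E\<in>Pow A. F E + F (insert a E))"
proof -
  have "(\<Sum>E\<in>Pow (insert a A). F E) = (\<Sum>E\<in>Pow A. F E) + (\<Sum>E\<in>insert a ` Pow A. F E)"
    unfolding Pow_insert using assms by (intro sum.union_disjoint) auto
  also have "(\<Sum>E\<in>insert a ` Pow A. F E) = (\<Sum>E\<in>Pow A. F (insert a E))"
    using assms(2) by (intro sum.reindex_cong[of "insert a"]) (auto simp: inj_on_def)
  finally show ?thesis by (simp add: sum.distrib)
qed

text \<open>Evaluated at \<open>g\<close>, the outermost factor acts first on the colouring: the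
  walk starts at \<open>g\<close>, follows the diagrams from left to right, and
  \<open>\<psi>\<close> is read at its end. The last factor is split off by absorbing it into
  \<open>\<psi>\<close>, hence the induction over arbitrary \<open>\<psi>\<close>.\<close>

lemma foldr_one_plus_T_act:
  "foldr one_plus_T_act (map s [0..<m]) \<psi> g =
    (\<Sum>E\<in>Pow {..<m}. walk_weight s E g m * \<psi> (colour_at s E g m))"
proof (induction m arbitrary: \<psi>)
  case 0
  then show ?case by (simp add: walk_weight_def colour_at_def[abs_def])
next
  case (Suc m)
  let ?F = "\<lambda>E. walk_weight s E g (Suc m) * \<psi> (colour_at s E g (Suc m))"
  have "walk_weight s E g m * one_plus_T_act (s m) \<psi> (colour_at s E g m) = ?F E + ?F (insert m E)"
    if E: "E \<in> Pow {..<m}" for E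
  proof -
    have same: "source_at s (insert m E) j = source_at s E j" if "j \<le> m" for j
      using that by (intro source_at_cong) auto
    then have w: "walk_weight s (insert m E) g m = walk_weight s E g m"
      by (auto simp: walk_weight_def colour_at_def intro!: prod.cong)
    have m: "m \<notin> E" using E by auto
    have c: "colour_at s E g (Suc m) = colour_at s E g m"
      "colour_at s (insert m E) g (Suc m) = swap_levels (s m) (colour_at s E g m)"
      using m same[of m] by (auto simp: colour_at_def crossing_perm_def swap_levels_def)
    have "walk_weight s E g (Suc m) = walk_weight s E g m *
        step_weight (colour_at s E g m (s m)) (colour_at s E g m (Suc (s m))) False"
      "walk_weight s (insert m E) g (Suc m) = walk_weight s E g m *
        step_weight (colour_at s E g m (s m)) (colour_at s E g m (Suc (s m))) True"
      using m w same[of m] by (simp_all add: walk_weight_def colour_at_def)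
    then show ?thesis by (simp add: c one_plus_T_act_step algebra_simps)
  qed
  then show ?case
    by (simp add: Suc lessThan_Suc sum_Pow_insert)
qed

text \<open>\<open>delta\<close> at the end closes the walk, and a walk in which equal colours meet
  has a factor 0, so both conditions move into the index set.\<close>

lemma sum_foldr_delta:
  assumes "finite F"
  shows "(\<Sum>f\<in>F. foldr one_plus_T_act (map s [0..<m]) (delta f) f) =
    (\<Sum>(g, E) \<in> {(g, E). g \<in> F \<and> E \<subseteq> {..<m} \<and> colour_at s E g m = g \<and>
        (\<forall>j<m. colour_at s E g j (s j) \<noteq> colour_at s E g j (Suc (s j)))}. walk_weight s E g m)"
proof -
  let ?S = "{(g, E). g \<in> F \<and> E \<subseteq> {..<m} \<and> colour_at s E g m = g \<and>
        (\<forall>j<m. colour_at s E g j (s j) \<noteq> colour_at s E g j (Suc (s j)))}"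
  have "(\<Sum>f\<in>F. foldr one_plus_T_act (map s [0..<m]) (delta f) f) =
      (\<Sum>(g, E)\<in>F \<times> Pow {..<m}. walk_weight s E g m * delta g (colour_at s E g m))"
    unfolding foldr_one_plus_T_act by (rule sum.cartesian_product)
  also have "\<dots> = (\<Sum>(g, E)\<in>?S. walk_weight s E g m)"
  proof (rule sum.mono_neutral_cong_right)
    show "\<forall>x\<in>F \<times> Pow {..<m} - ?S. (case x of (g, E) \<Rightarrow> walk_weight s E g m * delta g (colour_at s E g m)) = 0"
    proof
      fix x assume x: "x \<in> F \<times> Pow {..<m} - ?S"
      obtain g E where gE: "x = (g, E)" by (cases x)
      have "walk_weight s E g m * delta g (colour_at s E g m) = 0"
      proof (cases "colour_at s E g m = g")
        case True
        with x gE obtain j where "j < m" "colour_at s E g j (s j) = colour_at s E g j (Suc (s j))" by blast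
        then have "walk_weight s E g m = 0"
          unfolding walk_weight_def by (intro prod_zero bexI[of _ j]) (auto simp: step_weight_def)
        then show ?thesis by simp
      qed (simp add: delta_def)
      then show "(case x of (g, E) \<Rightarrow> walk_weight s E g m * delta g (colour_at s E g m)) = 0"
        by (simp add: gE)
    qed
  qed (use assms in \<open>auto simp: delta_def\<close>)
  finally show ?thesis .
qed

text \<open>The factor \<open>q\<close> occurs exactly at the noncrossings whose upper path has the
  smaller colour, that is, lies in a column further left: the situation counted by
  \<open>incross\<close>.\<close>

lemma walk_weight_eq:
  assumes "\<forall>j<m. colour_at s E g j (s j) \<noteq> colour_at s E g j (Suc (s j))" "E \<subseteq> {..<m}"
  shows "walk_weight s E g m =
    q ^ card {j. j < m \<and> j \<notin> E \<and> colour_at s E g j (Suc (s j)) < colour_at s E g j (s j)} * q_half ^ card E"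
proof -
  let ?D = "{j. j < m \<and> j \<notin> E \<and> colour_at s E g j (Suc (s j)) < colour_at s E g j (s j)}"
  have count: "(\<Prod>j<m. if j \<in> A then x else 1) = x ^ card ({..<m} \<inter> A)" for A and x :: laurent
    by (simp add: prod.If_cases)
  have "walk_weight s E g m = (\<Prod>j<m. (if j \<in> ?D then q else 1) * (if j \<in> E then q_half else 1))"
    unfolding walk_weight_def using assms(1) by (intro prod.cong) (auto simp: step_weight_def)
  also have "\<dots> = q ^ card ({..<m} \<inter> ?D) * q_half ^ card ({..<m} \<inter> E)"
    unfolding prod.distrib count ..
  also have "{..<m} \<inter> ?D = ?D" by auto
  also have "{..<m} \<inter> E = E" using assms(2) by auto
  finally show ?thesis by simp
qed

section \<open>Covering path families\<close>

text \<open>The vertices of a path within one elementary diagram except the right endpoint, which is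
  the left endpoint of the next segment.\<close>

definition segment :: "(nat \<Rightarrow> nat) \<Rightarrow> nat \<Rightarrow> nat \<Rightarrow> vertex list" where
  "segment s j h = (if h \<in> {s j, Suc (s j)} then [Pt j h, Centre j] else [Pt j h])"

text \<open>A path is encoded by the level \<open>l j\<close> at which it reaches each diagram. The
  starting position \<open>a\<close> allows induction from the right end towards the left.\<close>

definition level_path :: "(nat \<Rightarrow> nat) \<Rightarrow> nat \<Rightarrow> (nat \<Rightarrow> nat) \<Rightarrow> nat \<Rightarrow> vertex list" where
  "level_path s m l a = concat (map (\<lambda>j. segment s j (l j)) [a..<m]) @ [Pt m (l m)]"

lemma level_path_rec: "a < m \<Longrightarrow> level_path s m l a = segment s a (l a) @ level_path s m l (Suc a)"
  by (simp add: level_path_def upt_conv_Cons)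

lemma level_path_end: "level_path s m l m = [Pt m (l m)]"
  by (simp add: level_path_def)

lemma level_path_nonempty [simp]: "level_path s m l a \<noteq> []"
  by (simp add: level_path_def)

lemma hd_level_path: "a \<le> m \<Longrightarrow> hd (level_path s m l a) = Pt a (l a)"
  by (cases "a = m") (auto simp: level_path_end level_path_rec segment_def)

lemma last_level_path [simp]: "last (level_path s m l a) = Pt m (l m)"
  by (simp add: level_path_def)

lemma level_path_cong:
  "(\<And>j. a \<le> j \<Longrightarrow> j \<le> m \<Longrightarrow> l j = l' j) \<Longrightarrow> a \<le> m \<Longrightarrow> level_path s m l a = level_path s m l' a"
  by (auto simp: level_path_def intro!: arg_cong[of _ _ concat])

lemma set_level_path:
  assumes "a \<le> m"
  shows "set (level_path s m l a) = {Pt j (l j) | j. a \<le> j \<and> j \<le> m} \<union>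
    {Centre j | j. a \<le> j \<and> j < m \<and> l j \<in> {s j, Suc (s j)}}"
  using assms
proof (induction rule: inc_induct)
  case base
  then show ?case by (auto simp: level_path_end)
next
  case (step a)
  have "{Pt j (l j) | j. a \<le> j \<and> j \<le> m} = insert (Pt a (l a)) {Pt j (l j) | j. Suc a \<le> j \<and> j \<le> m}"
    using step.hyps by (auto simp: le_eq_less_or_eq Suc_le_eq)
  moreover have "{Centre j | j. a \<le> j \<and> j < m \<and> l j \<in> {s j, Suc (s j)}} =
      (if l a \<in> {s a, Suc (s a)} then {Centre a} else {}) \<union>
      {Centre j | j. Suc a \<le> j \<and> j < m \<and> l j \<in> {s j, Suc (s j)}}"
    using step.hyps by (auto simp: le_eq_less_or_eq Suc_le_eq)
  ultimately show ?case
    using step by (auto simp: level_path_rec segment_def)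
qed

lemma distinct_level_path:
  assumes "a \<le> m"
  shows "distinct (level_path s m l a)"
  using assms
proof (induction rule: inc_induct)
  case base
  then show ?case by (simp add: level_path_end)
next
  case (step a)
  have "Pt a (l a) \<notin> set (level_path s m l (Suc a))" "Centre a \<notin> set (level_path s m l (Suc a))"
    using step.hyps by (auto simp: set_level_path)
  then show ?case using step by (auto simp: level_path_rec segment_def)
qed

definition step_arcs :: "(nat \<Rightarrow> nat) \<Rightarrow> (nat \<Rightarrow> nat) \<Rightarrow> nat \<Rightarrow> (vertex \<times> vertex) set" where
  "step_arcs s l j = (if l j \<in> {s j, Suc (s j)}
    then {(Pt j (l j), Centre j), (Centre j, Pt (Suc j) (l (Suc j)))}
    else {(Pt j (l j), Pt (Suc j) (l (Suc j)))})"

lemma set_vwalk_arcs_level_path: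
  assumes "a \<le> m"
  shows "set (vwalk_arcs (level_path s m l a)) = (\<Union>j\<in>{a..<m}. step_arcs s l j)"
  using assms
proof (induction rule: inc_induct)
  case base
  then show ?case by (simp add: level_path_end)
next
  case (step a)
  have "set (vwalk_arcs (level_path s m l a)) = step_arcs s l a \<union> set (vwalk_arcs (level_path s m l (Suc a)))"
    using step.hyps by (auto simp: level_path_rec segment_def step_arcs_def hd_level_path)
  moreover have "{a..<m} = insert a {Suc a..<m}" using step.hyps by auto
  ultimately show ?case using step.IH by simp
qed

lemma arc_from_centre_in_level_path:
  "(Centre j, Pt j' h) \<in> set (vwalk_arcs (level_path s m l 0)) \<longleftrightarrow>
    j < m \<and> j' = Suc j \<and> l j \<in> {s j, Suc (s j)} \<and> h = l (Suc j)"
  unfolding set_vwalk_arcs_level_path[OF le0] by (auto simp: step_arcs_def split: if_splits)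

lemma arc_to_centre_in_level_path:
  "(Pt j h, Centre j') \<in> set (vwalk_arcs (level_path s m l 0)) \<longleftrightarrow>
    j < m \<and> j' = j \<and> l j \<in> {s j, Suc (s j)} \<and> h = l j"
  unfolding set_vwalk_arcs_level_path[OF le0] by (auto simp: step_arcs_def split: if_splits)

lemma horizontal_arc_in_level_path:
  "(Pt j h, Pt j' h') \<in> set (vwalk_arcs (level_path s m l 0)) \<longleftrightarrow>
    j < m \<and> j' = Suc j \<and> l j \<notin> {s j, Suc (s j)} \<and> h = l j \<and> h' = l (Suc j)"
  unfolding set_vwalk_arcs_level_path[OF le0] by (auto simp: step_arcs_def split: if_splits)

lemma enters_level_path:
  "enters (level_path s m l 0) j h \<longleftrightarrow> j < m \<and> l j \<in> {s j, Suc (s j)} \<and> h = l j"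
  by (simp add: enters_def arc_to_centre_in_level_path)

lemma leaves_level_path:
  "leaves (level_path s m l 0) j h \<longleftrightarrow> j < m \<and> l j \<in> {s j, Suc (s j)} \<and> h = l (Suc j)"
  by (simp add: leaves_def arc_from_centre_in_level_path)

section \<open>Walks in a wiring diagram as sequences of levels\<close>

definition level_step :: "(nat \<Rightarrow> nat) \<Rightarrow> nat \<Rightarrow> nat \<Rightarrow> nat \<Rightarrow> bool" where
  "level_step s j h h' \<longleftrightarrow>
    (if h \<in> {s j, Suc (s j)} then h' \<in> {s j, Suc (s j)} else h' = h)"

lemma wiring_arc_cases:
  assumes "(Pt j h, v) \<in> arcs (wiring_diagram n is)"
  shows "j < length is \<and> (if h \<in> {is ! j, Suc (is ! j)} then v = Centre j else v = Pt (Suc j) h)"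
  using assms by (auto simp: wiring_diagram_def elementary_arcs_def)

lemma wiring_centre_arc_cases:
  assumes "(Centre j, v) \<in> arcs (wiring_diagram n is)"
  shows "j < length is \<and> v \<in> {Pt (Suc j) (is ! j), Pt (Suc j) (Suc (is ! j))}"
  using assms by (auto simp: wiring_diagram_def elementary_arcs_def)

text \<open>Every arc out of a point is forced, and only a centre offers two continuations, so the
  levels at the points between diagrams determine the walk.\<close>

lemma walk_levels:
  assumes "p \<noteq> []" "set (vwalk_arcs p) \<subseteq> arcs (wiring_diagram n is)"
    and "hd p = Pt a h" "last p = Pt (length is) h'" "a \<le> length is"
  shows "\<exists>l. l a = h \<and> (\<forall>j\<in>{a..<length is}. level_step ((!) is) j (l j) (l (Suc j))) \<and>
    p = level_path ((!) is) (length is) l a"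
  using assms(5,1-4)
proof (induction a arbitrary: h p rule: inc_induct)
  case base
  then obtain p' where p: "p = Pt (length is) h # p'" by (cases p) auto
  have "p' = []"
  proof (rule ccontr)
    assume "p' \<noteq> []"
    then have "(Pt (length is) h, hd p') \<in> arcs (wiring_diagram n is)" using base p by simp
    then show False using wiring_arc_cases by blast
  qed
  then show ?case using p by (intro exI[of _ "\<lambda>_. h"]) (simp add: level_path_end)
next
  case (step a)
  obtain p' where p: "p = Pt a h # p'" using step.prems by (cases p) auto
  have p': "p' \<noteq> []" using p step.prems step.hyps by auto
  have arcs': "set (vwalk_arcs p') \<subseteq> arcs (wiring_diagram n is)" using step.prems p p' by auto
  have last': "last p' = Pt (length is) h'" using step.prems p p' by simp
  have arc: "(Pt a h, hd p') \<in> arcs (wiring_diagram n is)" using step.prems p p' by auto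
  show ?case
  proof (cases "h \<in> {is ! a, Suc (is ! a)}")
    case False
    then have "hd p' = Pt (Suc a) h" using wiring_arc_cases[OF arc] by simp
    from step.IH[OF p' arcs' this last'] obtain l where l: "l (Suc a) = h"
      "\<forall>j\<in>{Suc a..<length is}. level_step ((!) is) j (l j) (l (Suc j))"
      "p' = level_path ((!) is) (length is) l (Suc a)" by blast
    \<comment> \<open>\<open>l\<close> matters only from \<open>Suc a\<close> on, so its value at
      \<open>a\<close> can be reset without changing the rest of the path.\<close>
    let ?l = "l(a := h)"
    have "level_path ((!) is) (length is) ?l (Suc a) = p'"
      unfolding l(3) using step.hyps by (intro level_path_cong) auto
    then have "p = level_path ((!) is) (length is) ?l a"
      using False p step.hyps by (simp add: level_path_rec segment_def)
    moreover have "\<forall>j\<in>{a..<length is}. level_step ((!) is) j (?l j) (?l (Suc j))"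
    proof
      fix j assume "j \<in> {a..<length is}"
      then show "level_step ((!) is) j (?l j) (?l (Suc j))"
        using l(1,2) False by (cases "j = a") (auto simp: level_step_def[of _ a])
    qed
    moreover have "?l a = h" by simp
    ultimately show ?thesis by blast
  next
    case True
    then have "hd p' = Centre a" using wiring_arc_cases[OF arc] by simp
    then obtain p'' where p'': "p' = Centre a # p''" using p' by (cases p') auto
    have ne: "p'' \<noteq> []" using p'' last' by auto
    have arcs'': "set (vwalk_arcs p'') \<subseteq> arcs (wiring_diagram n is)" using arcs' p'' ne by auto
    have last'': "last p'' = Pt (length is) h'" using last' p'' ne by simp
    have "(Centre a, hd p'') \<in> arcs (wiring_diagram n is)" using arcs' p'' ne by auto
    then obtain h1 where h1: "hd p'' = Pt (Suc a) h1" "h1 \<in> {is ! a, Suc (is ! a)}"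
      using wiring_centre_arc_cases by fastforce
    from step.IH[OF ne arcs'' h1(1) last''] obtain l where l: "l (Suc a) = h1"
      "\<forall>j\<in>{Suc a..<length is}. level_step ((!) is) j (l j) (l (Suc j))"
      "p'' = level_path ((!) is) (length is) l (Suc a)" by blast
    let ?l = "l(a := h)"
    have "level_path ((!) is) (length is) ?l (Suc a) = p''"
      unfolding l(3) using step.hyps by (intro level_path_cong) auto
    then have "p = level_path ((!) is) (length is) ?l a"
      using True p p'' step.hyps by (simp add: level_path_rec segment_def)
    moreover have "\<forall>j\<in>{a..<length is}. level_step ((!) is) j (?l j) (?l (Suc j))"
    proof
      fix j assume "j \<in> {a..<length is}"
      then show "level_step ((!) is) j (?l j) (?l (Suc j))"
        using l(1,2) True h1(2) by (cases "j = a") (auto simp: level_step_def[of _ a])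
    qed
    moreover have "?l a = h" by simp
    ultimately show ?thesis by blast
  qed
qed

lemma set_vwalk_arcs_subset: "set (vwalk_arcs p) \<subseteq> set p \<times> set p"
  by (induction p rule: vwalk_arcs.induct) auto

lemma distinct_vwalk_arcs: "distinct p \<Longrightarrow> distinct (vwalk_arcs p)"
proof (induction p rule: vwalk_arcs.induct)
  case (3 x y xs)
  then show ?case using set_vwalk_arcs_subset[of "y # xs"] by auto
qed auto

lemma count_list_distinct: "distinct xs \<Longrightarrow> count_list xs x = (if x \<in> set xs then 1 else 0)"
  by (induction xs) auto

text \<open>In a path no arc repeats, so each multiplicity is 0 or 1 and a total of 1 means a unique
  path through the arc.\<close>

lemma sum_count_list_distinct:
  assumes "finite K" "\<And>k. k \<in> K \<Longrightarrow> distinct (xs k)"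
  shows "(\<Sum>k\<in>K. count_list (xs k) e) = 1 \<longleftrightarrow> (\<exists>!k. k \<in> K \<and> e \<in> set (xs k))"
proof -
  have "(\<Sum>k\<in>K. count_list (xs k) e) = (\<Sum>k\<in>K. if e \<in> set (xs k) then 1 else 0)"
    using assms(2) by (intro sum.cong) (auto simp: count_list_distinct)
  also have "\<dots> = card {k \<in> K. e \<in> set (xs k)}"
    using assms(1) by (simp add: sum.If_cases Int_def)
  finally show ?thesis by (simp add: card_1_singleton_iff set_eq_iff) (metis)
qed

lemma arcs_ends_wiring_diagram: "arcs_ends (wiring_diagram n is) = arcs (wiring_diagram n is)"
  by (auto simp: arcs_ends_def arc_to_ends_def wiring_diagram_def)

lemma covering_family_iff:
  "covering_family n is \<pi> \<longleftrightarrow> \<pi> \<in> extensional {1..n} \<and>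
    (\<forall>k\<in>{1..n}. vpath (\<pi> k) (wiring_diagram n is) \<and> hd (\<pi> k) = Pt 0 k \<and>
       last (\<pi> k) \<in> Pt (length is) ` {1..n}) \<and>
    (\<forall>e\<in>arcs (wiring_diagram n is). \<exists>!k. k \<in> {1..n} \<and> e \<in> set (vwalk_arcs (\<pi> k)))"
proof -
  have "(\<Sum>k=1..n. count_list (vwalk_arcs (\<pi> k)) e) = 1 \<longleftrightarrow>
      (\<exists>!k. k \<in> {1..n} \<and> e \<in> set (vwalk_arcs (\<pi> k)))"
    if "\<forall>k\<in>{1..n}. vpath (\<pi> k) (wiring_diagram n is)" for e
    by (rule sum_count_list_distinct) (use that in \<open>auto simp: vpath_def intro: distinct_vwalk_arcs\<close>)
  then show ?thesis unfolding covering_family_def by blast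
qed

section \<open>Covering families correspond to sets of crossings\<close>

definition crossing_family :: "nat \<Rightarrow> nat list \<Rightarrow> nat set \<Rightarrow> nat \<Rightarrow> vertex list" where
  "crossing_family n is E = (\<lambda>k\<in>{1..n}. level_path ((!) is) (length is) (\<lambda>j. level_at ((!) is) E j k) 0)"

lemma crossing_family_apply:
  "k \<in> {1..n} \<Longrightarrow> crossing_family n is E k =
    level_path ((!) is) (length is) (\<lambda>j. level_at ((!) is) E j k) 0"
  by (simp add: crossing_family_def)

context
  fixes n :: nat and "is" :: "nat list"
  assumes is_range: "set is \<subseteq> {1..<n}"
begin

lemma is_nth: "j < length is \<Longrightarrow> is ! j \<in> {1..<n}"
  using is_range nth_mem by blast

lemma level_at_range: "j \<le> length is \<Longrightarrow> level_at ((!) is) E j k \<in> {1..n} \<longleftrightarrow> k \<in> {1..n}"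
  by (rule level_at_in) (rule is_nth, simp)

lemma source_at_range: "j \<le> length is \<Longrightarrow> source_at ((!) is) E j h \<in> {1..n} \<longleftrightarrow> h \<in> {1..n}"
  by (rule source_at_in) (rule is_nth, simp)

lemma enters_crossing_family:
  assumes "k \<in> {1..n}"
  shows "enters (crossing_family n is E k) j h \<longleftrightarrow>
    j < length is \<and> h \<in> {is ! j, Suc (is ! j)} \<and> k = source_at ((!) is) E j h"
  using assms by (auto simp: crossing_family_apply enters_level_path level_at_eq_iff)

lemma level_at_Suc_strand:
  "level_at s E (Suc j) k \<in> {s j, Suc (s j)} \<longleftrightarrow> level_at s E j k \<in> {s j, Suc (s j)}"
  by (auto simp: crossing_perm_def transpose_def split: if_splits)

lemma leaves_crossing_family:
  assumes "k \<in> {1..n}"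
  shows "leaves (crossing_family n is E k) j h \<longleftrightarrow>
    j < length is \<and> h \<in> {is ! j, Suc (is ! j)} \<and> k = source_at ((!) is) E (Suc j) h"
proof -
  have "leaves (crossing_family n is E k) j h \<longleftrightarrow> j < length is \<and>
      level_at ((!) is) E (Suc j) k \<in> {is ! j, Suc (is ! j)} \<and> h = level_at ((!) is) E (Suc j) k"
    unfolding level_at_Suc_strand using assms by (simp add: crossing_family_apply leaves_level_path)
  also have "h = level_at ((!) is) E (Suc j) k \<longleftrightarrow> k = source_at ((!) is) E (Suc j) h"
    by (metis level_at_eq_iff)
  finally show ?thesis by (metis level_at_eq_iff)
qed

lemma crossing_crossing_family:
  assumes "j < length is"
  shows "crossing n is (crossing_family n is E) j \<longleftrightarrow> j \<in> E"
proof -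
  let ?i = "is ! j"
  have i: "?i \<in> {1..n}" "Suc ?i \<in> {1..n}" using is_nth[OF assms] by auto
  have src: "source_at ((!) is) E j h \<in> {1..n} \<longleftrightarrow> h \<in> {1..n}" for h
    using assms by (intro source_at_range) simp
  have inj: "source_at ((!) is) E j h = source_at ((!) is) E j h' \<longleftrightarrow> h = h'" for h h'
    by (metis level_at_source_at)
  have "(\<exists>k\<in>{1..n}. enters (crossing_family n is E k) j h \<and> leaves (crossing_family n is E k) j h') \<longleftrightarrow>
      h = crossing_perm ((!) is) E j h'"
    if "h \<in> {?i, Suc ?i}" "h' \<in> {?i, Suc ?i}" for h h'
  proof -
    have "h \<in> {1..n}" using that i by auto
    then have "source_at ((!) is) E j h \<in> {1..n}" using src by blast
    then show ?thesis
      using that assms enters_crossing_family leaves_crossing_family by (auto simp: inj)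
  qed
  from this[of ?i "Suc ?i"] this[of "Suc ?i" ?i] show ?thesis
    unfolding crossing_def by (auto simp: crossing_perm_def)
qed

text \<open>Every arc pins down one level at one position. \<open>level_at\<close> permutes the
  sources there, so exactly one path runs through the arc.\<close>

lemma crossing_family_covering: "covering_family n is (crossing_family n is E)"
  unfolding covering_family_iff
proof (intro conjI ballI)
  let ?s = "(!) is" and ?m = "length is"
  show "crossing_family n is E \<in> extensional {1..n}" by (simp add: crossing_family_def)
  fix k assume k: "k \<in> {1..n}"
  have lev: "level_at ?s E j k \<in> {1..n}" if "j \<le> ?m" for j using level_at_range[OF that] k by blast
  show "hd (crossing_family n is E k) = Pt 0 k" using k by (simp add: crossing_family_apply hd_level_path)
  show "last (crossing_family n is E k) \<in> Pt ?m ` {1..n}"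
    using k lev[of ?m] by (simp add: crossing_family_apply)
  have "step_arcs ?s (\<lambda>j. level_at ?s E j k) j \<subseteq> elementary_arcs n j (is ! j)" if "j < ?m" for j
    using lev[of j] lev[of "Suc j"] that level_at_Suc_strand[of ?s E j k]
    by (auto simp: step_arcs_def elementary_arcs_def crossing_perm_def)
  then have "set (vwalk_arcs (crossing_family n is E k)) \<subseteq> arcs (wiring_diagram n is)"
    using k by (fastforce simp: crossing_family_apply set_vwalk_arcs_level_path wiring_diagram_def)
  moreover have "set (crossing_family n is E k) \<subseteq> verts (wiring_diagram n is)"
    using k lev by (auto simp: crossing_family_apply set_level_path wiring_diagram_def)
  ultimately show "vpath (crossing_family n is E k) (wiring_diagram n is)"
    using k by (auto simp: vpath_def vwalk_def arcs_ends_wiring_diagram crossing_family_apply distinct_level_path)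
next
  let ?s = "(!) is" and ?m = "length is"
  fix a assume "a \<in> arcs (wiring_diagram n is)"
  then obtain j where j: "j < ?m" "a \<in> elementary_arcs n j (is ! j)" by (auto simp: wiring_diagram_def)
  have i: "is ! j \<in> {1..n}" "Suc (is ! j) \<in> {1..n}" using is_nth[OF j(1)] by auto
  \<comment> \<open>The position is \<open>j\<close> for horizontal arcs and arcs into the centre,
    but \<open>Suc j\<close> for arcs out of it.\<close>
  have "\<exists>h j'. j' \<le> ?m \<and> h \<in> {1..n} \<and> (\<forall>k\<in>{1..n}.
      a \<in> set (vwalk_arcs (crossing_family n is E k)) \<longleftrightarrow> level_at ?s E j' k = h)"
    using j(2) unfolding elementary_arcs_def
  proof (elim UnE CollectE exE conjE)
    fix h assume a: "a = (Pt j h, Pt (Suc j) h)" and h: "h \<in> {1..n} - {is ! j, is ! j + 1}"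
    have "a \<in> set (vwalk_arcs (crossing_family n is E k)) \<longleftrightarrow> level_at ?s E j k = h" if "k \<in> {1..n}" for k
      using a h j(1) that
      by (auto simp: crossing_family_apply horizontal_arc_in_level_path crossing_perm_def)
    then show ?thesis using h j(1) by (intro exI[of _ h] exI[of _ j]) auto
  next
    assume "a \<in> {(Pt j (is ! j), Centre j), (Pt j (is ! j + 1), Centre j),
      (Centre j, Pt (Suc j) (is ! j)), (Centre j, Pt (Suc j) (is ! j + 1))}"
    then consider h where "h \<in> {is ! j, Suc (is ! j)}" "a = (Pt j h, Centre j)"
      | h where "h \<in> {is ! j, Suc (is ! j)}" "a = (Centre j, Pt (Suc j) h)" by auto
    then show ?thesis
    proof cases
      case (1 h)
      then have "a \<in> set (vwalk_arcs (crossing_family n is E k)) \<longleftrightarrow> level_at ?s E j k = h"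
        if "k \<in> {1..n}" for k
        using enters_crossing_family[OF that, of E j h] j(1) unfolding enters_def level_at_eq_iff by simp
      then show ?thesis using 1 i j(1) by (intro exI[of _ h] exI[of _ j]) auto
    next
      case (2 h)
      then have "a \<in> set (vwalk_arcs (crossing_family n is E k)) \<longleftrightarrow> level_at ?s E (Suc j) k = h"
        if "k \<in> {1..n}" for k
        using leaves_crossing_family[OF that, of E j h] j(1) unfolding leaves_def level_at_eq_iff by simp
      then show ?thesis using 2 i j(1) by (intro exI[of _ h] exI[of _ "Suc j"]) auto
    qed
  qed
  then obtain h j' where h: "j' \<le> ?m" "h \<in> {1..n}"
    "\<And>k. k \<in> {1..n} \<Longrightarrow> a \<in> set (vwalk_arcs (crossing_family n is E k)) \<longleftrightarrow> level_at ?s E j' k = h"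
    by blast
  have "source_at ?s E j' h \<in> {1..n}" using source_at_range[OF h(1)] h(2) by blast
  then show "\<exists>!k. k \<in> {1..n} \<and> a \<in> set (vwalk_arcs (crossing_family n is E k))"
    using h(3) by (intro ex1I[of _ "source_at ?s E j' h"]) (auto simp: level_at_eq_iff)
qed

lemma covering_family_levels:
  assumes "covering_family n is \<pi>"
  obtains l where "\<And>k. k \<in> {1..n} \<Longrightarrow> l k 0 = k"
    "\<And>k j. k \<in> {1..n} \<Longrightarrow> j < length is \<Longrightarrow> level_step ((!) is) j (l k j) (l k (Suc j))"
    "\<And>k. k \<in> {1..n} \<Longrightarrow> \<pi> k = level_path ((!) is) (length is) (l k) 0"
proof -
  have "\<exists>l. l 0 = k \<and> (\<forall>j\<in>{0..<length is}. level_step ((!) is) j (l j) (l (Suc j))) \<and>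
    \<pi> k = level_path ((!) is) (length is) l 0" if k: "k \<in> {1..n}" for k
  proof -
    have p: "vpath (\<pi> k) (wiring_diagram n is)" "hd (\<pi> k) = Pt 0 k" "last (\<pi> k) \<in> Pt (length is) ` {1..n}"
      using assms k by (auto simp: covering_family_iff)
    then obtain h' where "last (\<pi> k) = Pt (length is) h'" by blast
    with p show ?thesis
      by (intro walk_levels[where h' = h' and n = n])
        (auto simp: vpath_def vwalk_def arcs_ends_wiring_diagram)
  qed
  then obtain l where "\<forall>k\<in>{1..n}. l k 0 = k \<and>
      (\<forall>j\<in>{0..<length is}. level_step ((!) is) j (l k j) (l k (Suc j))) \<and>
      \<pi> k = level_path ((!) is) (length is) (l k) 0"
    by metis
  then show thesis using that[of l] by auto
qed

text \<open>At each centre a covering family has only one binary choice, and this choice is recorded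
  by \<open>crossing\<close>. Induction on the diagrams from left to right then determines all
  levels.\<close>

lemma covering_family_eq:
  assumes cov: "covering_family n is \<pi>"
  shows "\<pi> = crossing_family n is {j. j < length is \<and> crossing n is \<pi> j}"
proof -
  let ?s = "(!) is" and ?m = "length is"
  define E where "E = {j. j < ?m \<and> crossing n is \<pi> j}"
  obtain l where l0: "\<And>k. k \<in> {1..n} \<Longrightarrow> l k 0 = k"
    and step: "\<And>k j. k \<in> {1..n} \<Longrightarrow> j < ?m \<Longrightarrow> level_step ?s j (l k j) (l k (Suc j))"
    and path: "\<And>k. k \<in> {1..n} \<Longrightarrow> \<pi> k = level_path ?s ?m (l k) 0"
    by (rule covering_family_levels[OF cov]) blast
  have levels: "\<forall>k\<in>{1..n}. l k j = level_at ?s E j k" if "j \<le> ?m" for j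
    using that
  proof (induction j)
    case 0
    then show ?case using l0 by simp
  next
    case (Suc j)
    let ?i = "is ! j"
    have IH: "l k j = level_at ?s E j k" if "k \<in> {1..n}" for k using Suc that by simp
    have j: "j < ?m" using Suc.prems by simp
    have i: "?i \<in> {1..n}" "Suc ?i \<in> {1..n}" using is_nth[OF j] by auto
    let ?a = "source_at ?s E j ?i" and ?b = "source_at ?s E j (Suc ?i)"
    have ab: "?a \<in> {1..n}" "?b \<in> {1..n}" using source_at_range[of j E] j i by auto
    have ne: "?a \<noteq> ?b" by (metis level_at_source_at n_not_Suc_n)
    have la: "l ?a j = ?i" "l ?b j = Suc ?i" using IH ab by simp_all
    have out: "l ?a (Suc j) \<in> {?i, Suc ?i}" "l ?b (Suc j) \<in> {?i, Suc ?i}"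
      using step[OF ab(1) j] step[OF ab(2) j] la by (auto simp: level_step_def)
    \<comment> \<open>Paths leaving the centre on the same level would share an arc, which the
      covering condition excludes.\<close>
    have "l ?a (Suc j) \<noteq> l ?b (Suc j)"
    proof
      assume eq: "l ?a (Suc j) = l ?b (Suc j)"
      let ?e = "(Centre j, Pt (Suc j) (l ?a (Suc j)))"
      have "?e \<in> set (vwalk_arcs (\<pi> ?a))" "?e \<in> set (vwalk_arcs (\<pi> ?b))"
        using ab la eq j by (auto simp: path arc_from_centre_in_level_path)
      moreover have "?e \<in> arcs (wiring_diagram n is)"
        using out(1) j by (auto simp: wiring_diagram_def elementary_arcs_def)
      ultimately show False using cov ab ne unfolding covering_family_iff by blast
    qed
    with out have or: "l ?a (Suc j) = ?i \<and> l ?b (Suc j) = Suc ?i \<or> l ?a (Suc j) = Suc ?i \<and> l ?b (Suc j) = ?i"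
      by auto
    have only: "k = ?a \<or> k = ?b" if "k \<in> {1..n}" "l k j \<in> {?i, Suc ?i}" for k
      using that IH by (auto simp: level_at_eq_iff)
    have cr: "crossing n is \<pi> j \<longleftrightarrow> l ?a (Suc j) = Suc ?i"
    proof
      assume "l ?a (Suc j) = Suc ?i"
      then have "l ?b (Suc j) = ?i" using or by auto
      with \<open>l ?a (Suc j) = Suc ?i\<close> show "crossing n is \<pi> j"
        unfolding crossing_def using ab la j
        by (intro conjI bexI[of _ ?a] bexI[of _ ?b]) (auto simp: path enters_level_path leaves_level_path)
    next
      assume "crossing n is \<pi> j"
      then obtain k where k: "k \<in> {1..n}" "enters (\<pi> k) j ?i" "leaves (\<pi> k) j (Suc ?i)"
        by (auto simp: crossing_def)
      then have "l k j = ?i" "l k (Suc j) = Suc ?i" by (auto simp: path enters_level_path leaves_level_path)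
      moreover have "k = ?a" using \<open>l k j = ?i\<close> IH[OF k(1)] by (metis level_at_eq_iff)
      ultimately show "l ?a (Suc j) = Suc ?i" by simp
    qed
    show ?case
    proof
      fix k assume k: "k \<in> {1..n}"
      show "l k (Suc j) = level_at ?s E (Suc j) k"
      proof (cases "l k j \<in> {?i, Suc ?i}")
        case False
        then have "l k (Suc j) = l k j" using step[OF k j] by (auto simp: level_step_def)
        then show ?thesis using False IH[OF k] by (auto simp: crossing_perm_def)
      next
        case True
        with only[OF k] consider "k = ?a" | "k = ?b" by blast
        then show ?thesis
          using or cr j by cases (auto simp: E_def crossing_perm_def)
      qed
    qed
  qed
  have "\<pi> k = crossing_family n is E k" for k
  proof (cases "k \<in> {1..n}")
    case True
    then show ?thesis
      using levels by (simp add: path crossing_family_apply) (rule level_path_cong; auto)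
  next
    case False
    then show ?thesis using cov by (auto simp: covering_family_iff crossing_family_def extensional_def)
  qed
  then show ?thesis unfolding E_def by blast
qed

end

section \<open>Column-strict tableaux\<close>

text \<open>In a weakly decreasing list the entries exceeding \<open>r\<close> form an initial
  segment.\<close>

lemma less_length_filter_greater:
  fixes \<mu> :: "nat list"
  assumes "sorted_wrt (\<ge>) \<mu>"
  shows "c < length (filter (\<lambda>p. r < p) \<mu>) \<longleftrightarrow> c < length \<mu> \<and> r < \<mu> ! c"
  using assms
proof (induction \<mu> arbitrary: c)
  case (Cons a \<mu>)
  show ?case
  proof (cases "r < a")
    case True
    then show ?thesis using Cons by (cases c) auto
  next
    case False
    then have "filter (\<lambda>p. r < p) (a # \<mu>) = []" using Cons.prems by (auto simp: filter_empty_conv)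
    moreover have "\<not> r < (a # \<mu>) ! c" if "c < length (a # \<mu>)"
      using that nth_mem[OF that] False Cons.prems by force
    ultimately show ?thesis by auto
  qed
qed simp

text \<open>Column \<open>c\<close> of the conjugate shape has \<open>\<mu> ! c\<close> cells, the
  size of colour class \<open>c\<close>. The row bound \<open>foldr max \<mu> 0\<close> built into
  \<open>conjugate\<close> follows from \<open>r < \<mu> ! c\<close>.\<close>

lemma young_diagram_conjugate:
  assumes "is_partition n \<mu>"
  shows "(r, c) \<in> young_diagram (conjugate \<mu>) \<longleftrightarrow> c < length \<mu> \<and> r < \<mu> ! c"
proof -
  have le: "x \<le> foldr max xs 0" if "x \<in> set xs" for x and xs :: "nat list"
    using that by (induction xs) auto
  have "r < foldr max \<mu> 0" if "c < length \<mu>" "r < \<mu> ! c"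
    using le[OF nth_mem[OF that(1)]] that(2) by simp
  then show ?thesis
    using less_length_filter_greater[of \<mu> c r] assms
    by (auto simp: young_diagram_def conjugate_def is_partition_def)
qed

lemma sorted_list_of_set_strict_mono_image:
  fixes f :: "nat \<Rightarrow> nat"
  assumes "\<And>r r'. r < r' \<Longrightarrow> r' < N \<Longrightarrow> f r < f r'"
  shows "sorted_list_of_set (f ` {..<N}) = map f [0..<N]"
proof (rule sorted_distinct_set_unique)
  have "sorted_wrt (<) (map f [0..<N])"
    unfolding sorted_wrt_iff_nth_less using assms by simp
  then show "sorted (map f [0..<N])" "distinct (map f [0..<N])" by (simp_all add: strict_sorted_iff)
qed auto

text \<open>The map is injective, hence a permutation of the finite set. Applying it to the
  increasing list of elements gives an increasing list of the same set, so the same list.\<close>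

lemma strict_mono_self_map_eq_id:
  fixes f :: "nat \<Rightarrow> nat"
  assumes "finite C" "f ` C \<subseteq> C" "\<And>a b. a \<in> C \<Longrightarrow> b \<in> C \<Longrightarrow> a < b \<Longrightarrow> f a < f b" "k \<in> C"
  shows "f k = k"
proof -
  let ?xs = "sorted_list_of_set C"
  have "inj_on f C" by (rule linorder_inj_onI) (use assms(3) in fastforce)+
  then have fC: "f ` C = C" using assms(1,2) by (intro endo_inj_surj)
  have "sorted_wrt (<) (map f ?xs)"
    unfolding sorted_wrt_iff_nth_less
  proof (intro allI impI)
    fix i j assume ij: "i < j" "j < length (map f ?xs)"
    then have "?xs ! i < ?xs ! j"
      using sorted_wrt_nth_less[OF strict_sorted_list_of_set[of C], of i j] by simp
    moreover have "?xs ! i \<in> C" "?xs ! j \<in> C"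
      using ij assms(1) nth_mem[of i ?xs] nth_mem[of j ?xs] by auto
    ultimately show "map f ?xs ! i < map f ?xs ! j" using assms(3) ij by simp
  qed
  then have "map f ?xs = ?xs"
    using assms(1) fC by (intro sorted_distinct_set_unique) (auto simp: strict_sorted_iff)
  then show ?thesis using assms(1,4) by (metis map_eq_conv map_ident set_sorted_list_of_set)
qed

context
  fixes n :: nat and "is" \<mu> :: "nat list"
  assumes is_range: "set is \<subseteq> {1..<n}" and mu: "is_partition n \<mu>"
begin

abbreviation (input) "s \<equiv> (!) is"
abbreviation (input) "m \<equiv> length is"
abbreviation (input) "D \<equiv> young_diagram (conjugate \<mu>)"
abbreviation (input) "colour_class g c \<equiv> {k \<in> {1..n}. g k = c}"

section \<open>The bijection between closed coloured walks and column-strict tableaux\<close>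

definition admissible :: "((nat \<Rightarrow> nat) \<times> nat set) set" where
  "admissible = {(g, E). g \<in> colourings n \<mu> \<and> E \<subseteq> {..<m} \<and> colour_at s E g m = g \<and>
        (\<forall>j<m. colour_at s E g j (s j) \<noteq> colour_at s E g j (Suc (s j)))}"

definition column_of :: "(nat \<Rightarrow> vertex list) \<Rightarrow> (nat \<times> nat \<Rightarrow> vertex list) \<Rightarrow> nat \<Rightarrow> nat" where
  "column_of \<pi> W = (\<lambda>k\<in>{1..n}. snd (inv_into D W (\<pi> k)))"

text \<open>Strictness leaves no freedom inside a column: once the set of its sources is known, row
  \<open>r\<close> must hold the path with the \<open>r\<close>-th smallest source, counted from
  0.\<close>

definition fill_columns :: "(nat \<Rightarrow> nat) \<Rightarrow> (nat \<Rightarrow> vertex list) \<Rightarrow> nat \<times> nat \<Rightarrow> vertex list" where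
  "fill_columns g \<pi> = restrict (\<lambda>(r, c). \<pi> (sorted_list_of_set (colour_class g c) ! r)) D"

lemma source_index_crossing_family: "k \<in> {1..n} \<Longrightarrow> source_index (crossing_family n is E k) = k"
  by (simp add: source_index_def crossing_family_apply hd_level_path)

lemma crossing_set_crossing_family:
  "E \<subseteq> {..<m} \<Longrightarrow> {j. j < m \<and> crossing n is (crossing_family n is E) j} = E"
  using crossing_crossing_family[OF is_range] by auto

text \<open>The path entering a centre from level \<open>h\<close> is the one with source
  \<open>source_at s E j h\<close>, and its column is the colour of that source. The hypotheses
  \<open>cell\<close> and \<open>path\<close> say that columns and colours agree in both
  directions.\<close>

lemma incross_eq:
  assumes E: "E \<subseteq> {..<m}"
    and cell: "\<And>k. k \<in> {1..n} \<Longrightarrow> \<exists>r. (r, g k) \<in> D \<and> W (r, g k) = crossing_family n is E k"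
    and path: "\<And>r c. (r, c) \<in> D \<Longrightarrow> \<exists>k\<in>{1..n}. W (r, c) = crossing_family n is E k \<and> g k = c"
  shows "incross n is (conjugate \<mu>) (crossing_family n is E) W =
    card {j. j < m \<and> j \<notin> E \<and> colour_at s E g j (Suc (s j)) < colour_at s E g j (s j)}"
proof -
  have "(\<exists>r c r' c'. (r, c) \<in> D \<and> (r', c') \<in> D \<and> enters (W (r, c)) j (is ! j + 1) \<and>
      enters (W (r', c')) j (is ! j) \<and> c < c') \<longleftrightarrow>
      colour_at s E g j (Suc (s j)) < colour_at s E g j (s j)" (is "?L \<longleftrightarrow> ?R") if j: "j < m" for j
  proof
    assume ?L
    then obtain r c r' c' where *: "(r, c) \<in> D" "(r', c') \<in> D" "enters (W (r, c)) j (is ! j + 1)"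
      "enters (W (r', c')) j (is ! j)" "c < c'" by blast
    obtain k k' where k: "k \<in> {1..n}" "W (r, c) = crossing_family n is E k" "g k = c"
      "k' \<in> {1..n}" "W (r', c') = crossing_family n is E k'" "g k' = c'"
      using path[OF *(1)] path[OF *(2)] by blast
    then have "k = source_at s E j (Suc (s j))" "k' = source_at s E j (s j)"
      using * enters_crossing_family[OF is_range k(1)] enters_crossing_family[OF is_range k(4)] by auto
    then show ?R using k *(5) by (simp add: colour_at_def)
  next
    assume R: ?R
    let ?a = "source_at s E j (Suc (s j))" and ?b = "source_at s E j (s j)"
    have "s j \<in> {1..<n}" by (rule is_nth[OF is_range j])
    then have ab: "?a \<in> {1..n}" "?b \<in> {1..n}" using source_at_range[OF is_range, of j E] j by auto
    obtain r r' where "(r, g ?a) \<in> D" "W (r, g ?a) = crossing_family n is E ?a"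
      "(r', g ?b) \<in> D" "W (r', g ?b) = crossing_family n is E ?b"
      using cell[OF ab(1)] cell[OF ab(2)] by blast
    then show ?L
      using R j enters_crossing_family[OF is_range ab(1), of E j] enters_crossing_family[OF is_range ab(2), of E j]
      by (intro exI[of _ r] exI[of _ "g ?a"] exI[of _ r'] exI[of _ "g ?b"]) (simp add: colour_at_def)
  qed
  moreover have "crossing n is (crossing_family n is E) j \<longleftrightarrow> j \<in> E" if "j < m" for j
    using crossing_crossing_family[OF is_range that] .
  ultimately show ?thesis
    unfolding incross_def by (intro arg_cong[of _ _ card]) blast
qed

lemma tableau_facts:
  assumes "(\<pi>, W) \<in> column_strict_tableaux n is (conjugate \<mu>)"
  defines "E \<equiv> {j. j < m \<and> crossing n is \<pi> j}" and "g \<equiv> column_of \<pi> W"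
  shows "\<pi> = crossing_family n is E"
    and "\<And>k. k \<in> {1..n} \<Longrightarrow> \<exists>r. (r, g k) \<in> D \<and> W (r, g k) = \<pi> k"
    and "\<And>r c. (r, c) \<in> D \<Longrightarrow> \<exists>k\<in>{1..n}. W (r, c) = \<pi> k \<and> g k = c"
proof -
  have G: "covering_family n is \<pi>" "bij_betw W D (\<pi> ` {1..n})"
    using assms(1) by (auto simp: column_strict_tableaux_def G_tableau_def)
  show \<pi>: "\<pi> = crossing_family n is E" unfolding E_def by (rule covering_family_eq[OF is_range G(1)])
  show "\<exists>r. (r, g k) \<in> D \<and> W (r, g k) = \<pi> k" if "k \<in> {1..n}" for k
  proof -
    have "\<pi> k \<in> W ` D" using G(2) that by (auto simp: bij_betw_def)
    then have "inv_into D W (\<pi> k) \<in> D" "W (inv_into D W (\<pi> k)) = \<pi> k"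
      by (rule inv_into_into, rule f_inv_into_f)
    then show ?thesis
      using that by (intro exI[of _ "fst (inv_into D W (\<pi> k))"]) (simp add: g_def column_of_def)
  qed
  show "\<exists>k\<in>{1..n}. W (r, c) = \<pi> k \<and> g k = c" if rc: "(r, c) \<in> D" for r c
  proof -
    have "W (r, c) \<in> \<pi> ` {1..n}" using G(2) rc by (auto simp: bij_betw_def)
    then obtain k where k: "k \<in> {1..n}" "W (r, c) = \<pi> k" by blast
    have "inv_into D W (W (r, c)) = (r, c)" using G(2) rc by (intro inv_into_f_f) (auto simp: bij_betw_def)
    then have "g k = c" using k by (simp add: g_def column_of_def)
    then show ?thesis using k by blast
  qed
qed

lemma tableau_colour_class:
  assumes TS: "(\<pi>, W) \<in> column_strict_tableaux n is (conjugate \<mu>)" and c: "c < length \<mu>"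
  shows "sorted_list_of_set (colour_class (column_of \<pi> W) c) =
    map (\<lambda>r. source_index (W (r, c))) [0..<\<mu> ! c]"
proof -
  note facts = tableau_facts[OF TS]
  have si: "source_index (\<pi> k) = k" if "k \<in> {1..n}" for k
    using source_index_crossing_family[OF that] facts(1) by metis
  have "colour_class (column_of \<pi> W) c = (\<lambda>r. source_index (W (r, c))) ` {..<\<mu> ! c}"
  proof (intro equalityI subsetI)
    fix k assume "k \<in> colour_class (column_of \<pi> W) c"
    then have k: "k \<in> {1..n}" "column_of \<pi> W k = c" by auto
    from facts(2)[OF k(1)] obtain r where "(r, c) \<in> D" "W (r, c) = \<pi> k" unfolding k(2) by blast
    then show "k \<in> (\<lambda>r. source_index (W (r, c))) ` {..<\<mu> ! c}"
      using si[OF k(1)] by (intro image_eqI[of _ _ r]) (simp_all add: young_diagram_conjugate[OF mu])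
  next
    fix k assume "k \<in> (\<lambda>r. source_index (W (r, c))) ` {..<\<mu> ! c}"
    then obtain r where r: "k = source_index (W (r, c))" "r < \<mu> ! c" by auto
    then have "(r, c) \<in> D" using c by (simp add: young_diagram_conjugate[OF mu])
    from facts(3)[OF this] obtain k' where k': "k' \<in> {1..n}" "W (r, c) = \<pi> k'" "column_of \<pi> W k' = c"
      by blast
    then show "k \<in> colour_class (column_of \<pi> W) c" using r si[OF k'(1)] by simp
  qed
  moreover have "source_index (W (r, c)) < source_index (W (r', c))" if "r < r'" "r' < \<mu> ! c" for r r'
  proof -
    have "(r, c) \<in> D" "(r', c) \<in> D" using that c by (simp_all add: young_diagram_conjugate[OF mu])
    then show ?thesis using TS that(1) unfolding column_strict_tableaux_def column_strict_def by blast
  qed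
  ultimately show ?thesis by (simp add: sorted_list_of_set_strict_mono_image)
qed

lemma tableau_to_admissible:
  assumes TS: "(\<pi>, W) \<in> column_strict_tableaux n is (conjugate \<mu>)"
  defines "E \<equiv> {j. j < m \<and> crossing n is \<pi> j}" and "g \<equiv> column_of \<pi> W"
  shows "(g, E) \<in> admissible"
    and "fill_columns g \<pi> = W"
    and "walk_weight s E g m = q ^ incross n is (conjugate \<mu>) \<pi> W * q_half ^ cross n is \<pi>"
proof -
  note facts = tableau_facts[OF TS, folded E_def g_def]
  note col_class = tableau_colour_class[OF TS, folded g_def]
  have E: "E \<subseteq> {..<m}" by (auto simp: E_def)
  have gext: "g \<in> extensional {1..n}" by (simp add: g_def column_of_def)
  have g_less: "g k < length \<mu>" if "k \<in> {1..n}" for k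
    using facts(2)[OF that] by (auto simp: young_diagram_conjugate[OF mu])
  have "card (colour_class g c) = \<mu> ! c" if "c < length \<mu>" for c
    using arg_cong[OF col_class[OF that], of length] by simp
  moreover have "g \<in> {1..n} \<rightarrow>\<^sub>E {..<length \<mu>}"
    using gext g_less by (intro PiE_I) (auto simp: extensional_def)
  ultimately have col: "g \<in> colourings n \<mu>"
    by (simp add: colourings_def)
  have strict: "source_index (W (r, c)) < source_index (W (r', c)) \<and> set (W (r, c)) \<inter> set (W (r', c)) = {}"
    if "(r, c) \<in> D" "(r', c) \<in> D" "r < r'" for r r' c
    using TS that unfolding column_strict_tableaux_def column_strict_def by blast
  \<comment> \<open>Both paths at this point pass through \<open>Centre j\<close>. Equal colours
    would put them into one column, where disjoint vertex sets are required.\<close>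
  have nomeet: "colour_at s E g j (s j) \<noteq> colour_at s E g j (Suc (s j))" if j: "j < m" for j
  proof
    assume eq: "colour_at s E g j (s j) = colour_at s E g j (Suc (s j))"
    let ?a = "source_at s E j (s j)" and ?b = "source_at s E j (Suc (s j))"
    have "s j \<in> {1..<n}" by (rule is_nth[OF is_range j])
    then have ab: "?a \<in> {1..n}" "?b \<in> {1..n}" using source_at_range[OF is_range, of j E] j by auto
    have ne: "?a \<noteq> ?b" by (metis level_at_source_at n_not_Suc_n)
    have gg: "g ?b = g ?a" using eq by (simp add: colour_at_def)
    from facts(2)[OF ab(1)] facts(2)[OF ab(2)] gg
    obtain r r' where r: "(r, g ?a) \<in> D" "W (r, g ?a) = \<pi> ?a" "(r', g ?a) \<in> D" "W (r', g ?a) = \<pi> ?b" by auto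
    have si: "source_index (\<pi> ?a) = ?a" "source_index (\<pi> ?b) = ?b"
      using source_index_crossing_family[OF ab(1)] source_index_crossing_family[OF ab(2)] facts(1) by metis+
    have "r \<noteq> r'" using r si ne by metis
    then have "set (\<pi> ?a) \<inter> set (\<pi> ?b) = {}"
      using strict[OF r(1,3)] strict[OF r(3,1)] r(2,4) by (metis Int_commute linorder_neqE_nat)
    moreover have "Centre j \<in> set (\<pi> ?a)" "Centre j \<in> set (\<pi> ?b)"
      unfolding facts(1) using ab j by (auto simp: crossing_family_apply set_level_path)
    ultimately show False by blast
  qed
  \<comment> \<open>Here the type of the tableau enters: every path returns to its own level.
    Outside \<open>{1..n}\<close> both sides are the default value of an extensional
    function.\<close>
  have "colour_at s E g m = g"
  proof
    fix h
    show "colour_at s E g m h = g h"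
    proof (cases "h \<in> {1..n}")
      case True
      have "family_type n \<pi> h = h" using TS True by (simp add: column_strict_tableaux_def has_type_id_def)
      then have "level (last (\<pi> h)) = h" using True by (simp add: family_type_def)
      then have "level_at s E m h = h" unfolding facts(1) using True by (simp add: crossing_family_apply)
      then show ?thesis by (metis colour_at_def source_at_level_at)
    next
      case False
      then have "source_at s E m h \<notin> {1..n}" using source_at_range[OF is_range order_refl] by blast
      then show ?thesis using False gext by (auto simp: colour_at_def extensional_def)
    qed
  qed
  then show "(g, E) \<in> admissible" using col E nomeet by (simp add: admissible_def)
  show "fill_columns g \<pi> = W"
  proof
    fix x :: "nat \<times> nat"
    obtain r c where x: "x = (r, c)" by (cases x)
    show "fill_columns g \<pi> x = W x"
    proof (cases "x \<in> D")
      case True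
      then have rc: "c < length \<mu>" "r < \<mu> ! c" by (simp_all add: x young_diagram_conjugate[OF mu])
      from facts(3)[OF True[unfolded x]] obtain k where k: "k \<in> {1..n}" "W (r, c) = \<pi> k" by blast
      have "source_index (W (r, c)) = k" using source_index_crossing_family[OF k(1)] k(2) facts(1) by metis
      moreover have "sorted_list_of_set (colour_class g c) ! r = source_index (W (r, c))"
        unfolding col_class[OF rc(1)] using rc(2) by simp
      ultimately show ?thesis using True k by (simp add: fill_columns_def x)
    next
      case False
      have "W \<in> extensional D" using TS by (simp add: column_strict_tableaux_def G_tableau_def)
      then have "W x = undefined" using False by (rule extensional_arb)
      moreover have "fill_columns g \<pi> x = undefined" using False by (simp only: fill_columns_def restrict_apply if_False)
      ultimately show ?thesis by (simp only:)
    qed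
  qed
  have "incross n is (conjugate \<mu>) \<pi> W =
      card {j. j < m \<and> j \<notin> E \<and> colour_at s E g j (Suc (s j)) < colour_at s E g j (s j)}"
    using incross_eq[OF E, of g W] facts by metis
  moreover have "cross n is \<pi> = card E" by (simp add: cross_def E_def)
  ultimately show "walk_weight s E g m = q ^ incross n is (conjugate \<mu>) \<pi> W * q_half ^ cross n is \<pi>"
    using walk_weight_eq[of m s E g] nomeet E by simp
qed

text \<open>Two paths can exchange their order only on adjacent levels at a common centre, and the
  hypothesis keeps equal colours from meeting there.\<close>

lemma same_colour_order:
  assumes "\<forall>j<m. colour_at s E g j (s j) \<noteq> colour_at s E g j (Suc (s j))" "a < b" "g a = g b" "j \<le> m"
  shows "level_at s E j a < level_at s E j b"
  using assms(4)
proof (induction j)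
  case 0
  then show ?case using assms(2) by simp
next
  case (Suc j)
  then have IH: "level_at s E j a < level_at s E j b" and j: "j < m" by simp_all
  have "\<not> (level_at s E j a = s j \<and> level_at s E j b = Suc (s j))"
    using assms(1,3) j by (auto simp: level_at_eq_iff colour_at_def)
  then show ?case using IH by (auto simp: crossing_perm_def transpose_def)
qed

lemma admissible_to_tableau:
  assumes adm: "(g, E) \<in> admissible"
  defines "\<pi> \<equiv> crossing_family n is E"
  defines "W \<equiv> fill_columns g \<pi>"
  shows "(\<pi>, W) \<in> column_strict_tableaux n is (conjugate \<mu>)"
    and "column_of \<pi> W = g"
proof -
  have g: "g \<in> colourings n \<mu>" and E: "E \<subseteq> {..<m}" and closed: "colour_at s E g m = g"
    and nomeet: "\<forall>j<m. colour_at s E g j (s j) \<noteq> colour_at s E g j (Suc (s j))"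
    using adm by (auto simp: admissible_def)
  have card: "card (colour_class g c) = \<mu> ! c" if "c < length \<mu>" for c
    using g that by (simp add: colourings_def)
  have g_less: "g k < length \<mu>" if "k \<in> {1..n}" for k using g that by (auto simp: colourings_def)
  let ?src = "\<lambda>r c. sorted_list_of_set (colour_class g c) ! r"
  have src: "?src r c \<in> {1..n}" "g (?src r c) = c" if "(r, c) \<in> D" for r c
  proof -
    have "?src r c \<in> set (sorted_list_of_set (colour_class g c))"
      using that card by (intro nth_mem) (simp add: young_diagram_conjugate[OF mu])
    then show "?src r c \<in> {1..n}" "g (?src r c) = c" by simp_all
  qed
  have src_less: "?src r c < ?src r' c" if "(r, c) \<in> D" "(r', c) \<in> D" "r < r'" for r r' c
    using that card sorted_wrt_nth_less[OF strict_sorted_list_of_set[of "colour_class g c"], of r r']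
    by (simp add: young_diagram_conjugate[OF mu])
  have src_surj: "\<exists>r. (r, g k) \<in> D \<and> ?src r (g k) = k" if k: "k \<in> {1..n}" for k
  proof -
    have "k \<in> set (sorted_list_of_set (colour_class g (g k)))" using k by simp
    then obtain r where "r < length (sorted_list_of_set (colour_class g (g k)))" "?src r (g k) = k"
      unfolding in_set_conv_nth by blast
    then show ?thesis using g_less[OF k] card[OF g_less[OF k]] by (auto simp: young_diagram_conjugate[OF mu])
  qed
  have W: "W (r, c) = \<pi> (?src r c)" if "(r, c) \<in> D" for r c
    using that by (simp add: W_def fill_columns_def)
  have si: "source_index (\<pi> k) = k" if "k \<in> {1..n}" for k
    unfolding \<pi>_def by (rule source_index_crossing_family[OF that])
  have inj: "inj_on W D"
  proof (rule inj_onI)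
    fix x y assume xy: "x \<in> D" "y \<in> D" "W x = W y"
    obtain r c r' c' where e: "x = (r, c)" "y = (r', c')" by (cases x, cases y)
    have rc: "(r, c) \<in> D" "(r', c') \<in> D" using xy unfolding e by blast+
    have "source_index (\<pi> (?src r c)) = source_index (\<pi> (?src r' c'))"
      using xy(3) unfolding e W[OF rc(1)] W[OF rc(2)] by (rule arg_cong)
    then have k: "?src r c = ?src r' c'"
      unfolding si[OF src(1)[OF rc(1)]] si[OF src(1)[OF rc(2)]] .
    have c: "c = c'" using src(2)[OF rc(1)] src(2)[OF rc(2)] unfolding k by (rule trans[OF sym])
    note rc' = rc(1)[unfolded c] and k' = k[unfolded c]
    have "\<not> r < r'"
    proof
      assume "r < r'"
      from src_less[OF rc' rc(2) this] show False unfolding k' by (simp only: less_irrefl)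
    qed
    moreover have "\<not> r' < r"
    proof
      assume "r' < r"
      from src_less[OF rc(2) rc' this] show False unfolding k' by (simp only: less_irrefl)
    qed
    ultimately show "x = y" by (simp add: e c)
  qed
  have "W ` D = \<pi> ` {1..n}"
  proof (intro equalityI subsetI)
    fix p assume "p \<in> W ` D"
    then obtain r c where "(r, c) \<in> D" "p = W (r, c)" by auto
    then show "p \<in> \<pi> ` {1..n}" using W src by blast
  next
    fix p assume "p \<in> \<pi> ` {1..n}"
    then obtain k where k: "k \<in> {1..n}" "p = \<pi> k" by blast
    from src_surj[OF k(1)] obtain r where r: "(r, g k) \<in> D" "?src r (g k) = k" by blast
    have "p = W (r, g k)" unfolding W[OF r(1)] r(2) k(2) ..
    then show "p \<in> W ` D" using r(1) by (rule image_eqI)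
  qed
  then have bij: "bij_betw W D (\<pi> ` {1..n})" using inj by (simp add: bij_betw_def)
  \<comment> \<open>Closedness of the walk only says that \<open>level_at s E m\<close> maps each
    colour class to itself. As it also preserves the order within the finite class, it is the
    identity there.\<close>
  have "level_at s E m k = k" if k: "k \<in> {1..n}" for k
  proof (rule strict_mono_self_map_eq_id[of "colour_class g (g k)"])
    have "g (level_at s E m l) = g l" for l
      using fun_cong[OF closed, of "level_at s E m l"] by (simp add: colour_at_def)
    then show "level_at s E m ` colour_class g (g k) \<subseteq> colour_class g (g k)"
      using level_at_range[OF is_range order_refl, of E] by auto
    show "level_at s E m a < level_at s E m b"
      if "a \<in> colour_class g (g k)" "b \<in> colour_class g (g k)" "a < b" for a b
      using that by (intro same_colour_order[OF nomeet]) auto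
  qed (use k in auto)
  then have type_id: "has_type_id n \<pi>"
    by (auto simp: has_type_id_def family_type_def \<pi>_def crossing_family_apply)
  \<comment> \<open>At a common point the two levels would coincide, against the preserved order; at
    a common centre they would be the adjacent levels of that diagram, and equal colours would
    meet.\<close>
  have disjoint: "set (\<pi> a) \<inter> set (\<pi> b) = {}"
    if ab: "a \<in> {1..n}" "b \<in> {1..n}" "g a = g b" "a < b" for a b
  proof (rule ccontr)
    assume "set (\<pi> a) \<inter> set (\<pi> b) \<noteq> {}"
    then obtain v where v: "v \<in> set (\<pi> a)" "v \<in> set (\<pi> b)" by blast
    have lt: "level_at s E j a < level_at s E j b" if "j \<le> m" for j
      using ab that by (intro same_colour_order[OF nomeet]) auto
    show False
    proof (cases v)
      case (Pt j h)
      then show False using v ab lt[of j] by (auto simp: \<pi>_def crossing_family_apply set_level_path)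
    next
      case (Centre j)
      then have j: "j < m" "level_at s E j a \<in> {s j, Suc (s j)}" "level_at s E j b \<in> {s j, Suc (s j)}"
        using v ab by (auto simp: \<pi>_def crossing_family_apply set_level_path)
      then have "level_at s E j a = s j" "level_at s E j b = Suc (s j)" using lt[of j] by auto
      then have "colour_at s E g j (s j) = colour_at s E g j (Suc (s j))"
        using ab(3) by (metis colour_at_def source_at_level_at)
      then show False using nomeet j(1) by blast
    qed
  qed
  have "column_strict (conjugate \<mu>) W"
    unfolding column_strict_def
  proof (intro allI impI, elim conjE)
    fix r r' c assume rc: "(r, c) \<in> D" "(r', c) \<in> D" "r < r'"
    note less = src_less[OF rc]
    show "source_index (W (r, c)) < source_index (W (r', c)) \<and> set (W (r, c)) \<inter> set (W (r', c)) = {}"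
      using less src[OF rc(1)] src[OF rc(2)] disjoint[OF src(1)[OF rc(1)] src(1)[OF rc(2)]]
      unfolding W[OF rc(1)] W[OF rc(2)] by (simp add: si)
  qed
  then show "(\<pi>, W) \<in> column_strict_tableaux n is (conjugate \<mu>)"
    unfolding column_strict_tableaux_def G_tableau_def
    using bij type_id crossing_family_covering[OF is_range, of E]
    by (auto simp: \<pi>_def W_def fill_columns_def)
  show "column_of \<pi> W = g"
  proof
    fix k
    show "column_of \<pi> W k = g k"
    proof (cases "k \<in> {1..n}")
      case True
      then obtain r where r: "(r, g k) \<in> D" "?src r (g k) = k" using src_surj by blast
      then have "inv_into D W (\<pi> k) = (r, g k)" using inv_into_f_f[OF inj r(1)] W[OF r(1)] by simp
      then show ?thesis using True by (simp add: column_of_def)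
    next
      case False
      then show ?thesis using g by (auto simp: column_of_def colourings_def PiE_def extensional_def)
    qed
  qed
qed

text \<open>The witnesses are inverse to each other because a covering family is determined by its
  crossings and a column-strict filling by the column of each path.\<close>

lemma sum_admissible_eq_sum_tableaux:
  "(\<Sum>(g, E)\<in>admissible. walk_weight s E g m) =
    (\<Sum>(\<pi>, W) \<in> column_strict_tableaux n is (conjugate \<mu>).
       q ^ incross n is (conjugate \<mu>) \<pi> W * q_half ^ cross n is \<pi>)"
proof (rule sum.reindex_bij_witness[symmetric])
  let ?i = "\<lambda>(g, E). (crossing_family n is E, fill_columns g (crossing_family n is E))"
  let ?j = "\<lambda>(\<pi>, W). (column_of \<pi> W, {j. j < m \<and> crossing n is \<pi> j})"
  fix x assume x: "x \<in> column_strict_tableaux n is (conjugate \<mu>)"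
  obtain \<pi> W where e: "x = (\<pi>, W)" by (cases x)
  note t = tableau_to_admissible[OF x[unfolded e]] and f = tableau_facts(1)[OF x[unfolded e]]
  show "?i (?j x) = x" using t(2) f[symmetric] by (simp add: e)
  show "?j x \<in> admissible" using t(1) by (simp add: e)
  show "(case ?j x of (g, E) \<Rightarrow> walk_weight s E g m) =
      (case x of (\<pi>, W) \<Rightarrow> q ^ incross n is (conjugate \<mu>) \<pi> W * q_half ^ cross n is \<pi>)"
    using t(3) by (simp add: e)
next
  let ?i = "\<lambda>(g, E). (crossing_family n is E, fill_columns g (crossing_family n is E))"
  let ?j = "\<lambda>(\<pi>, W). (column_of \<pi> W, {j. j < m \<and> crossing n is \<pi> j})"
  fix y assume y: "y \<in> admissible"
  obtain g E where e: "y = (g, E)" by (cases y)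
  note a = admissible_to_tableau[OF y[unfolded e]]
  have "E \<subseteq> {..<m}" using y by (simp add: e admissible_def)
  then show "?j (?i y) = y" using a(2) by (simp add: e crossing_set_crossing_family)
  show "?i y \<in> column_strict_tableaux n is (conjugate \<mu>)" using a(1) by (simp add: e)
qed

end

theorem theorem5p4:
  fixes n :: nat and "is" :: "nat list" and \<mu> :: "nat list"
  assumes "set is \<subseteq> {1..<n}"
    and "is_partition n \<mu>"
  shows "induced_sign_character n \<mu> (one_plus_T_product n is) =
    (\<Sum>(\<pi>, W) \<in> column_strict_tableaux n is (conjugate \<mu>).
       q ^ incross n is (conjugate \<mu>) \<pi> W * q_half ^ cross n is \<pi>)"
proof -
  have mu: "sum_list \<mu> = n" using assms(2) by (simp add: is_partition_def)
  have "induced_sign_character n \<mu> (one_plus_T_product n is) =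
      (\<Sum>f\<in>colourings n \<mu>. foldr one_plus_T_act (map ((!) is) [0..<length is]) (delta f) f)"
    unfolding map_nth by (rule induced_sign_character_one_plus_T[OF mu assms(1)])
  also have "\<dots> = (\<Sum>(g, E)\<in>admissible n is \<mu>. walk_weight ((!) is) E g (length is))"
    unfolding admissible_def[OF assms] by (rule sum_foldr_delta[OF finite_colourings])
  also have "\<dots> = (\<Sum>(\<pi>, W) \<in> column_strict_tableaux n is (conjugate \<mu>).
       q ^ incross n is (conjugate \<mu>) \<pi> W * q_half ^ cross n is \<pi>)"
    by (rule sum_admissible_eq_sum_tableaux[OF assms])
  finally show ?thesis .
qed

end
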